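(* Let $\alpha\in(1,2)$ and $\varepsilon\in(0,1)$ be fixed, and consider the random graph model M2 with parameter $\alpha$ on $n$ nodes. Let $q_c>0$, $q_l>0$, $|r|\le q_c$ be fixed with $2q_c+q_l\le 1$, let $d=d(\alpha)$, and let $P$ be the transition matrix of the homogeneous Markov chain with parameters $q_c,q_l,r,d$ on a random graph from M2. (1) If $r=0$ (the reversible homogeneous chain), then there are constants $c_1,c_2>0$ not depending on $n$ such that asymptotically almost surely as $n\to\infty$ $$c_1 n^{2\alpha-2}\log^2 n < t_{\rm mix}(P,\varepsilon) < c_2\, d(\alpha)^2\, n^{2\alpha-2}\log^3 n .$$ (2) If $r\neq0$ (non-reversible homogeneous chain) and the chain is lazy asymptotically almost surely, then there are constants $c_1,c_2>0$ not depending on $n$ such that asymptotically almost surely as $n\to\infty$ $$c_1 n^{\alpha-1}\log n < t_{\rm mix}(P,\varepsilon) < c_2\, d(\alpha)^2\, n^{2\alpha-2}\log^3 n .$$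
   Context: Mixing time: for a Markov chain with transition matrix $P$ on a finite set $\mathcal X$ with unique stationary distribution $\pi$, $t_{\rm mix}(P,\varepsilon)=\max_{\sigma}\min\{k:\|\sigma P^k-\pi\|_{\rm TV}\le\varepsilon\}$, the maximum being over probability distributions $\sigma$ on $\mathcal X$, where $\|\mu-\nu\|_{\rm TV}=\max_{A\subseteq\mathcal X}|\mu(A)-\nu(A)|$. A chain is lazy if $p_{ii}\ge 1/2$ for all states $i$. Model M2: start with the cycle on the nodes $0,1,\dots,n-1$ (node $i$ adjacent to $i\pm1$ mod $n$). From all $\binom n2$ pairs of distinct nodes draw a subset of size $\lceil n^{2-\alpha}\rceil$ uniformly at random, and add these pairs as edges, called long range edges. Pairs that are edges of the cycle are allowed to be chosen as long range edges. Homogeneous chain with parameters $q_c,q_l,r,d$: every clockwise transition along the cycle has probability $q_c+r$, every counterclockwise transition along the cycle has probability $q_c-r$, each long range edge is used (in each direction) with probability $q_l/d$, and with the remaining probability the chain stays put. If a long range edge coincides with a cycle edge, the probabilities add up. Its stationary distribution is uniform. $d(\alpha)$ denotes a fixed constant, depending only on $\alpha$, such that asymptotically almost surely no node of the random graph has more than $d(\alpha)$ long range edges (such a constant exists; with $d=d(\alpha)$ and $2q_c+q_l\le1$ the homogeneous chain is a proper Markov chain asymptotically almost surely). "Asymptotically almost surely" means with probability tending to 1 as $n\to\infty$. Constants may depend on the fixed parameters $\alpha,\varepsilon,q_c,q_l,r$ but not on $n$. *)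

theory Defs
  imports "HOL-Probability.Probability"
begin

text \<open>
  A transition matrix on a finite set \<open>X\<close> is a real-valued function \<open>P\<close> of two states. It is not
  required to be stochastic, since the chain on the random graph is a proper Markov chain only
  asymptotically almost surely.
\<close>

primrec transition_power ::
  "'a set \<Rightarrow> ('a \<Rightarrow> 'a \<Rightarrow> real) \<Rightarrow> nat \<Rightarrow> 'a \<Rightarrow> 'a \<Rightarrow> real" where
  "transition_power X P 0 = (\<lambda>x y. if x = y then 1 else 0)"
| "transition_power X P (Suc k) = (\<lambda>x y. \<Sum>z\<in>X. transition_power X P k x z * P z y)"

definition row_mult ::
  "'a set \<Rightarrow> 'a pmf \<Rightarrow> ('a \<Rightarrow> 'a \<Rightarrow> real) \<Rightarrow> 'a \<Rightarrow> real" where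
  "row_mult X \<sigma> M y = (\<Sum>x\<in>X. pmf \<sigma> x * M x y)"

definition stationary :: "'a set \<Rightarrow> ('a \<Rightarrow> 'a \<Rightarrow> real) \<Rightarrow> 'a pmf \<Rightarrow> bool" where
  "stationary X P \<pi> \<longleftrightarrow> set_pmf \<pi> \<subseteq> X \<and> (\<forall>y\<in>X. row_mult X \<pi> P y = pmf \<pi> y)"

definition stationary_distribution :: "'a set \<Rightarrow> ('a \<Rightarrow> 'a \<Rightarrow> real) \<Rightarrow> 'a pmf" where
  "stationary_distribution X P = (THE \<pi>. stationary X P \<pi>)"

definition total_variation :: "'a set \<Rightarrow> ('a \<Rightarrow> real) \<Rightarrow> ('a \<Rightarrow> real) \<Rightarrow> real" where
  "total_variation X \<mu> \<nu> = (MAX A\<in>Pow X. \<bar>sum \<mu> A - sum \<nu> A\<bar>)"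

text \<open>
  The value lies in \<^typ>\<open>enat\<close>, so that it is \<open>\<infinity>\<close> when some initial distribution never comes
  within \<open>\<epsilon>\<close> of the stationary one. A finite supremum is attained and hence is a maximum; the
  infimum of a nonempty set is its minimum.
\<close>

definition mixing_time :: "'a set \<Rightarrow> ('a \<Rightarrow> 'a \<Rightarrow> real) \<Rightarrow> real \<Rightarrow> enat" where
  "mixing_time X P \<epsilon> =
     (SUP \<sigma>\<in>{\<sigma>. set_pmf \<sigma> \<subseteq> X}.
        INF k\<in>{k. total_variation X (row_mult X \<sigma> (transition_power X P k))
                    (pmf (stationary_distribution X P)) \<le> \<epsilon>}. enat k)"

definition lazy :: "'a set \<Rightarrow> ('a \<Rightarrow> 'a \<Rightarrow> real) \<Rightarrow> bool" where
  "lazy X P \<longleftrightarrow> (\<forall>x\<in>X. P x x \<ge> 1/2)"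

definition asymptotically_almost_surely ::
  "(nat \<Rightarrow> 'a pmf) \<Rightarrow> (nat \<Rightarrow> 'a \<Rightarrow> bool) \<Rightarrow> bool" where
  "asymptotically_almost_surely M Q \<longleftrightarrow>
     (\<lambda>n. measure_pmf.prob (M n) {\<omega>. Q n \<omega>}) \<longlonglongrightarrow> 1"

definition node_pairs :: "nat \<Rightarrow> nat set set" where
  "node_pairs n = {e. e \<subseteq> {..<n} \<and> card e = 2}"

text \<open>
  An outcome of the model is the set of long range edges; the cycle edges are deterministic. For
  the finitely many \<open>n\<close> with fewer than \<open>\<lceil>n\<^sup>2\<^sup>-\<^sup>\<alpha>\<rceil>\<close> pairs the distribution is unspecified.
\<close>

definition M2 :: "real \<Rightarrow> nat \<Rightarrow> nat set set pmf" where
  "M2 \<alpha> n = pmf_of_set {E. E \<subseteq> node_pairs n \<and> card E = nat \<lceil>real n powr (2 - \<alpha>)\<rceil>}"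

definition long_range_degree :: "nat set set \<Rightarrow> nat \<Rightarrow> nat" where
  "long_range_degree E i = card {e\<in>E. i \<in> e}"

text \<open>
  Clockwise is the direction from \<open>i\<close> to \<open>i + 1\<close> modulo \<open>n\<close>.
\<close>

definition edge_prob ::
  "nat \<Rightarrow> nat set set \<Rightarrow> real \<Rightarrow> real \<Rightarrow> real \<Rightarrow> real \<Rightarrow> nat \<Rightarrow> nat \<Rightarrow> real" where
  "edge_prob n E q\<^sub>c q\<^sub>l r d i j =
     (if j = (i + 1) mod n then q\<^sub>c + r else 0) +
     (if i = (j + 1) mod n then q\<^sub>c - r else 0) +
     (if {i, j} \<in> E then q\<^sub>l / d else 0)"

definition homogeneous_chain ::
  "nat \<Rightarrow> nat set set \<Rightarrow> real \<Rightarrow> real \<Rightarrow> real \<Rightarrow> real \<Rightarrow> nat \<Rightarrow> nat \<Rightarrow> real" where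
  "homogeneous_chain n E q\<^sub>c q\<^sub>l r d i j =
     (if i = j then 1 - (\<Sum>k\<in>{..<n} - {i}. edge_prob n E q\<^sub>c q\<^sub>l r d i k)
      else edge_prob n E q\<^sub>c q\<^sub>l r d i j)"

end

theory Submission
  imports Defs "HOL-Real_Asymp.Real_Asymp"
begin

text \<open>
  The chain \<open>P\<close> is doubly stochastic, so one step decreases \<open>\<parallel>\<sigma>P\<^sup>k - \<pi>\<parallel>\<^sup>2\<close> by the Dirichlet form of the
  symmetric kernel \<open>PP\<^sup>T\<close>, which Cheeger's inequality bounds below through the weights of cuts.
  Divide the cycle into blocks of length \<open>l\<close> of order \<open>n\<^sup>\<alpha>\<^sup>-\<^sup>1 log n\<close>. By a union bound, asymptotically
  almost surely every set of blocks that is not too large is joined by long range edges to the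
  blocks outside. Hence a set of at most half the nodes either splits many of the blocks it meets
  or has many bridges from its full blocks to empty ones, and each such block contributes a
  constant to the cut. This gives a Cheeger constant of order \<open>1/l\<close> and mixing in time of order
  \<open>l\<^sup>2 log n\<close>.

  For the lower bound, the second moment method finds an interval of length of order
  \<open>n\<^sup>\<alpha>\<^sup>-\<^sup>1 log n\<close> without long range edges. From its midpoint the chain needs of order the
  length (the squared length if \<open>r = 0\<close>) steps to leave it, because the truncated distance (its
  square) to the midpoint grows by at most 1 per step in expectation.
\<close>

section \<open>Cheeger's inequality and mixing of doubly stochastic chains\<close>

text \<open>The kernel \<open>P P^T\<close> is forced by \<open>r \<noteq> 0\<close>: then
  \<open>P\<close> is not reversible, but the energy identity for \<open>P P^T\<close> is exact and
  asks only for double stochasticity. The price is that a cut gets weight only at a node which is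
  entered in one step from both sides. A lazy chain enters every node from itself; without laziness
  a set may alternate along the cycle and receive nothing there. For \<open>r = 0\<close> this is
  repaired by nodes without long range edges: they hold with probability at least
  \<open>q\<^sub>l\<close>, and asymptotically almost surely every window of a certain bounded
  length contains one.

  The order of \<open>l\<close> comes from the union bound: a block must have of order
  \<open>ln n\<close> long range edges on average for connectedness to survive the number of sets of
  blocks. The longest intervals without such edges have the same order, so for \<open>r = 0\<close>
  the two bounds differ by one logarithm only, the cost of passing from the Euclidean norm to total
  variation.\<close>

definition dirichlet_form :: "'a set \<Rightarrow> ('a \<Rightarrow> 'a \<Rightarrow> real) \<Rightarrow> ('a \<Rightarrow> real) \<Rightarrow> real" where
  "dirichlet_form X Q f = (\<Sum>x\<in>X. \<Sum>z\<in>X. Q x z * (f x - f z)^2) / 2"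

definition cut_weight :: "'a set \<Rightarrow> ('a \<Rightarrow> 'a \<Rightarrow> real) \<Rightarrow> 'a set \<Rightarrow> real" where
  "cut_weight X Q A = (\<Sum>x\<in>X. \<Sum>z\<in>X. Q x z * of_bool (x \<in> A \<and> z \<notin> A))"

lemma sum_kernel_flip:
  fixes Q :: "'a \<Rightarrow> 'a \<Rightarrow> real"
  assumes sym: "\<And>x z. x \<in> X \<Longrightarrow> z \<in> X \<Longrightarrow> Q x z = Q z x"
  shows "(\<Sum>x\<in>X. \<Sum>z\<in>X. Q x z * F x z) = (\<Sum>x\<in>X. \<Sum>z\<in>X. Q x z * F z x)"
proof -
  have "(\<Sum>x\<in>X. \<Sum>z\<in>X. Q x z * F x z) = (\<Sum>z\<in>X. \<Sum>x\<in>X. Q x z * F x z)"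
    by (rule sum.swap)
  also have "\<dots> = (\<Sum>x\<in>X. \<Sum>z\<in>X. Q x z * F z x)"
    by (intro sum.cong refl) (simp add: sym)
  finally show ?thesis .
qed

lemma cut_weight_abs:
  fixes Q :: "'a \<Rightarrow> 'a \<Rightarrow> real"
  assumes sym: "\<And>x z. x \<in> X \<Longrightarrow> z \<in> X \<Longrightarrow> Q x z = Q z x"
  shows "(\<Sum>x\<in>X. \<Sum>z\<in>X. Q x z * \<bar>of_bool (x \<in> A) - of_bool (z \<in> A)\<bar>) = 2 * cut_weight X Q A"
proof -
  have "(\<Sum>x\<in>X. \<Sum>z\<in>X. Q x z * \<bar>of_bool (x \<in> A) - of_bool (z \<in> A)\<bar>)
      = (\<Sum>x\<in>X. \<Sum>z\<in>X. Q x z * of_bool (x \<in> A \<and> z \<notin> A)) + (\<Sum>x\<in>X. \<Sum>z\<in>X. Q x z * of_bool (z \<in> A \<and> x \<notin> A))"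
    unfolding sum.distrib[symmetric] by (intro sum.cong refl) auto
  also have "(\<Sum>x\<in>X. \<Sum>z\<in>X. Q x z * of_bool (z \<in> A \<and> x \<notin> A)) = cut_weight X Q A"
    unfolding cut_weight_def by (subst sum_kernel_flip[OF sym]) auto
  finally show ?thesis by (simp add: cut_weight_def)
qed

text \<open>A layer decomposition replaces the integral over level sets: peeling the lowest positive
  layer off \<open>F\<close> shrinks the support, and both sides are additive under it. The cut
  bound is applied only to these supports, none of which exceeds half of \<open>X\<close>.\<close>

lemma coarea_inequality:
  fixes Q :: "'a \<Rightarrow> 'a \<Rightarrow> real" and F :: "'a \<Rightarrow> real"
  assumes fin: "finite X"
    and sym: "\<And>x z. x \<in> X \<Longrightarrow> z \<in> X \<Longrightarrow> Q x z = Q z x"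
    and cut: "\<And>A. A \<subseteq> X \<Longrightarrow> A \<noteq> {} \<Longrightarrow> 2 * card A \<le> card X \<Longrightarrow> h * real (card A) \<le> cut_weight X Q A"
    and nonneg: "\<And>x. x \<in> X \<Longrightarrow> F x \<ge> 0"
    and supp: "2 * card {x\<in>X. F x > 0} \<le> card X"
  shows "h * sum F X \<le> (\<Sum>x\<in>X. \<Sum>z\<in>X. Q x z * \<bar>F x - F z\<bar>) / 2"
  using nonneg supp
proof (induction "card {x\<in>X. F x > 0}" arbitrary: F rule: less_induct)
  case less
  define S where "S = {x\<in>X. F x > 0}"
  have finS: "finite S" using fin by (simp add: S_def)
  show ?case
  proof (cases "S = {}")
    case True
    then have "F x = 0" if "x \<in> X" for x
      using less.prems(1)[OF that] that by (force simp: S_def)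
    then show ?thesis by simp
  next
    case False
    define m where "m = Min (F ` S)"
    have "m \<in> F ` S" unfolding m_def using False finS by (intro Min_in) auto
    then obtain x0 where x0: "x0 \<in> S" "F x0 = m" by auto
    have mpos: "m > 0" using x0 by (auto simp: S_def)
    have mle: "m \<le> F x" if "x \<in> S" for x
      unfolding m_def using that finS by auto
    define G where "G x = F x - m * of_bool (x \<in> S)" for x
    have G_nonneg: "G x \<ge> 0" if "x \<in> X" for x
      using mle[of x] less.prems(1)[OF that] by (auto simp: G_def)
    have sub: "{x\<in>X. G x > 0} \<subset> S"
    proof
      show "{x\<in>X. G x > 0} \<subseteq> S"
        using less.prems(1) by (auto simp: G_def S_def split: if_splits)
      show "{x\<in>X. G x > 0} \<noteq> S" using x0 by (auto simp: G_def)
    qed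
    then have card_less: "card {x\<in>X. G x > 0} < card S"
      using finS by (intro psubset_card_mono) auto
    have IH: "h * sum G X \<le> (\<Sum>x\<in>X. \<Sum>z\<in>X. Q x z * \<bar>G x - G z\<bar>) / 2"
      using less.hyps[of G] card_less G_nonneg less.prems(2) by (auto simp: S_def)
    have sumF: "sum F X = sum G X + m * real (card S)"
    proof -
      have "sum F X = (\<Sum>x\<in>X. G x + m * of_bool (x \<in> S))" by (simp add: G_def)
      also have "\<dots> = sum G X + m * (\<Sum>x\<in>X. of_bool (x \<in> S))"
        by (simp add: sum.distrib sum_distrib_left)
      also have "(\<Sum>x\<in>X. of_bool (x \<in> S)) = real (card S)"
        using fin by (simp add: S_def Int_def)
      finally show ?thesis .
    qed
    \<comment> \<open>No cancellation occurs: \<open>F\<close> vanishes off \<open>S\<close> and is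
      at least \<open>m\<close> on \<open>S\<close>, so the differences of \<open>G\<close> and of
      the removed layer never have opposite signs.\<close>
    have pt: "\<bar>F x - F z\<bar> = \<bar>G x - G z\<bar> + m * \<bar>of_bool (x \<in> S) - of_bool (z \<in> S)\<bar>"
      if "x \<in> X" "z \<in> X" for x z
    proof -
      have "F y = 0" if "y \<in> X" "y \<notin> S" for y
        using less.prems(1)[OF that(1)] that by (auto simp: S_def)
      then show ?thesis
        using mle[of x] mle[of z] mpos that by (auto simp: G_def)
    qed
    have cw: "(\<Sum>x\<in>X. \<Sum>z\<in>X. Q x z * \<bar>of_bool (x \<in> S) - of_bool (z \<in> S)\<bar>) = 2 * cut_weight X Q S"
      by (rule cut_weight_abs[OF sym])
    have "(\<Sum>x\<in>X. \<Sum>z\<in>X. Q x z * \<bar>F x - F z\<bar>)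
      = (\<Sum>x\<in>X. \<Sum>z\<in>X. Q x z * \<bar>G x - G z\<bar> + m * (Q x z * \<bar>of_bool (x \<in> S) - of_bool (z \<in> S)\<bar>))"
      by (intro sum.cong refl) (simp add: pt algebra_simps)
    also have "\<dots> = (\<Sum>x\<in>X. \<Sum>z\<in>X. Q x z * \<bar>G x - G z\<bar>) + m * (2 * cut_weight X Q S)"
      by (simp only: cw[symmetric] sum.distrib sum_distrib_left[symmetric])
    finally have sumQ: "(\<Sum>x\<in>X. \<Sum>z\<in>X. Q x z * \<bar>F x - F z\<bar>) =
      (\<Sum>x\<in>X. \<Sum>z\<in>X. Q x z * \<bar>G x - G z\<bar>) + 2 * (m * cut_weight X Q S)" by simp
    have "h * real (card S) \<le> cut_weight X Q S"
      using False less.prems(2) by (intro cut) (auto simp: S_def)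
    then have "m * (h * real (card S)) \<le> m * cut_weight X Q S"
      using mpos by (intro mult_left_mono) auto
    with IH show ?thesis unfolding sumF sumQ by (simp add: algebra_simps)
  qed
qed

text \<open>The coarea inequality is applied to \<open>f^2\<close>, which has the same support as
  \<open>f\<close>. The factors of \<open>f x ^ 2 - f z ^ 2\<close> are separated by a weighted
  AM-GM inequality, pointwise, in place of Cauchy-Schwarz.\<close>

lemma cheeger_nonneg:
  fixes Q :: "'a \<Rightarrow> 'a \<Rightarrow> real" and f :: "'a \<Rightarrow> real"
  assumes fin: "finite X" and h: "h > 0"
    and sym: "\<And>x z. x \<in> X \<Longrightarrow> z \<in> X \<Longrightarrow> Q x z = Q z x"
    and Qnn: "\<And>x z. x \<in> X \<Longrightarrow> z \<in> X \<Longrightarrow> Q x z \<ge> 0"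
    and row: "\<And>x. x \<in> X \<Longrightarrow> (\<Sum>z\<in>X. Q x z) = 1"
    and cut: "\<And>A. A \<subseteq> X \<Longrightarrow> A \<noteq> {} \<Longrightarrow> 2 * card A \<le> card X \<Longrightarrow> h * real (card A) \<le> cut_weight X Q A"
    and nonneg: "\<And>x. x \<in> X \<Longrightarrow> f x \<ge> 0"
    and supp: "2 * card {x\<in>X. f x > 0} \<le> card X"
  shows "h^2 / 2 * (\<Sum>x\<in>X. f x ^ 2) \<le> dirichlet_form X Q f"
proof -
  have supp_eq: "{x\<in>X. (f x)\<^sup>2 > 0} = {x\<in>X. f x > 0}"
    using nonneg by (auto simp: less_le)
  have "h * (\<Sum>x\<in>X. f x ^ 2) \<le> (\<Sum>x\<in>X. \<Sum>z\<in>X. Q x z * \<bar>f x ^ 2 - f z ^ 2\<bar>) / 2"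
    by (rule coarea_inequality[OF fin sym cut]) (use supp supp_eq in auto)
  also have "(\<Sum>x\<in>X. \<Sum>z\<in>X. Q x z * \<bar>f x ^ 2 - f z ^ 2\<bar>) \<le>
     (\<Sum>x\<in>X. \<Sum>z\<in>X. (Q x z * (f x - f z)^2) / h + h / 2 * (Q x z * f x ^ 2 + Q x z * f z ^ 2))"
  proof (intro sum_mono)
    fix x z assume xz: "x \<in> X" "z \<in> X"
    have "\<bar>f x ^ 2 - f z ^ 2\<bar> = \<bar>f x - f z\<bar> * (f x + f z)"
      using nonneg[OF xz(1)] nonneg[OF xz(2)] by (simp add: power2_eq_square square_diff_square_factored abs_mult mult.commute)
    also have "\<dots> \<le> (f x - f z)^2 / h + h / 4 * (f x + f z)^2"
    proof -
      \<comment> \<open>The weight \<open>h / 2\<close> is chosen so that after summation the second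
        term returns half of the left side, which is then absorbed.\<close>
      have "0 \<le> (\<bar>f x - f z\<bar> - h / 2 * (f x + f z))^2 / h" using h by simp
      also have "\<dots> = (f x - f z)^2 / h + h / 4 * (f x + f z)^2 - \<bar>f x - f z\<bar> * (f x + f z)"
        using h by (simp add: power2_diff power_mult_distrib power2_eq_square[of h]) (simp add: field_simps power2_eq_square)
      finally show ?thesis by simp
    qed
    also have "\<dots> \<le> (f x - f z)^2 / h + h / 4 * (2 * f x ^ 2 + 2 * f z ^ 2)"
    proof -
      have "(f x + f z)^2 \<le> 2 * f x ^ 2 + 2 * f z ^ 2"
        using zero_le_power2[of "f x - f z"] by (simp add: power2_sum power2_diff)
      then show ?thesis using h by (intro add_left_mono mult_left_mono) auto
    qed
    finally have "Q x z * \<bar>f x ^ 2 - f z ^ 2\<bar> \<le> Q x z * ((f x - f z)^2 / h + h / 4 * (2 * f x ^ 2 + 2 * f z ^ 2))"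
      using Qnn[OF xz] by (intro mult_left_mono) auto
    then show "Q x z * \<bar>f x ^ 2 - f z ^ 2\<bar> \<le> (Q x z * (f x - f z)^2) / h + h / 2 * (Q x z * f x ^ 2 + Q x z * f z ^ 2)"
      by (simp add: algebra_simps)
  qed
  also have "\<dots> = (\<Sum>x\<in>X. \<Sum>z\<in>X. Q x z * (f x - f z)^2) / h
      + h / 2 * ((\<Sum>x\<in>X. \<Sum>z\<in>X. Q x z * f x ^ 2) + (\<Sum>x\<in>X. \<Sum>z\<in>X. Q x z * f z ^ 2))"
    by (simp only: sum.distrib sum_distrib_left[symmetric] sum_divide_distrib[symmetric])
  also have "(\<Sum>x\<in>X. \<Sum>z\<in>X. Q x z * f z ^ 2) = (\<Sum>x\<in>X. \<Sum>z\<in>X. Q x z * f x ^ 2)"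
    by (rule sum_kernel_flip[OF sym])
  also have "(\<Sum>x\<in>X. \<Sum>z\<in>X. Q x z * f x ^ 2) = (\<Sum>x\<in>X. f x ^ 2)"
    by (intro sum.cong refl) (simp add: sum_distrib_right[symmetric] row)
  finally have "h * (\<Sum>x\<in>X. f x ^ 2) \<le> dirichlet_form X Q f / h + h / 2 * (\<Sum>x\<in>X. f x ^ 2)"
    by (simp add: dirichlet_form_def field_simps)
  then show ?thesis using h by (simp add: field_simps power2_eq_square)
qed

text \<open>Take for \<open>c\<close> the smallest value whose sublevel set has at least half of the
  states; the next smaller value fails this, which bounds the states strictly below
  \<open>c\<close>.\<close>

lemma exists_median:
  fixes g :: "'a \<Rightarrow> real"
  assumes fin: "finite X" and ne: "X \<noteq> {}"
  shows "\<exists>c. 2 * card {x\<in>X. g x > c} \<le> card X \<and> 2 * card {x\<in>X. g x < c} \<le> card X"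
proof -
  define V where "V = {v \<in> g ` X. card X \<le> 2 * card {x\<in>X. g x \<le> v}}"
  have finV: "finite V" using fin by (simp add: V_def)
  have "{x\<in>X. g x \<le> Max (g ` X)} = X" using fin by auto
  then have "Max (g ` X) \<in> V" using fin ne by (simp add: V_def)
  then have Vne: "V \<noteq> {}" by auto
  define c where "c = Min V"
  have c: "c \<in> V" unfolding c_def using finV Vne by simp
  have "card {x\<in>X. g x \<le> c} + card {x\<in>X. g x > c} = card X"
    using fin by (subst card_Un_disjoint[symmetric]) (auto intro!: arg_cong[where f=card])
  then have 1: "2 * card {x\<in>X. g x > c} \<le> card X" using c by (auto simp: V_def)
  have 2: "2 * card {x\<in>X. g x < c} \<le> card X"
  proof (cases "{x\<in>X. g x < c} = {}")
    case True
    then show ?thesis by (metis card.empty mult_0_right zero_le)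
  next
    case False
    define W where "W = {v \<in> g ` X. v < c}"
    define v where "v = Max W"
    have finW: "finite W" using fin by (simp add: W_def)
    have v: "v \<in> W" unfolding v_def using finW False by (intro Max_in) (auto simp: W_def)
    have eq: "{x\<in>X. g x < c} = {x\<in>X. g x \<le> v}"
    proof -
      have "g x \<le> v" if "x \<in> X" "g x < c" for x
        unfolding v_def using finW that by (intro Max_ge) (auto simp: W_def)
      moreover have "v < c" using v by (simp add: W_def)
      ultimately show ?thesis by force
    qed
    have "v \<notin> V"
    proof
      assume "v \<in> V"
      then have "c \<le> v" unfolding c_def using finV by simp
      then show False using v by (simp add: W_def)
    qed
    then show ?thesis using v unfolding eq by (auto simp: V_def W_def)
  qed
  from 1 2 show ?thesis by blast
qed

text \<open>Cut at a median, \<open>g\<close> splits into parts \<open>p\<close> and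
  \<open>q\<close> that each live on at most half of the states, where the one sided inequality
  applies.\<close>

lemma cheeger_inequality:
  fixes Q :: "'a \<Rightarrow> 'a \<Rightarrow> real" and g :: "'a \<Rightarrow> real"
  assumes fin: "finite X" and h: "h > 0"
    and sym: "\<And>x z. x \<in> X \<Longrightarrow> z \<in> X \<Longrightarrow> Q x z = Q z x"
    and Qnn: "\<And>x z. x \<in> X \<Longrightarrow> z \<in> X \<Longrightarrow> Q x z \<ge> 0"
    and row: "\<And>x. x \<in> X \<Longrightarrow> (\<Sum>z\<in>X. Q x z) = 1"
    and cut: "\<And>A. A \<subseteq> X \<Longrightarrow> A \<noteq> {} \<Longrightarrow> 2 * card A \<le> card X \<Longrightarrow> h * real (card A) \<le> cut_weight X Q A"
    and sum0: "sum g X = 0"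
  shows "h^2 / 2 * (\<Sum>x\<in>X. g x ^ 2) \<le> dirichlet_form X Q g"
proof (cases "X = {}")
  case True
  then show ?thesis by (simp add: dirichlet_form_def)
next
  case False
  obtain c where c: "2 * card {x\<in>X. g x > c} \<le> card X" "2 * card {x\<in>X. g x < c} \<le> card X"
    using exists_median[OF fin False, of g] by blast
  define p where "p x = max (g x - c) 0" for x
  define q where "q x = max (c - g x) 0" for x
  have p: "h^2 / 2 * (\<Sum>x\<in>X. p x ^ 2) \<le> dirichlet_form X Q p"
  proof (rule cheeger_nonneg[OF fin h sym Qnn row cut])
    show "2 * card {x\<in>X. p x > 0} \<le> card X" using c(1) by (simp add: p_def less_max_iff_disj)
  qed (auto simp: p_def)
  have q: "h^2 / 2 * (\<Sum>x\<in>X. q x ^ 2) \<le> dirichlet_form X Q q"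
  proof (rule cheeger_nonneg[OF fin h sym Qnn row cut])
    show "2 * card {x\<in>X. q x > 0} \<le> card X" using c(2) by (simp add: q_def less_max_iff_disj)
  qed (auto simp: q_def)
  have "dirichlet_form X Q p + dirichlet_form X Q q \<le> dirichlet_form X Q g"
  proof -
    have "(p x - p z)^2 + (q x - q z)^2 \<le> (g x - g z)^2" for x z
    proof -
      have g: "g x - g z = (p x - p z) - (q x - q z)" by (auto simp: p_def q_def)
      \<comment> \<open>As functions of the value of \<open>g\<close>, \<open>p\<close> increases
        and \<open>q\<close> decreases.\<close>
      have "(p x - p z) * (q x - q z) \<le> 0"
        by (auto simp: p_def q_def max_def mult_le_0_iff)
      moreover have "(g x - g z)^2 = (p x - p z)^2 + (q x - q z)^2 - 2 * ((p x - p z) * (q x - q z))"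
        unfolding g by (rule trans[OF power2_diff]) (simp only: mult.assoc)
      ultimately show ?thesis by linarith
    qed
    then have "(\<Sum>x\<in>X. \<Sum>z\<in>X. Q x z * (p x - p z)^2 + Q x z * (q x - q z)^2)
        \<le> (\<Sum>x\<in>X. \<Sum>z\<in>X. Q x z * (g x - g z)^2)"
      unfolding distrib_left[symmetric] using Qnn by (intro sum_mono mult_left_mono) auto
    then show ?thesis by (simp add: dirichlet_form_def sum.distrib)
  qed
  moreover have "(\<Sum>x\<in>X. g x ^ 2) \<le> (\<Sum>x\<in>X. p x ^ 2) + (\<Sum>x\<in>X. q x ^ 2)"
  proof -
    \<comment> \<open>Since \<open>g\<close> has mean zero, shifting it by \<open>c\<close> can only
      increase the sum of squares.\<close>
    have "(\<Sum>x\<in>X. g x ^ 2) \<le> (\<Sum>x\<in>X. g x ^ 2) + real (card X) * c^2" by simp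
    also have "\<dots> = (\<Sum>x\<in>X. (g x - c)^2)"
      using sum0 by (simp add: power2_diff sum.distrib sum_subtractf sum_distrib_right[symmetric]
        sum_distrib_left[symmetric])
    also have "\<dots> = (\<Sum>x\<in>X. p x ^ 2 + q x ^ 2)"
      by (intro sum.cong refl) (auto simp: p_def q_def max_def power2_commute)
    finally show ?thesis by (simp add: sum.distrib)
  qed
  then have "h^2 / 2 * (\<Sum>x\<in>X. g x ^ 2) \<le> h^2 / 2 * ((\<Sum>x\<in>X. p x ^ 2) + (\<Sum>x\<in>X. q x ^ 2))"
    by (intro mult_left_mono) auto
  ultimately show ?thesis using p q by (simp add: distrib_left)
qed

section \<open>Energy decay and mixing time bounds for doubly stochastic chains\<close>

locale doubly_stochastic =
  fixes X :: "'a set" and P :: "'a \<Rightarrow> 'a \<Rightarrow> real"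
  assumes finite_X: "finite X" and X_nonempty: "X \<noteq> {}"
    and P_nonneg: "x \<in> X \<Longrightarrow> y \<in> X \<Longrightarrow> P x y \<ge> 0"
    and row_sum: "x \<in> X \<Longrightarrow> (\<Sum>y\<in>X. P x y) = 1"
    and col_sum: "y \<in> X \<Longrightarrow> (\<Sum>x\<in>X. P x y) = 1"
begin

text \<open>The entries of \<open>P P^T\<close>: the chance that independent steps from
  \<open>x\<close> and \<open>z\<close> end at the same state.\<close>

definition overlap :: "'a \<Rightarrow> 'a \<Rightarrow> real" where
  "overlap x z = (\<Sum>y\<in>X. P x y * P z y)"

lemma overlap_sym: "overlap x z = overlap z x"
  by (simp add: overlap_def mult.commute)

lemma overlap_nonneg: "x \<in> X \<Longrightarrow> z \<in> X \<Longrightarrow> overlap x z \<ge> 0"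
  by (auto simp: overlap_def intro!: sum_nonneg mult_nonneg_nonneg P_nonneg)

lemma overlap_row_sum:
  assumes "x \<in> X"
  shows "(\<Sum>z\<in>X. overlap x z) = 1"
proof -
  have "(\<Sum>z\<in>X. overlap x z) = (\<Sum>y\<in>X. \<Sum>z\<in>X. P x y * P z y)"
    unfolding overlap_def by (rule sum.swap)
  also have "\<dots> = (\<Sum>y\<in>X. P x y)"
    by (intro sum.cong refl) (simp add: sum_distrib_left[symmetric] col_sum)
  finally show ?thesis using assms by (simp add: row_sum)
qed

text \<open>Grouping by the meeting state \<open>y\<close> factors the weight into what enters
  \<open>y\<close> from \<open>A\<close> and what enters it from outside.\<close>

lemma cut_weight_overlap:
  assumes "A \<subseteq> X"
  shows "cut_weight X overlap A = (\<Sum>y\<in>X. (\<Sum>x\<in>A. P x y) * (\<Sum>z\<in>X - A. P z y))"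
proof -
  have "cut_weight X overlap A = (\<Sum>x\<in>X. of_bool (x \<in> A) * (\<Sum>z\<in>X. of_bool (z \<in> X - A) * overlap x z))"
    unfolding cut_weight_def by (auto intro!: sum.cong simp: sum_distrib_left)
  also have "\<dots> = (\<Sum>x\<in>A. \<Sum>z\<in>X - A. overlap x z)"
  proof -
    have B: "(\<Sum>x\<in>X. of_bool (x \<in> B) * F x) = sum F B" if "B \<subseteq> X" for B and F :: "'a \<Rightarrow> real"
      using that finite_X by (auto intro!: sum.mono_neutral_cong_right)
    show ?thesis using assms by (simp only: B Diff_subset)
  qed
  also have "\<dots> = (\<Sum>x\<in>A. \<Sum>y\<in>X. \<Sum>z\<in>X - A. P x y * P z y)"
    unfolding overlap_def by (intro sum.cong refl sum.swap)
  also have "\<dots> = (\<Sum>y\<in>X. \<Sum>x\<in>A. \<Sum>z\<in>X - A. P x y * P z y)"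
    by (rule sum.swap)
  finally show ?thesis by (simp add: sum_product)
qed

definition push :: "('a \<Rightarrow> real) \<Rightarrow> 'a \<Rightarrow> real" where
  "push g y = (\<Sum>x\<in>X. g x * P x y)"

lemma sum_push: "(\<Sum>y\<in>X. push g y) = sum g X"
proof -
  have "(\<Sum>y\<in>X. push g y) = (\<Sum>x\<in>X. \<Sum>y\<in>X. g x * P x y)"
    unfolding push_def by (rule sum.swap)
  also have "\<dots> = sum g X"
    by (intro sum.cong refl) (simp add: sum_distrib_left[symmetric] row_sum)
  finally show ?thesis .
qed

text \<open>The square in the Dirichlet form is expanded: row sums of \<open>overlap\<close>
  evaluate the pure squares, and the mixed term is the energy after the step. No spectral theory of
  \<open>P\<close> is involved.\<close>

lemma push_energy:
  "(\<Sum>y\<in>X. push g y ^ 2) = (\<Sum>x\<in>X. g x ^ 2) - dirichlet_form X overlap g"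
proof -
  have 1: "(\<Sum>x\<in>X. \<Sum>z\<in>X. overlap x z * g x ^ 2) = (\<Sum>x\<in>X. g x ^ 2)"
    by (intro sum.cong refl) (simp add: sum_distrib_right[symmetric] overlap_row_sum)
  have 2: "(\<Sum>x\<in>X. \<Sum>z\<in>X. overlap x z * g z ^ 2) = (\<Sum>x\<in>X. g x ^ 2)"
    using sum_kernel_flip[of X overlap "\<lambda>x z. g z ^ 2"] 1 overlap_sym by auto
  have "(\<Sum>y\<in>X. push g y ^ 2) = (\<Sum>y\<in>X. \<Sum>x\<in>X. \<Sum>z\<in>X. g x * P x y * (g z * P z y))"
    by (simp add: push_def power2_eq_square sum_product)
  also have "\<dots> = (\<Sum>x\<in>X. \<Sum>z\<in>X. \<Sum>y\<in>X. g x * P x y * (g z * P z y))"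
    by (subst sum.swap) (intro sum.cong refl sum.swap)
  also have "\<dots> = (\<Sum>x\<in>X. \<Sum>z\<in>X. overlap x z * (g x * g z))"
    by (intro sum.cong refl) (auto simp: overlap_def sum_distrib_right sum_distrib_left algebra_simps)
  finally have 3: "(\<Sum>x\<in>X. \<Sum>z\<in>X. overlap x z * (g x * g z)) = (\<Sum>y\<in>X. push g y ^ 2)" ..
  have "2 * dirichlet_form X overlap g = (\<Sum>x\<in>X. \<Sum>z\<in>X. overlap x z * g x ^ 2 + overlap x z * g z ^ 2 - 2 * (overlap x z * (g x * g z)))"
    unfolding dirichlet_form_def by (simp add: power2_diff algebra_simps)
  also have "\<dots> = 2 * (\<Sum>x\<in>X. g x ^ 2) - 2 * (\<Sum>y\<in>X. push g y ^ 2)"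
    by (simp only: sum.distrib sum_subtractf sum_distrib_left[symmetric] 1 2 3)
  finally show ?thesis by simp
qed

text \<open>A Cheeger constant of \<open>overlap\<close>, written as in
  \<open>cut_weight_overlap\<close> so that it can be verified by exhibiting single states
  \<open>y\<close>.\<close>

definition expands :: "real \<Rightarrow> bool" where
  "expands h \<longleftrightarrow> h > 0 \<and> (\<forall>A\<subseteq>X. A \<noteq> {} \<longrightarrow> 2 * card A \<le> card X \<longrightarrow>
     h * real (card A) \<le> (\<Sum>y\<in>X. (\<Sum>x\<in>A. P x y) * (\<Sum>z\<in>X - A. P z y)))"

lemma push_contracts:
  assumes "expands h" and "sum g X = 0"
  shows "(\<Sum>y\<in>X. push g y ^ 2) \<le> (1 - h^2 / 2) * (\<Sum>x\<in>X. g x ^ 2)"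
proof -
  have "h^2 / 2 * (\<Sum>x\<in>X. g x ^ 2) \<le> dirichlet_form X overlap g"
  proof (rule cheeger_inequality)
    show "h * real (card A) \<le> cut_weight X overlap A"
      if "A \<subseteq> X" "A \<noteq> {}" "2 * card A \<le> card X" for A
      using assms(1) that by (simp add: expands_def cut_weight_overlap)
  qed (use assms overlap_sym overlap_nonneg overlap_row_sum finite_X in \<open>auto simp: expands_def\<close>)
  then show ?thesis by (simp add: push_energy algebra_simps)
qed

lemma row_mult_power_0:
  assumes "y \<in> X" shows "row_mult X \<sigma> (transition_power X P 0) y = pmf \<sigma> y"
  using assms finite_X by (simp add: row_mult_def if_distrib cong: if_cong)

lemma row_mult_power_Suc:
  "row_mult X \<sigma> (transition_power X P (Suc k)) y = push (row_mult X \<sigma> (transition_power X P k)) y"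
proof -
  have "row_mult X \<sigma> (transition_power X P (Suc k)) y
      = (\<Sum>x\<in>X. \<Sum>z\<in>X. pmf \<sigma> x * transition_power X P k x z * P z y)"
    by (simp add: row_mult_def sum_distrib_left algebra_simps)
  also have "\<dots> = (\<Sum>z\<in>X. \<Sum>x\<in>X. pmf \<sigma> x * transition_power X P k x z * P z y)"
    by (rule sum.swap)
  finally show ?thesis by (simp add: push_def row_mult_def sum_distrib_right)
qed

lemma push_diff_const:
  assumes "y \<in> X"
  shows "push (\<lambda>x. g x - c) y = push g y - c"
proof -
  have "push (\<lambda>x. g x - c) y = push g y - (\<Sum>x\<in>X. c * P x y)"
    by (simp add: push_def left_diff_distrib sum_subtractf)
  also have "(\<Sum>x\<in>X. c * P x y) = c" using assms by (simp add: sum_distrib_left[symmetric] col_sum)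
  finally show ?thesis .
qed

text \<open>The deviation of a stationary distribution from uniform is fixed by \<open>push\<close>,
  yet its energy shrinks by a factor below 1, so it vanishes. Expansion replaces irreducibility in
  the uniqueness that \<open>stationary_distribution\<close> presupposes.\<close>

lemma stationary_iff_uniform:
  assumes "expands h"
  shows "stationary X P \<pi> \<longleftrightarrow> \<pi> = pmf_of_set X"
proof
  assume st: "stationary X P \<pi>"
  then have sub: "set_pmf \<pi> \<subseteq> X" by (simp add: stationary_def)
  define g where "g x = pmf \<pi> x - 1 / real (card X)" for x
  have sumpi: "(\<Sum>x\<in>X. pmf \<pi> x) = 1" using sub finite_X by (rule sum_pmf_eq_1[rotated])
  have sum0: "sum g X = 0"
    using sumpi X_nonempty finite_X by (simp add: g_def sum_subtractf)
  have fix_g: "push g y = g y" if "y \<in> X" for y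
  proof -
    have "push g y = push (pmf \<pi>) y - 1 / real (card X)"
      unfolding g_def by (rule push_diff_const[OF that])
    also have "push (pmf \<pi>) y = pmf \<pi> y"
      using st that by (simp add: stationary_def row_mult_def push_def)
    finally show ?thesis using g_def[of y] by metis
  qed
  have "(\<Sum>x\<in>X. g x ^ 2) \<le> (1 - h^2 / 2) * (\<Sum>x\<in>X. g x ^ 2)"
    using push_contracts[OF assms sum0] fix_g by simp
  then have "h^2 / 2 * (\<Sum>x\<in>X. g x ^ 2) \<le> 0" by (simp add: algebra_simps)
  moreover have "h^2 / 2 > 0" using assms by (simp add: expands_def)
  ultimately have "(\<Sum>x\<in>X. g x ^ 2) \<le> 0" by (simp add: mult_le_0_iff)
  then have "(\<Sum>x\<in>X. g x ^ 2) = 0" by (intro antisym sum_nonneg) auto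
  then have g0: "g x = 0" if "x \<in> X" for x
    using that finite_X by (simp add: sum_nonneg_eq_0_iff)
  show "\<pi> = pmf_of_set X"
  proof (rule pmf_eqI)
    fix x show "pmf \<pi> x = pmf (pmf_of_set X) x"
      using g0[of x] sub finite_X X_nonempty
      by (cases "x \<in> X") (auto simp: g_def set_pmf_iff)
  qed
next
  assume "\<pi> = pmf_of_set X"
  then show "stationary X P \<pi>"
    using finite_X X_nonempty col_sum
    by (auto simp: stationary_def row_mult_def sum_divide_distrib[symmetric] indicator_def)
qed

lemma stationary_distribution_uniform:
  assumes "expands h"
  shows "stationary_distribution X P = pmf_of_set X"
  unfolding stationary_distribution_def
  by (rule the_equality) (simp_all add: stationary_iff_uniform[OF assms])

text \<open>The initial energy is at most 1 because
  \<open>(pmf \<sigma> y)^2 \<le> pmf \<sigma> y\<close>. Conservation of mass keeps the deviation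
  at sum zero, as \<open>push_contracts\<close> demands at each step.\<close>

lemma energy_decay:
  assumes "expands h" and sub: "set_pmf \<sigma> \<subseteq> X"
  shows "(\<Sum>y\<in>X. (row_mult X \<sigma> (transition_power X P k) y - 1 / real (card X))^2) \<le> exp (- (real k * h^2 / 2))"
    and "(\<Sum>y\<in>X. row_mult X \<sigma> (transition_power X P k) y) = 1"
proof -
  define c where "c = 1 / real (card X)"
  define \<mu> where "\<mu> k y = row_mult X \<sigma> (transition_power X P k) y" for k y
  have sumpi: "(\<Sum>x\<in>X. pmf \<sigma> x) = 1" using sub finite_X by (rule sum_pmf_eq_1[rotated])
  have sum_mu: "sum (\<mu> k) X = 1" for k
  proof (induction k)
    case 0
    show ?case using sumpi by (simp add: \<mu>_def row_mult_power_0 del: transition_power.simps)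
  next
    case (Suc k)
    then show ?case
      by (simp add: \<mu>_def row_mult_power_Suc sum_push del: transition_power.simps)
  qed
  then show "(\<Sum>y\<in>X. row_mult X \<sigma> (transition_power X P k) y) = 1" by (simp add: \<mu>_def)
  have "(\<Sum>y\<in>X. (\<mu> k y - c)^2) \<le> exp (- (real k * h^2 / 2))"
  proof (induction k)
    case 0
    have "(\<Sum>y\<in>X. (\<mu> 0 y - c)^2) = (\<Sum>y\<in>X. (pmf \<sigma> y)^2) - 2 * c * (\<Sum>y\<in>X. pmf \<sigma> y) + real (card X) * c^2"
      by (simp add: \<mu>_def row_mult_power_0 power2_diff sum.distrib sum_subtractf sum_distrib_left
          mult_ac del: transition_power.simps)
    also have "\<dots> = (\<Sum>y\<in>X. (pmf \<sigma> y)^2) - c"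
      using X_nonempty finite_X by (simp add: sumpi c_def power2_eq_square)
    also have "\<dots> \<le> (\<Sum>y\<in>X. pmf \<sigma> y)"
      by (rule order.trans[of _ "\<Sum>y\<in>X. (pmf \<sigma> y)^2"])
         (auto simp: c_def power2_eq_square intro!: sum_mono mult_left_le pmf_le_1)
    finally show ?case by (simp add: sumpi)
  next
    case (Suc k)
    have "(\<Sum>y\<in>X. (\<mu> (Suc k) y - c)^2) = (\<Sum>y\<in>X. push (\<lambda>x. \<mu> k x - c) y ^ 2)"
      by (intro sum.cong refl)
         (simp add: push_diff_const, simp add: \<mu>_def row_mult_power_Suc del: transition_power.simps)
    also have "\<dots> \<le> (1 - h^2 / 2) * (\<Sum>y\<in>X. (\<mu> k y - c)^2)"
      by (rule push_contracts[OF assms(1)])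
         (use sum_mu X_nonempty finite_X in \<open>simp add: sum_subtractf c_def\<close>)
    also have "\<dots> \<le> exp (- (h^2 / 2)) * (\<Sum>y\<in>X. (\<mu> k y - c)^2)"
      using exp_ge_add_one_self[of "- (h^2 / 2)"] by (intro mult_right_mono sum_nonneg) auto
    also have "\<dots> \<le> exp (- (h^2 / 2)) * exp (- (real k * h^2 / 2))"
      using Suc by (intro mult_left_mono) auto
    also have "\<dots> = exp (- (real (Suc k) * h^2 / 2))"
      by (simp add: exp_add[symmetric] algebra_simps add_divide_distrib)
    finally show ?case .
  qed
  then show "(\<Sum>y\<in>X. (row_mult X \<sigma> (transition_power X P k) y - 1 / real (card X))^2) \<le> exp (- (real k * h^2 / 2))"
    by (simp add: \<mu>_def c_def)
qed

text \<open>Cauchy-Schwarz passes from the energy to the sum of absolute deviations, which dominates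
  the difference on every event. It costs the factor \<open>card X\<close>, hence a logarithm of the
  number of states in the time.\<close>

lemma mixing_time_le:
  assumes ex: "expands h" and eps: "\<epsilon> > 0"
    and k: "real (card X) * exp (- (real k * h^2 / 2)) \<le> \<epsilon>^2"
  shows "mixing_time X P \<epsilon> \<le> enat k"
  unfolding mixing_time_def
proof (rule SUP_least)
  fix \<sigma> assume "\<sigma> \<in> {\<sigma>. set_pmf \<sigma> \<subseteq> X}"
  then have sub: "set_pmf \<sigma> \<subseteq> X" by simp
  define \<mu> where "\<mu> = row_mult X \<sigma> (transition_power X P k)"
  define g where "g y = \<mu> y - 1 / real (card X)" for y
  have "(\<Sum>y\<in>X. \<bar>g y\<bar>)^2 \<le> (\<Sum>y\<in>X. g y ^ 2) * real (card X)"
    using Cauchy_Schwarz_ineq_sum[of "\<lambda>y. \<bar>g y\<bar>" "\<lambda>_. 1" X] by simp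
  also have "\<dots> \<le> exp (- (real k * h^2 / 2)) * real (card X)"
    using energy_decay(1)[OF ex sub, of k] by (intro mult_right_mono) (auto simp: g_def \<mu>_def)
  also have "\<dots> \<le> \<epsilon>^2" using k by (simp add: mult.commute)
  finally have l1: "(\<Sum>y\<in>X. \<bar>g y\<bar>) \<le> \<epsilon>" using eps by (simp add: power2_le_iff_abs_le)
  have "total_variation X \<mu> (pmf (stationary_distribution X P)) \<le> \<epsilon>"
    unfolding total_variation_def
  proof (subst Max_le_iff)
    show "\<forall>a\<in>(\<lambda>A. \<bar>sum \<mu> A - sum (pmf (stationary_distribution X P)) A\<bar>) ` Pow X. a \<le> \<epsilon>"
    proof safe
      fix A assume A: "A \<subseteq> X"
      have "sum \<mu> A - sum (pmf (stationary_distribution X P)) A = sum g A"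
        unfolding sum_subtractf[symmetric] g_def stationary_distribution_uniform[OF ex]
        by (intro sum.cong refl) (use A finite_X X_nonempty in \<open>auto simp: indicator_def\<close>)
      also have "\<bar>sum g A\<bar> \<le> (\<Sum>y\<in>A. \<bar>g y\<bar>)" by (rule sum_abs)
      also have "\<dots> \<le> (\<Sum>y\<in>X. \<bar>g y\<bar>)" using A finite_X by (intro sum_mono2) auto
      finally show "\<bar>sum \<mu> A - sum (pmf (stationary_distribution X P)) A\<bar> \<le> \<epsilon>" using l1 by simp
    qed
  qed (use finite_X in auto)
  then show "(INF k\<in>{k. total_variation X (row_mult X \<sigma> (transition_power X P k))
                    (pmf (stationary_distribution X P)) \<le> \<epsilon>}. enat k) \<le> enat k"
    by (intro INF_lower) (simp add: \<mu>_def)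
qed

lemma row_mult_power_nonneg:
  assumes "y \<in> X"
  shows "row_mult X \<sigma> (transition_power X P k) y \<ge> 0"
  using assms
proof (induction k arbitrary: y)
  case 0
  then show ?case by (simp add: row_mult_power_0 del: transition_power.simps)
next
  case (Suc k)
  then show ?case unfolding row_mult_power_Suc push_def
    by (intro sum_nonneg mult_nonneg_nonneg P_nonneg) auto
qed

text \<open>If one step increases the expectation of the potential \<open>f\<close> by at most 1, then the
  chain started where \<open>f\<close> vanishes needs time of order \<open>M\<close> to leave \<open>{f < M}\<close>.\<close>

lemma mixing_time_gt:
  assumes ex: "expands h" and x0: "x0 \<in> X" "f x0 = 0" and M: "M > 0"
    and f_nonneg: "\<And>x. x \<in> X \<Longrightarrow> f x \<ge> 0"
    and drift: "\<And>x. x \<in> X \<Longrightarrow> (\<Sum>y\<in>X. P x y * f y) \<le> f x + 1"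
    and B: "real (card {x\<in>X. f x < M}) \<le> (1 - \<epsilon>) / 4 * real (card X)"
    and t: "t \<le> (1 - \<epsilon>) / 4 * M" and eps: "\<epsilon> < 1"
  shows "ereal t < ereal_of_enat (mixing_time X P \<epsilon>)"
proof -
  define \<sigma> where "\<sigma> = return_pmf x0"
  have sub: "set_pmf \<sigma> \<subseteq> X" using x0 by (simp add: \<sigma>_def)
  define \<mu> where "\<mu> k y = row_mult X \<sigma> (transition_power X P k) y" for k y
  have mu_nonneg: "\<mu> k y \<ge> 0" if "y \<in> X" for k y
    using that by (simp add: \<mu>_def row_mult_power_nonneg)
  have sum_mu: "sum (\<mu> k) X = 1" for k
    using energy_decay(2)[OF ex sub] by (simp add: \<mu>_def)
  have Ef: "(\<Sum>y\<in>X. \<mu> k y * f y) \<le> real k" for k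
  proof (induction k)
    case 0
    have "(\<Sum>y\<in>X. \<mu> 0 y * f y) = (\<Sum>y\<in>X. 0)"
      by (intro sum.cong refl) (auto simp: \<mu>_def row_mult_power_0 \<sigma>_def indicator_def x0
          simp del: transition_power.simps)
    then show ?case by simp
  next
    case (Suc k)
    have "(\<Sum>y\<in>X. \<mu> (Suc k) y * f y) = (\<Sum>y\<in>X. \<Sum>x\<in>X. \<mu> k x * P x y * f y)"
      by (simp add: \<mu>_def row_mult_power_Suc push_def sum_distrib_right del: transition_power.simps)
    also have "\<dots> = (\<Sum>x\<in>X. \<mu> k x * (\<Sum>y\<in>X. P x y * f y))"
      by (subst sum.swap) (simp add: sum_distrib_left mult_ac)
    also have "\<dots> \<le> (\<Sum>x\<in>X. \<mu> k x * (f x + 1))"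
      by (intro sum_mono mult_left_mono drift mu_nonneg)
    also have "\<dots> = (\<Sum>x\<in>X. \<mu> k x * f x) + 1"
      by (simp add: distrib_left sum.distrib sum_mu)
    finally show ?case using Suc by simp
  qed
  \<comment> \<open>By Markov's inequality at most \<open>(1 - \<epsilon>) / 4\<close> of the mass
    has left \<open>{f < M}\<close>, while the uniform distribution gives that set at most
    \<open>(1 - \<epsilon>) / 4\<close>. The distance is then at least
    \<open>1 - (1 - \<epsilon>) / 2\<close>, more than \<epsilon>.\<close>
  have far: "t < real k" if tv: "total_variation X (\<mu> k) (pmf (stationary_distribution X P)) \<le> \<epsilon>" for k
  proof (rule ccontr)
    assume "\<not> t < real k"
    then have kt: "real k \<le> (1 - \<epsilon>) / 4 * M" using t by simp
    define A where "A = {x\<in>X. f x < M}"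
    have A: "A \<subseteq> X" by (auto simp: A_def)
    have "M * sum (\<mu> k) (X - A) = (\<Sum>y\<in>X - A. \<mu> k y * M)" by (simp add: sum_distrib_left mult.commute)
    also have "\<dots> \<le> (\<Sum>y\<in>X - A. \<mu> k y * f y)"
      by (intro sum_mono mult_left_mono mu_nonneg) (auto simp: A_def)
    also have "\<dots> \<le> (\<Sum>y\<in>X. \<mu> k y * f y)"
      using finite_X mu_nonneg f_nonneg by (intro sum_mono2) auto
    also have "\<dots> \<le> (1 - \<epsilon>) / 4 * M" using Ef[of k] kt by simp
    finally have 1: "sum (\<mu> k) (X - A) \<le> (1 - \<epsilon>) / 4" using M by (simp add: mult.commute)
    have 2: "sum (\<mu> k) A = 1 - sum (\<mu> k) (X - A)"
      using sum_mu[of k] A finite_X by (simp add: sum_diff)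
    have "sum (pmf (stationary_distribution X P)) A = real (card A) / real (card X)"
      unfolding stationary_distribution_uniform[OF ex]
      using A finite_X X_nonempty by (simp add: indicator_def subset_eq cong: sum.cong)
    also have "\<dots> \<le> (1 - \<epsilon>) / 4"
      using B finite_X X_nonempty by (simp add: A_def divide_le_eq card_gt_0_iff)
    finally have 3: "sum (pmf (stationary_distribution X P)) A \<le> (1 - \<epsilon>) / 4" .
    have "\<bar>sum (\<mu> k) A - sum (pmf (stationary_distribution X P)) A\<bar> \<le> \<epsilon>"
      by (rule order.trans[OF _ tv], unfold total_variation_def)
         (use A finite_X in \<open>intro Max_ge, auto\<close>)
    with 1 2 3 have "1 - (1 - \<epsilon>) / 2 \<le> \<epsilon>" by linarith
    then show False using eps by (simp add: field_simps)
  qed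
  \<comment> \<open>The least natural number above \<open>t\<close>. If no time is admissible, the
    infimum is infinite and the bound still holds.\<close>
  define K where "K = nat (\<lfloor>t\<rfloor> + 1)"
  have "enat K \<le> (INF k\<in>{k. total_variation X (\<mu> k) (pmf (stationary_distribution X P)) \<le> \<epsilon>}. enat k)"
  proof (rule INF_greatest)
    fix k assume "k \<in> {k. total_variation X (\<mu> k) (pmf (stationary_distribution X P)) \<le> \<epsilon>}"
    then have "t < real k" using far by simp
    then have "\<lfloor>t\<rfloor> < int k" by (simp add: floor_less_iff)
    then show "enat K \<le> enat k" by (simp add: K_def)
  qed
  also have "\<dots> \<le> mixing_time X P \<epsilon>"
    unfolding mixing_time_def \<mu>_def using sub by (intro SUP_upper) auto
  finally have "ereal_of_enat (enat K) \<le> ereal_of_enat (mixing_time X P \<epsilon>)"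
    by (simp only: ereal_of_enat_le_iff)
  moreover have "t < real K" unfolding K_def by linarith
  ultimately show ?thesis by (metis ereal_of_enat_simps(1) less_ereal.simps(1) order_less_le_trans)
qed

end

section \<open>Asymptotically sure events\<close>

lemma prob_mono_support:
  assumes "\<And>\<omega>. \<omega> \<in> set_pmf M \<Longrightarrow> \<omega> \<in> A \<Longrightarrow> \<omega> \<in> B"
  shows "measure_pmf.prob M A \<le> measure_pmf.prob M B"
proof -
  have "measure_pmf.prob M (A \<inter> set_pmf M) \<le> measure_pmf.prob M B"
    using assms by (intro measure_pmf.finite_measure_mono) auto
  then show ?thesis by (simp add: measure_Int_set_pmf)
qed

lemma prob_not: "measure_pmf.prob M {\<omega>. \<not> Q \<omega>} = 1 - measure_pmf.prob M {\<omega>. Q \<omega>}"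
  using measure_pmf.prob_compl[of "{\<omega>. Q \<omega>}" M] by (simp add: Compl_eq_Diff_UNIV[symmetric] Collect_neg_eq)

lemma aas_iff: "asymptotically_almost_surely M Q \<longleftrightarrow> (\<lambda>n. measure_pmf.prob (M n) {\<omega>. \<not> Q n \<omega>}) \<longlonglongrightarrow> 0"
proof -
  have "(\<lambda>n. measure_pmf.prob (M n) {\<omega>. Q n \<omega>}) \<longlonglongrightarrow> 1 \<longleftrightarrow> (\<lambda>n. 1 - measure_pmf.prob (M n) {\<omega>. Q n \<omega>}) \<longlonglongrightarrow> 0"
    using tendsto_diff[OF tendsto_const[of 1], of "\<lambda>n. measure_pmf.prob (M n) {\<omega>. Q n \<omega>}" 1 sequentially]
      tendsto_diff[OF tendsto_const[of 1], of "\<lambda>n. 1 - measure_pmf.prob (M n) {\<omega>. Q n \<omega>}" 0 sequentially]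
    by auto
  then show ?thesis by (simp add: asymptotically_almost_surely_def prob_not)
qed

lemma aasI:
  assumes "\<forall>\<^sub>F n in sequentially. measure_pmf.prob (M n) {\<omega>. \<not> Q n \<omega>} \<le> g n" and "g \<longlonglongrightarrow> 0"
  shows "asymptotically_almost_surely M Q"
  unfolding aas_iff by (rule tendsto_sandwich[OF _ assms(1) tendsto_const assms(2)]) simp

lemma aas_mono:
  assumes "asymptotically_almost_surely M Q"
    and "\<forall>\<^sub>F n in sequentially. \<forall>\<omega>\<in>set_pmf (M n). Q n \<omega> \<longrightarrow> Q' n \<omega>"
  shows "asymptotically_almost_surely M Q'"
proof (rule aasI)
  show "\<forall>\<^sub>F n in sequentially. measure_pmf.prob (M n) {\<omega>. \<not> Q' n \<omega>} \<le> measure_pmf.prob (M n) {\<omega>. \<not> Q n \<omega>}"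
    using assms(2) by eventually_elim (rule prob_mono_support, auto)
  show "(\<lambda>n. measure_pmf.prob (M n) {\<omega>. \<not> Q n \<omega>}) \<longlonglongrightarrow> 0"
    using assms(1) by (simp add: aas_iff)
qed

lemma aas_conj:
  assumes "asymptotically_almost_surely M Q" and "asymptotically_almost_surely M Q'"
  shows "asymptotically_almost_surely M (\<lambda>n \<omega>. Q n \<omega> \<and> Q' n \<omega>)"
proof (rule aasI)
  show "\<forall>\<^sub>F n in sequentially. measure_pmf.prob (M n) {\<omega>. \<not> (Q n \<omega> \<and> Q' n \<omega>)}
      \<le> measure_pmf.prob (M n) {\<omega>. \<not> Q n \<omega>} + measure_pmf.prob (M n) {\<omega>. \<not> Q' n \<omega>}"
  proof (intro always_eventually allI)
    fix n
    have "{\<omega>. \<not> (Q n \<omega> \<and> Q' n \<omega>)} = {\<omega>. \<not> Q n \<omega>} \<union> {\<omega>. \<not> Q' n \<omega>}" by auto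
    then show "measure_pmf.prob (M n) {\<omega>. \<not> (Q n \<omega> \<and> Q' n \<omega>)}
      \<le> measure_pmf.prob (M n) {\<omega>. \<not> Q n \<omega>} + measure_pmf.prob (M n) {\<omega>. \<not> Q' n \<omega>}"
      by (simp add: measure_Un_le)
  qed
  show "(\<lambda>n. measure_pmf.prob (M n) {\<omega>. \<not> Q n \<omega>} + measure_pmf.prob (M n) {\<omega>. \<not> Q' n \<omega>}) \<longlonglongrightarrow> 0"
    using tendsto_add[of _ 0 _ _ 0] assms by (auto simp: aas_iff)
qed

text \<open>Turns a statement on probabilities into the existence of one graph; it serves to show
  that the degree bound is at least 1.\<close>

lemma aas_eventually_witness:
  assumes "asymptotically_almost_surely M Q"
  shows "\<forall>\<^sub>F n in sequentially. \<exists>\<omega>\<in>set_pmf (M n). Q n \<omega>"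
proof -
  have "\<forall>\<^sub>F n in sequentially. measure_pmf.prob (M n) {\<omega>. Q n \<omega>} > 0"
    using assms unfolding asymptotically_almost_surely_def by (rule order_tendstoD) simp
  then show ?thesis
  proof eventually_elim
    case (elim n)
    show ?case
    proof (rule ccontr)
      assume "\<not> ?thesis"
      then have "measure_pmf.prob (M n) {\<omega>. Q n \<omega>} \<le> measure_pmf.prob (M n) {}"
        by (intro prob_mono_support) auto
      then show False using elim by simp
    qed
  qed
qed

text \<open>Chebyshev's argument: for the number \<open>Z\<close> of events that occur and its mean
  \<open>c\<close>, the square \<open>(Z - c)^2\<close> equals \<open>c^2\<close> wherever
  \<open>Z = 0\<close>. The diagonal pairs produce \<open>1 / (K * p)\<close>, the others the excess
  of \<open>p2\<close> over \<open>p^2\<close>.\<close>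

lemma second_moment:
  fixes A :: "nat \<Rightarrow> 'a set" and K :: nat
  assumes fin: "finite (set_pmf M)" and K: "K > 0" and p: "p > 0"
    and single: "\<And>i. i < K \<Longrightarrow> measure_pmf.prob M (A i) = p"
    and pair: "\<And>i j. i < K \<Longrightarrow> j < K \<Longrightarrow> i \<noteq> j \<Longrightarrow> measure_pmf.prob M (A i \<inter> A j) \<le> p2"
    and p2: "p2 \<ge> 0"
  shows "measure_pmf.prob M {\<omega>. \<forall>i<K. \<omega> \<notin> A i} \<le> 1 / (real K * p) + (p2 / p^2 - 1)"
proof -
  let ?c = "real K * p"
  define Z where "Z \<omega> = (\<Sum>i<K. indicator (A i) \<omega> :: real)" for \<omega>
  have int: "integrable (measure_pmf M) f" for f :: "'a \<Rightarrow> real"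
    using fin by (rule integrable_measure_pmf_finite)
  have ZZ: "Z \<omega> * Z \<omega> = (\<Sum>i<K. \<Sum>j<K. indicator (A i \<inter> A j) \<omega>)" for \<omega>
    unfolding Z_def sum_product by (simp add: indicator_inter_arith)
  have "?c^2 * measure_pmf.prob M {\<omega>. \<forall>i<K. \<omega> \<notin> A i}
      = (\<integral>\<omega>. ?c^2 * indicator {\<omega>. \<forall>i<K. \<omega> \<notin> A i} \<omega> \<partial>measure_pmf M)" by simp
  also have "\<dots> \<le> (\<integral>\<omega>. Z \<omega> * Z \<omega> - 2 * ?c * Z \<omega> + ?c^2 \<partial>measure_pmf M)"
  proof (rule integral_mono[OF int int])
    fix \<omega>
    have "0 \<le> (Z \<omega> - ?c)^2" by simp
    then have "0 \<le> Z \<omega> * Z \<omega> - 2 * ?c * Z \<omega> + ?c^2" by (simp add: power2_eq_square algebra_simps)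
    moreover have "Z \<omega> = 0" if "\<forall>i<K. \<omega> \<notin> A i" using that by (simp add: Z_def)
    ultimately show "?c^2 * indicator {\<omega>. \<forall>i<K. \<omega> \<notin> A i} \<omega> \<le> Z \<omega> * Z \<omega> - 2 * ?c * Z \<omega> + ?c^2"
      by (auto simp: indicator_def)
  qed
  also have "\<dots> = (\<integral>\<omega>. Z \<omega> * Z \<omega> \<partial>measure_pmf M) - 2 * ?c * (\<integral>\<omega>. Z \<omega> \<partial>measure_pmf M) + ?c^2"
    by (simp add: int)
  also have "(\<integral>\<omega>. Z \<omega> \<partial>measure_pmf M) = ?c"
    unfolding Z_def by (subst Bochner_Integration.integral_sum) (auto simp: int single)
  also have "(\<integral>\<omega>. Z \<omega> * Z \<omega> \<partial>measure_pmf M) = (\<Sum>i<K. \<Sum>j<K. measure_pmf.prob M (A i \<inter> A j))"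
    unfolding ZZ by (simp add: Bochner_Integration.integral_sum int)
  also have "\<dots> \<le> (\<Sum>i<K. \<Sum>j<K. p2 + (if j = i then p else 0))"
  proof (intro sum_mono)
    fix i j assume "i \<in> {..<K}" "j \<in> {..<K}"
    then show "measure_pmf.prob M (A i \<inter> A j) \<le> p2 + (if j = i then p else 0)"
      using single[of i] pair[of i j] p2 by auto
  qed
  also have "\<dots> = real K ^ 2 * p2 + real K * p" by (simp add: sum.distrib power2_eq_square algebra_simps)
  finally have "?c^2 * measure_pmf.prob M {\<omega>. \<forall>i<K. \<omega> \<notin> A i} \<le> real K ^ 2 * p2 + real K * p - ?c^2"
    by (simp add: power2_eq_square algebra_simps)
  then have "measure_pmf.prob M {\<omega>. \<forall>i<K. \<omega> \<notin> A i} \<le> (real K ^ 2 * p2 + real K * p - ?c^2) / ?c^2"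
    using K p by (simp add: pos_le_divide_eq mult.commute)
  also have "\<dots> = 1 / (real K * p) + (p2 / p^2 - 1)"
    using K p by (simp add: field_simps power2_eq_square)
  finally show ?thesis .
qed

section \<open>Uniform subsets of given size\<close>

text \<open>The factorials of \<open>m\<close> cancel. Probabilities for a uniform subset thus
  become products that can be estimated one factor per draw.\<close>

lemma binomial_ratio:
  "real (a choose m) / real (N choose m) = (\<Prod>i<m. (real a - real i) / (real N - real i))"
  by (simp add: binomial_gbinomial gbinomial_prod_rev prod_dividef atLeast0LessThan)

locale uniform_subset =
  fixes U :: "'a set" and m :: nat
  assumes finite_U: "finite U" and m_le: "m \<le> card U"
begin

definition \<Omega> :: "'a set set" where
  "\<Omega> = {E. E \<subseteq> U \<and> card E = m}"

lemma finite_\<Omega>: "finite \<Omega>"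
  by (rule finite_subset[of _ "Pow U"]) (auto simp: \<Omega>_def finite_U)

lemma card_\<Omega>: "card \<Omega> = card U choose m"
  unfolding \<Omega>_def using finite_U by (rule n_subsets)

lemma \<Omega>_nonempty: "\<Omega> \<noteq> {}"
  using card_\<Omega> m_le by (metis card.empty binomial_eq_0_iff not_less)

lemma set_pmf: "set_pmf (pmf_of_set \<Omega>) = \<Omega>"
  using finite_\<Omega> \<Omega>_nonempty by (rule set_pmf_of_set[rotated])

abbreviation pr :: "'a set set \<Rightarrow> real" where
  "pr \<equiv> measure_pmf.prob (pmf_of_set \<Omega>)"

lemma pr_eq: "pr A = real (card (\<Omega> \<inter> A)) / real (card U choose m)"
  using finite_\<Omega> \<Omega>_nonempty by (simp add: measure_pmf_of_set card_\<Omega>)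

lemma pr_avoid:
  assumes "F \<subseteq> U"
  shows "pr {E. E \<inter> F = {}} = real ((card U - card F) choose m) / real (card U choose m)"
proof -
  have "\<Omega> \<inter> {E. E \<inter> F = {}} = {E. E \<subseteq> U - F \<and> card E = m}"
    using assms by (auto simp: \<Omega>_def)
  then have "card (\<Omega> \<inter> {E. E \<inter> F = {}}) = card (U - F) choose m"
    using finite_U by (simp add: n_subsets)
  also have "card (U - F) = card U - card F"
    using assms finite_U by (simp add: card_Diff_subset finite_subset)
  finally show ?thesis by (simp add: pr_eq)
qed

text \<open>Drawing without replacement only makes avoidance harder: each factor is at most
  \<open>1 - card F / card U\<close>.\<close>

lemma pr_avoid_le:
  assumes F: "F \<subseteq> U"
  shows "pr {E. E \<inter> F = {}} \<le> exp (- (real (card F) * real m / real (card U)))"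
proof (cases "m \<le> card U - card F \<and> 0 < m")
  case False
  show ?thesis
  proof (cases "m = 0")
    case False
    with \<open>\<not> (m \<le> card U - card F \<and> 0 < m)\<close> show ?thesis by (simp add: pr_avoid[OF F] binomial_eq_0)
  qed simp
next
  case True
  have FU: "card F \<le> card U" using F finite_U by (rule card_mono[rotated])
  have U0: "card U > 0" using True m_le by linarith
  have "pr {E. E \<inter> F = {}} = (\<Prod>i<m. (real (card U - card F) - real i) / (real (card U) - real i))"
    by (simp add: pr_avoid[OF F] binomial_ratio)
  also have "\<dots> \<le> (\<Prod>i<m. exp (- (real (card F) / real (card U))))"
  proof (intro prod_mono conjI)
    fix i assume i: "i \<in> {..<m}"
    then have i': "real i < real (card U) - real (card F)" using True FU by (auto simp: of_nat_diff)
    show "0 \<le> (real (card U - card F) - real i) / (real (card U) - real i)"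
      using i' FU by (simp add: of_nat_diff)
    have "(real (card U - card F) - real i) / (real (card U) - real i) \<le> 1 - real (card F) / real (card U)"
      using i' FU U0 by (simp add: of_nat_diff field_simps)
    also have "\<dots> \<le> exp (- (real (card F) / real (card U)))"
      using exp_ge_add_one_self[of "- (real (card F) / real (card U))"] by simp
    finally show "(real (card U - card F) - real i) / (real (card U) - real i) \<le> exp (- (real (card F) / real (card U)))" .
  qed
  also have "\<dots> = exp (- (real (card F) * real m / real (card U)))"
    by (simp add: exp_of_nat_mult[symmetric] mult.commute)
  finally show ?thesis .
qed

text \<open>Containment is no likelier than for independent draws: with the roles of
  \<open>m\<close> and \<open>card J\<close> exchanged by a binomial identity, each factor
  \<open>(m - i) / (card U - i)\<close> is at most \<open>m / card U\<close>.\<close>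

lemma pr_contains_le:
  assumes J: "J \<subseteq> U"
  shows "pr {E. J \<subseteq> E} \<le> (real m / real (card U)) ^ card J"
proof (cases "card J \<le> m")
  case False
  have "\<Omega> \<inter> {E. J \<subseteq> E} = {}"
  proof -
    have "card J \<le> card E" if "J \<subseteq> E" "E \<subseteq> U" for E
      using that finite_U by (intro card_mono) (auto intro: finite_subset)
    then show ?thesis using False by (auto simp: \<Omega>_def)
  qed
  then show ?thesis by (simp add: pr_eq)
next
  case True
  let ?j = "card J"
  have finJ: "finite J" using J finite_U by (rule finite_subset)
  \<comment> \<open>A superset of \<open>J\<close> is determined by its part outside
    \<open>J\<close>, of size \<open>m - card J\<close>.\<close>
  have "\<Omega> \<inter> {E. J \<subseteq> E} = (\<lambda>B. B \<union> J) ` {B. B \<subseteq> U - J \<and> card B = m - ?j}"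
  proof (intro equalityI subsetI)
    fix E assume E: "E \<in> \<Omega> \<inter> {E. J \<subseteq> E}"
    then have "finite E" using finite_U by (auto simp: \<Omega>_def intro: finite_subset)
    then have "E - J \<in> {B. B \<subseteq> U - J \<and> card B = m - ?j}"
      using E finJ by (auto simp: \<Omega>_def card_Diff_subset)
    moreover have "E = (E - J) \<union> J" using E by auto
    ultimately show "E \<in> (\<lambda>B. B \<union> J) ` {B. B \<subseteq> U - J \<and> card B = m - ?j}" by blast
  next
    fix E assume "E \<in> (\<lambda>B. B \<union> J) ` {B. B \<subseteq> U - J \<and> card B = m - ?j}"
    then obtain B where B: "E = B \<union> J" "B \<subseteq> U - J" "card B = m - ?j" by blast
    moreover have "finite B" using B finite_U by (auto intro: finite_subset)
    ultimately show "E \<in> \<Omega> \<inter> {E. J \<subseteq> E}"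
      using True J finJ by (subst (asm) B, auto simp: \<Omega>_def) (subst card_Un_disjoint, auto)
  qed
  then have "card (\<Omega> \<inter> {E. J \<subseteq> E}) \<le> card (U - J) choose (m - ?j)"
    using finite_U card_image_le[of "{B. B \<subseteq> U - J \<and> card B = m - ?j}" "\<lambda>B. B \<union> J"]
    by (simp add: n_subsets)
  also have "card (U - J) = card U - ?j" using J finJ by (simp add: card_Diff_subset)
  finally have "pr {E. J \<subseteq> E} \<le> real (card U - ?j choose (m - ?j)) / real (card U choose m)"
    unfolding pr_eq by (intro divide_right_mono) auto
  also have "\<dots> = real (m choose ?j) / real (card U choose ?j)"
  proof -
    have "(card U choose m) * (m choose ?j) = (card U choose ?j) * (card U - ?j choose (m - ?j))"
      by (rule choose_mult[OF True m_le])
    then have "real (card U choose m) * real (m choose ?j) = real (card U choose ?j) * real (card U - ?j choose (m - ?j))"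
      by (metis of_nat_mult)
    moreover have "real (card U choose m) \<noteq> 0" "real (card U choose ?j) \<noteq> 0"
      using m_le True by (auto simp: binomial_eq_0_iff)
    ultimately show ?thesis by (simp add: field_simps)
  qed
  also have "\<dots> = (\<Prod>i<?j. (real m - real i) / (real (card U) - real i))" by (rule binomial_ratio)
  also have "\<dots> \<le> (\<Prod>i<?j. real m / real (card U))"
  proof (intro prod_mono conjI)
    fix i assume i: "i \<in> {..<?j}"
    then have "real i < real m" "real m \<le> real (card U)" using True m_le by auto
    then show "0 \<le> (real m - real i) / (real (card U) - real i)"
      "(real m - real i) / (real (card U) - real i) \<le> real m / real (card U)"
      by (auto simp: field_simps mult_left_mono)
  qed
  finally show ?thesis by simp
qed

text \<open>Union bound over the \<open>j\<close>-element subsets of \<open>F\<close> that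
  \<open>E\<close> might contain.\<close>

lemma pr_inter_card_ge:
  assumes F: "F \<subseteq> U"
  shows "pr {E. j \<le> card (E \<inter> F)} \<le> (real (card F) * real m / real (card U)) ^ j"
proof -
  define \<J> where "\<J> = {J. J \<subseteq> F \<and> card J = j}"
  have finF: "finite F" using F finite_U by (rule finite_subset)
  have fin: "finite \<J>" by (rule finite_subset[of _ "Pow F"]) (auto simp: \<J>_def finF)
  have "pr {E. j \<le> card (E \<inter> F)} \<le> pr (\<Union>J\<in>\<J>. {E. J \<subseteq> E})"
  proof (rule measure_pmf.finite_measure_mono)
    show "{E. j \<le> card (E \<inter> F)} \<subseteq> (\<Union>J\<in>\<J>. {E. J \<subseteq> E})"
    proof
      fix E assume "E \<in> {E. j \<le> card (E \<inter> F)}"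
      then obtain J where "J \<subseteq> E \<inter> F" "card J = j" by (auto elim: obtain_subset_with_card_n)
      then show "E \<in> (\<Union>J\<in>\<J>. {E. J \<subseteq> E})" by (auto simp: \<J>_def)
    qed
  qed simp
  also have "\<dots> \<le> (\<Sum>J\<in>\<J>. pr {E. J \<subseteq> E})"
    using fin by (intro measure_UNION_le) auto
  also have "\<dots> \<le> (\<Sum>J\<in>\<J>. (real m / real (card U)) ^ j)"
    using pr_contains_le F by (intro sum_mono) (fastforce simp: \<J>_def)
  also have "\<dots> = real (card F choose j) * (real m / real (card U)) ^ j"
    using finF by (simp add: \<J>_def n_subsets)
  also have "\<dots> \<le> real (card F ^ j) * (real m / real (card U)) ^ j"
  proof (intro mult_right_mono)
    have "card F choose j \<le> card F ^ j"
      by (cases "j \<le> card F") (auto simp: binomial_le_pow binomial_eq_0)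
    then show "real (card F choose j) \<le> real (card F ^ j)" by (simp only: of_nat_le_iff)
  qed simp
  also have "\<dots> = (real (card F) * real m / real (card U)) ^ j"
    by (simp add: power_mult_distrib power_divide)
  finally show ?thesis .
qed

end

section \<open>Expansion from blocks\<close>

context doubly_stochastic
begin

text \<open>One summand of the sum in \<open>expands\<close>; it is positive only at a state entered
  from both sides of the cut.\<close>

definition flow :: "'a set \<Rightarrow> 'a \<Rightarrow> real" where
  "flow A y = (\<Sum>x\<in>A. P x y) * (\<Sum>z\<in>X - A. P z y)"

lemma flow_ge:
  assumes "A \<subseteq> X" "x \<in> A" "y \<in> X - A" "z \<in> X" "a \<le> P x z" "b \<le> P y z" "0 \<le> a" "0 \<le> b"
  shows "a * b \<le> flow A z"
proof -
  have "P x z \<le> (\<Sum>x\<in>A. P x z)"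
    using assms finite_X finite_subset[of A X] P_nonneg by (intro member_le_sum) auto
  moreover have "P y z \<le> (\<Sum>x\<in>X - A. P x z)"
    using assms finite_X P_nonneg by (intro member_le_sum) auto
  ultimately show ?thesis unfolding flow_def using assms by (intro mult_mono) auto
qed

lemma flow_nonneg:
  assumes "A \<subseteq> X" "z \<in> X"
  shows "0 \<le> flow A z"
  unfolding flow_def using assms P_nonneg by (intro mult_nonneg_nonneg sum_nonneg) auto

text \<open>A set of at most half the states splits many blocks, or consists mostly of full blocks; in
  the second case the bridge condition, applied to the full blocks without a bridge to an
  empty block, shows that these are a minority.\<close>

lemma block_expansion:
  fixes blk :: "'a \<Rightarrow> nat" and l k :: nat and adj :: "'a \<Rightarrow> 'a \<Rightarrow> bool"
  assumes blk: "\<And>x. x \<in> X \<Longrightarrow> blk x < k" and l: "l > 0" and \<kappa>: "\<kappa> > 0"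
    and small: "card X < (k + 1) * l"
    and size_ge: "\<And>b. b < k \<Longrightarrow> l \<le> card {x\<in>X. blk x = b}"
    and size_le: "\<And>b. b < k \<Longrightarrow> card {x\<in>X. blk x = b} \<le> 2 * l"
    and split: "\<And>A x y. A \<subseteq> X \<Longrightarrow> x \<in> A \<Longrightarrow> y \<in> X - A \<Longrightarrow> blk x = blk y \<Longrightarrow>
        \<exists>z\<in>X. blk z = blk x \<and> \<kappa> \<le> flow A z"
    and bridge: "\<And>A x y. A \<subseteq> X \<Longrightarrow> {z\<in>X. blk z = blk x} \<subseteq> A \<Longrightarrow> x \<in> A \<Longrightarrow> y \<in> X - A \<Longrightarrow> adj x y \<Longrightarrow>
        \<exists>z\<in>X. blk z = blk x \<and> \<kappa> \<le> flow A z"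
    and connected: "\<And>S R. S \<subseteq> R \<Longrightarrow> R \<subseteq> {..<k} \<Longrightarrow> S \<noteq> {} \<Longrightarrow> card R \<le> 3 * card S \<Longrightarrow> 4 * card R \<le> 3 * k \<Longrightarrow>
        \<exists>x\<in>X. \<exists>y\<in>X. blk x \<in> S \<and> blk y \<notin> R \<and> adj x y"
  shows "expands (\<kappa> / (10 * real l))"
  unfolding expands_def
proof (intro conjI allI impI)
  show "\<kappa> / (10 * real l) > 0" using l \<kappa> by simp
next
  fix A assume A: "A \<subseteq> X" "A \<noteq> {}" "2 * card A \<le> card X"
  define B where "B b = {x\<in>X. blk x = b}" for b
  define F where "F = {b\<in>{..<k}. B b \<subseteq> A}"
  define D where "D = {b\<in>{..<k}. B b \<inter> A \<noteq> {} \<and> \<not> B b \<subseteq> A}"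
  define G where "G = {b\<in>{..<k}. \<exists>z\<in>X. blk z = b \<and> \<kappa> \<le> flow A z}"
  have fin: "finite F" "finite D" "finite G" "finite (B b)" for b
    using finite_X by (auto simp: F_def D_def G_def B_def)
  have FD: "F \<inter> D = {}" by (auto simp: F_def D_def)
  have DG: "D \<subseteq> G"
  proof
    fix b assume "b \<in> D"
    then obtain x y where "x \<in> A" "blk x = b" "y \<in> X - A" "blk y = b" "b < k"
      by (auto simp: D_def B_def)
    then show "b \<in> G" using split[of A x y] A(1) by (auto simp: G_def)
  qed
  have card_A: "card A \<le> 2 * l * (card F + card D)"
  proof -
    have "A \<subseteq> (\<Union>b\<in>F \<union> D. B b)"
    proof
      fix x assume x: "x \<in> A"
      then have "x \<in> B (blk x)" "blk x < k" using A(1) blk by (auto simp: B_def)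
      moreover from this x have "blk x \<in> F \<union> D" by (auto simp: F_def D_def)
      ultimately show "x \<in> (\<Union>b\<in>F \<union> D. B b)" by blast
    qed
    then have "card A \<le> card (\<Union>b\<in>F \<union> D. B b)" using fin by (intro card_mono) auto
    also have "\<dots> \<le> (\<Sum>b\<in>F \<union> D. card (B b))" using fin by (intro card_UN_le) auto
    also have "\<dots> \<le> (\<Sum>b\<in>F \<union> D. 2 * l)"
      using size_le by (intro sum_mono) (auto simp: F_def D_def B_def)
    also have "\<dots> = 2 * l * (card F + card D)" using fin FD by (simp add: card_Un_disjoint)
    finally show ?thesis .
  qed
  \<comment> \<open>Each full block takes \<open>l\<close> of the at most \<open>card X / 2\<close>
    states of \<open>A\<close>. The bound \<open>small\<close> allows for a remainder beyond
    \<open>k * l\<close>, and integrality removes its effect.\<close>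
  have F_le: "2 * card F \<le> k"
  proof -
    have "card F * l = (\<Sum>b\<in>F. l)" by simp
    also have "\<dots> \<le> (\<Sum>b\<in>F. card (B b))"
      using size_ge by (intro sum_mono) (auto simp: F_def B_def)
    also have "\<dots> = card (\<Union>b\<in>F. B b)"
      using fin by (intro card_UN_disjoint[symmetric]) (auto simp: B_def)
    also have "\<dots> \<le> card A"
      using A(1) finite_X by (intro card_mono) (auto simp: F_def finite_subset)
    finally have "2 * card F * l < (k + 1) * l" using A(3) small by linarith
    then have "2 * card F < k + 1" using mult_less_cancel2[of "2 * card F" l "k + 1"] by blast
    then show ?thesis by simp
  qed
  \<comment> \<open>Either \<open>D\<close> exceeds a quarter of \<open>F\<close>, and
    \<open>D \<subseteq> G\<close> gives the factor 5, or at least half of \<open>F\<close> lies in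
    \<open>G\<close>, which gives even the factor 2.\<close>
  have card_G: "card F + card D \<le> 5 * card G"
  proof (cases "4 * card D \<le> card F")
    case False
    then show ?thesis using card_mono[OF fin(3) DG] by linarith
  next
    case True
    have "\<not> (2 * card (F - G) > card F)"
    proof
      assume big: "2 * card (F - G) > card F"
      \<comment> \<open>The split blocks \<open>D\<close> must be excluded as targets, since an edge
        into one of them could end in \<open>A\<close>. Here \<open>F \<union> D\<close> has at most
        5/4 of the size of \<open>F\<close>, hence less than 5/2 of that of \<open>F - G\<close> and
        at most 5/8 of \<open>k\<close>, within the factors 3 and 3/4 that \<open>connected\<close>
        permits.\<close>
      have "\<exists>x\<in>X. \<exists>y\<in>X. blk x \<in> F - G \<and> blk y \<notin> F \<union> D \<and> adj x y"
      proof (rule connected)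
        show "F - G \<noteq> {}" using big by (metis card.empty mult_0_right not_less_zero)
        show "card (F \<union> D) \<le> 3 * card (F - G)" "4 * card (F \<union> D) \<le> 3 * k"
          using big True F_le fin FD by (simp_all add: card_Un_disjoint)
      qed (auto simp: F_def D_def)
      then obtain x y where xy: "x \<in> X" "y \<in> X" "blk x \<in> F - G" "blk y \<notin> F \<union> D" "adj x y" by blast
      have "y \<notin> A" using xy blk[OF xy(2)] by (auto simp: F_def D_def B_def)
      moreover have "{z\<in>X. blk z = blk x} \<subseteq> A" "x \<in> A" using xy by (auto simp: F_def B_def)
      ultimately have "blk x \<in> G" using bridge[of A x y] A(1) xy blk by (auto simp: G_def)
      then show False using xy by simp
    qed
    moreover have "card F \<le> card (F - G) + card (F \<inter> G)"
      using card_Un_le[of "F - G" "F \<inter> G"] by (simp add: Un_Diff_Int)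
    moreover have "card (F \<inter> G) + card D \<le> card G"
    proof -
      have "card (F \<inter> G) + card D = card (F \<inter> G \<union> D)"
        using fin FD by (intro card_Un_disjoint[symmetric]) auto
      also have "\<dots> \<le> card G" using DG fin by (intro card_mono) auto
      finally show ?thesis .
    qed
    ultimately show ?thesis by linarith
  qed
  have "\<kappa> * real (card G) \<le> (\<Sum>y\<in>X. flow A y)"
  proof -
    \<comment> \<open>One state is chosen per good block; these states are distinct, so their flows
      add up.\<close>
    have "\<exists>z. \<forall>b\<in>G. z b \<in> X \<and> blk (z b) = b \<and> \<kappa> \<le> flow A (z b)"
      by (rule bchoice) (auto simp: G_def)
    then obtain z where z: "\<And>b. b \<in> G \<Longrightarrow> z b \<in> X \<and> blk (z b) = b \<and> \<kappa> \<le> flow A (z b)" by blast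
    have "\<kappa> * real (card G) = (\<Sum>b\<in>G. \<kappa>)" by simp
    also have "\<dots> \<le> (\<Sum>b\<in>G. flow A (z b))" using z by (intro sum_mono) auto
    also have "\<dots> = (\<Sum>y\<in>z ` G. flow A y)"
    proof (subst sum.reindex)
      show "inj_on z G" by (rule inj_on_inverseI[of _ blk]) (use z in auto)
    qed simp
    also have "\<dots> \<le> (\<Sum>y\<in>X. flow A y)"
      using z finite_X flow_nonneg[OF A(1)] by (intro sum_mono2) auto
    finally show ?thesis .
  qed
  moreover have "\<kappa> / (10 * real l) * real (card A) \<le> \<kappa> * real (card G)"
  proof -
    have "2 * l * (card F + card D) \<le> 2 * l * (5 * card G)" using card_G by (intro mult_left_mono) auto
    then have "card A \<le> 10 * l * card G" using card_A by (simp add: algebra_simps)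
    then have "real (card A) \<le> real (10 * l * card G)" by (simp only: of_nat_le_iff)
    then have "\<kappa> / (10 * real l) * real (card A) \<le> \<kappa> / (10 * real l) * real (10 * l * card G)"
      using \<kappa> l by (intro mult_left_mono) auto
    also have "\<dots> = \<kappa> * real (card G)" using l by simp
    finally show ?thesis .
  qed
  ultimately show "\<kappa> / (10 * real l) * real (card A) \<le> (\<Sum>y\<in>X. (\<Sum>x\<in>A. P x y) * (\<Sum>z\<in>X - A. P z y))"
    by (simp add: flow_def)
qed

end

section \<open>Two-colourings of an integer interval\<close>

lemma exists_adjacent_change:
  fixes a b :: nat
  assumes "a \<le> b" "c a \<noteq> c b"
  shows "\<exists>z. a \<le> z \<and> z < b \<and> c z \<noteq> c (Suc z)"
  using assms
proof (induction b rule: dec_induct)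
  case (step m)
  then show ?case by (metis le_imp_less_Suc less_Suc_eq less_or_eq_imp_le)
qed simp

text \<open>The relation at distance two leaves the two parity classes apart; one pair of equal
  neighbours joins them. It models a chain without holding, where two cycle steps meet only from
  nodes at distance two.\<close>

lemma constant_of_step_two:
  fixes a b w :: nat and c :: "nat \<Rightarrow> bool"
  assumes two: "\<And>z. a \<le> z \<Longrightarrow> z + 2 \<le> b \<Longrightarrow> c z = c (z + 2)"
    and w: "a \<le> w" "w + 1 \<le> b" "c w = c (w + 1)" and x: "a \<le> x" "x \<le> b"
  shows "c x = c w"
proof -
  \<comment> \<open>The induction carries a neighbouring pair, so that each step can use the
    relation at distance two.\<close>
  have up: "w + j + 1 \<le> b \<Longrightarrow> c (w + j) = c w \<and> c (w + j + 1) = c w" for j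
  proof (induction j)
    case (Suc j)
    then show ?case using two[of "w + j"] w(1) by (simp add: numeral_2_eq_2)
  qed (use w in simp)
  have down: "a + j \<le> w \<Longrightarrow> c (w - j) = c w \<and> c (w - j + 1) = c w" for j
  proof (induction j)
    case (Suc j)
    have "w - Suc j + 2 = w - j + 1" "w - Suc j + 1 = w - j" using Suc.prems by auto
    then show ?case using two[of "w - Suc j"] w Suc by auto
  qed (use w in simp)
  show ?thesis
  proof (cases "x \<le> w")
    case True
    then show ?thesis using down[of "w - x"] x by simp
  next
    case False
    then show ?thesis using up[of "x - w - 1"] x by simp
  qed
qed

section \<open>The homogeneous chain\<close>

locale cycle_chain =
  fixes n :: nat and E :: "nat set set" and q\<^sub>c q\<^sub>l r d :: real
  assumes n3: "3 \<le> n" and E_pairs: "E \<subseteq> node_pairs n" and d1: "1 \<le> d"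
    and qc: "0 < q\<^sub>c" and ql: "0 < q\<^sub>l" and r: "\<bar>r\<bar> \<le> q\<^sub>c" and q_le: "2 * q\<^sub>c + q\<^sub>l \<le> 1"
    and degree: "i < n \<Longrightarrow> real (long_range_degree E i) \<le> d"
begin

abbreviation ep :: "nat \<Rightarrow> nat \<Rightarrow> real" where
  "ep \<equiv> edge_prob n E q\<^sub>c q\<^sub>l r d"

definition P :: "nat \<Rightarrow> nat \<Rightarrow> real" where
  "P = homogeneous_chain n E q\<^sub>c q\<^sub>l r d"

lemma finite_E: "finite E"
proof (rule finite_subset)
  show "E \<subseteq> Pow {..<n}" using E_pairs by (auto simp: node_pairs_def)
qed simp

lemma Suc_mod_ne: "i < n \<Longrightarrow> (i + 1) mod n \<noteq> i"
  using n3 by (cases "i + 1 = n") auto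

lemma sum_succ: "i < n \<Longrightarrow> (\<Sum>j\<in>{..<n} - {i}. if j = (i + 1) mod n then a else 0) = (a :: real)"
  using Suc_mod_ne[of i] n3 by simp

lemma Suc_mod_eq_iff:
  assumes "i < n" "j < n"
  shows "i = (j + 1) mod n \<longleftrightarrow> j = (if i = 0 then n - 1 else i - 1)"
  using assms n3 by (cases "j + 1 = n") auto

lemma sum_pred:
  assumes i: "i < n"
  shows "(\<Sum>j\<in>{..<n} - {i}. if i = (j + 1) mod n then a else 0) = (a :: real)"
proof -
  have "(\<Sum>j\<in>{..<n} - {i}. if i = (j + 1) mod n then a else 0)
      = (\<Sum>j\<in>{..<n} - {i}. if j = (if i = 0 then n - 1 else i - 1) then a else 0)"
    using Suc_mod_eq_iff[OF i] by (intro sum.cong refl) auto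
  also have "\<dots> = a" using i n3 by (auto simp: sum.delta)
  finally show ?thesis .
qed

lemma sum_long:
  assumes i: "i < n"
  shows "(\<Sum>j\<in>{..<n} - {i}. if {i, j} \<in> E then a else 0) = a * real (long_range_degree E i)"
proof -
  have "bij_betw (\<lambda>j. {i, j}) {j\<in>{..<n} - {i}. {i, j} \<in> E} {e\<in>E. i \<in> e}"
  proof (rule bij_betwI')
    fix e assume e: "e \<in> {e \<in> E. i \<in> e}"
    then have "card e = 2" "e \<subseteq> {..<n}" using E_pairs by (auto simp: node_pairs_def)
    then obtain u v where uv: "e = {u, v}" "u \<noteq> v" by (auto simp: card_2_iff)
    then show "\<exists>j\<in>{j\<in>{..<n} - {i}. {i, j} \<in> E}. e = {i, j}"
      using e \<open>e \<subseteq> {..<n}\<close> by (auto simp: insert_commute)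
  qed (auto simp: doubleton_eq_iff)
  then have "card {j\<in>{..<n} - {i}. {i, j} \<in> E} = long_range_degree E i"
    unfolding long_range_degree_def by (rule bij_betw_same_card)
  moreover have "(\<Sum>j\<in>{..<n} - {i}. if {i, j} \<in> E then a else 0) = (\<Sum>j\<in>{j\<in>{..<n} - {i}. {i, j} \<in> E}. a)"
    by (subst sum.inter_filter) auto
  ultimately show ?thesis by simp
qed

lemma edge_prob_row:
  assumes "i < n"
  shows "(\<Sum>j\<in>{..<n} - {i}. ep i j) = 2 * q\<^sub>c + q\<^sub>l / d * real (long_range_degree E i)"
  unfolding edge_prob_def sum.distrib sum_succ[OF assms] sum_pred[OF assms] sum_long[OF assms] by simp

text \<open>Node \<open>i\<close> is entered clockwise from one neighbour with
  \<open>q\<^sub>c + r\<close> and counterclockwise from the other with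
  \<open>q\<^sub>c - r\<close>, so \<open>r\<close> cancels as it does in rows. This makes the chain
  doubly stochastic even when it is not reversible.\<close>

lemma edge_prob_col:
  assumes "i < n"
  shows "(\<Sum>j\<in>{..<n} - {i}. ep j i) = 2 * q\<^sub>c + q\<^sub>l / d * real (long_range_degree E i)"
  unfolding edge_prob_def sum.distrib insert_commute[of _ i] sum_succ[OF assms] sum_pred[OF assms] sum_long[OF assms]
  by simp

lemma P_diag: "i < n \<Longrightarrow> P i i = 1 - (2 * q\<^sub>c + q\<^sub>l / d * real (long_range_degree E i))"
  by (simp add: P_def homogeneous_chain_def edge_prob_row)

lemma edge_prob_nonneg: "0 \<le> ep i j"
  using r ql d1 by (auto simp: edge_prob_def)

lemma P_off_diag: "i \<noteq> j \<Longrightarrow> P i j = ep i j"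
  by (simp add: P_def homogeneous_chain_def)

sublocale doubly_stochastic "{..<n}" P
proof
  show "{..<n} \<noteq> {}" using n3 by (auto simp: lessThan_empty_iff)
next
  fix i j assume ij: "i \<in> {..<n}" "j \<in> {..<n}"
  show "0 \<le> P i j"
  proof (cases "i = j")
    case True
    have "q\<^sub>l / d * real (long_range_degree E i) \<le> q\<^sub>l / d * d"
      using degree[of i] ij ql d1 by (intro mult_left_mono) auto
    then show ?thesis using True ij q_le d1 by (simp add: P_diag)
  qed (simp add: P_off_diag edge_prob_nonneg)
next
  fix i assume i: "i \<in> {..<n}"
  have "(\<Sum>j<n. P i j) = P i i + (\<Sum>j\<in>{..<n} - {i}. P i j)"
    using i by (subst sum.remove[of _ i]) auto
  also have "(\<Sum>j\<in>{..<n} - {i}. P i j) = (\<Sum>j\<in>{..<n} - {i}. ep i j)"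
    by (intro sum.cong refl) (auto simp: P_off_diag)
  finally show "(\<Sum>j<n. P i j) = 1" using i by (simp add: P_diag edge_prob_row)
  have "(\<Sum>j<n. P j i) = P i i + (\<Sum>j\<in>{..<n} - {i}. P j i)"
    using i by (subst sum.remove[of _ i]) auto
  also have "(\<Sum>j\<in>{..<n} - {i}. P j i) = (\<Sum>j\<in>{..<n} - {i}. ep j i)"
    by (intro sum.cong refl) (auto simp: P_off_diag)
  finally show "(\<Sum>j<n. P j i) = 1" using i by (simp add: P_diag edge_prob_col)
qed simp

text \<open>Only an inequality, because a long range edge may coincide with the cycle edge and add
  to it.\<close>

lemma P_succ: "Suc i < n \<Longrightarrow> q\<^sub>c + r \<le> P i (Suc i)"
  using r ql d1 by (auto simp: P_off_diag edge_prob_def)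

lemma P_pred: "Suc i < n \<Longrightarrow> q\<^sub>c - r \<le> P (Suc i) i"
  using r ql d1 by (auto simp: P_off_diag edge_prob_def)

lemma P_long: "{i, j} \<in> E \<Longrightarrow> q\<^sub>l / d \<le> P i j"
proof -
  assume e: "{i, j} \<in> E"
  then have "card {i, j} = 2" using E_pairs by (auto simp: node_pairs_def)
  then have "i \<noteq> j" by auto
  then show ?thesis using e r by (auto simp: P_off_diag edge_prob_def)
qed

text \<open>A common lower bound for the products of two transition probabilities into one node that
  occur below: two cycle steps, a cycle step and a long range edge, or holding together with one of
  these. The degree bound enters only through \<open>q\<^sub>l / d\<close>.\<close>

definition \<kappa> :: real where
  "\<kappa> = q\<^sub>c * min q\<^sub>c (q\<^sub>l / d)"

lemma \<kappa>_bounds: "0 < \<kappa>" "\<kappa> \<le> q\<^sub>c * q\<^sub>c" "\<kappa> \<le> q\<^sub>c * (q\<^sub>l / d)" "\<kappa> \<le> q\<^sub>l * q\<^sub>c"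
  "\<kappa> \<le> 1 / 2 * (q\<^sub>l / d)" "\<kappa> \<le> 1 / 2 * q\<^sub>c"
proof -
  show "0 < \<kappa>" using qc ql d1 by (simp add: \<kappa>_def)
  show 1: "\<kappa> \<le> q\<^sub>c * q\<^sub>c" using qc by (simp add: \<kappa>_def)
  show 2: "\<kappa> \<le> q\<^sub>c * (q\<^sub>l / d)" unfolding \<kappa>_def using qc by (intro mult_left_mono) auto
  have "q\<^sub>l / d \<le> q\<^sub>l / 1" using ql d1 by (intro divide_left_mono) auto
  then have "q\<^sub>c * (q\<^sub>l / d) \<le> q\<^sub>c * q\<^sub>l" using qc by (intro mult_left_mono) auto
  with 2 show "\<kappa> \<le> q\<^sub>l * q\<^sub>c" by (simp add: mult.commute)
  have h: "q\<^sub>c \<le> 1 / 2" using q_le ql by simp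
  have "q\<^sub>c * (q\<^sub>l / d) \<le> 1 / 2 * (q\<^sub>l / d)" using h ql d1 by (intro mult_right_mono) auto
  with 2 show "\<kappa> \<le> 1 / 2 * (q\<^sub>l / d)" by simp
  have "q\<^sub>c * q\<^sub>c \<le> 1 / 2 * q\<^sub>c" using h qc by (intro mult_right_mono) auto
  with 1 show "\<kappa> \<le> 1 / 2 * q\<^sub>c" by simp
qed

end

section \<open>Expansion of the chain from connected blocks\<close>

locale blocked_cycle_chain = cycle_chain +
  fixes k l :: nat and blk :: "nat \<Rightarrow> nat"
  assumes l2: "2 \<le> l" and n_less: "n < (k + 1) * l"
    and blk_less: "x < n \<Longrightarrow> blk x < k"
    and blk_mono: "x \<le> y \<Longrightarrow> y < n \<Longrightarrow> blk x \<le> blk y"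
    and blk_size_ge: "b < k \<Longrightarrow> l \<le> card {x\<in>{..<n}. blk x = b}"
    and blk_size_le: "b < k \<Longrightarrow> card {x\<in>{..<n}. blk x = b} \<le> 2 * l"
    and connected: "S \<subseteq> R \<Longrightarrow> R \<subseteq> {..<k} \<Longrightarrow> S \<noteq> {} \<Longrightarrow> card R \<le> 3 * card S \<Longrightarrow> 4 * card R \<le> 3 * k \<Longrightarrow>
        \<exists>x<n. \<exists>y<n. blk x \<in> S \<and> blk y \<notin> R \<and> {x, y} \<in> E"
begin

lemma blk_convex: "x \<le> z \<Longrightarrow> z \<le> y \<Longrightarrow> y < n \<Longrightarrow> blk x = blk y \<Longrightarrow> blk z = blk x"
  using blk_mono[of x z] blk_mono[of z y] by simp

lemma expands_of_split_bridge:
  assumes split: "\<And>A x y. A \<subseteq> {..<n} \<Longrightarrow> x \<in> A \<Longrightarrow> y \<in> {..<n} - A \<Longrightarrow> blk x = blk y \<Longrightarrow>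
        \<exists>z<n. blk z = blk x \<and> \<kappa> \<le> flow A z"
    and bridge: "\<And>A x y. A \<subseteq> {..<n} \<Longrightarrow> {z\<in>{..<n}. blk z = blk x} \<subseteq> A \<Longrightarrow> x \<in> A \<Longrightarrow> y \<in> {..<n} - A \<Longrightarrow> {x, y} \<in> E \<Longrightarrow>
        \<kappa> \<le> flow A x"
  shows "expands (\<kappa> / (10 * real l))"
proof (rule block_expansion[where blk = blk and k = k and adj = "\<lambda>x y. {x, y} \<in> E"])
  fix A x y
  show "\<exists>z\<in>{..<n}. blk z = blk x \<and> \<kappa> \<le> flow A z"
    if "A \<subseteq> {..<n}" "x \<in> A" "y \<in> {..<n} - A" "blk x = blk y"
    using split[OF that] by auto
  show "\<exists>z\<in>{..<n}. blk z = blk x \<and> \<kappa> \<le> flow A z"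
    if "A \<subseteq> {..<n}" "{z\<in>{..<n}. blk z = blk x} \<subseteq> A" "x \<in> A" "y \<in> {..<n} - A" "{x, y} \<in> E"
    using bridge[OF that] that by auto
next
  fix S R :: "nat set"
  assume "S \<subseteq> R" "R \<subseteq> {..<k}" "S \<noteq> {}" "card R \<le> 3 * card S" "4 * card R \<le> 3 * k"
  from connected[OF this] show "\<exists>x\<in>{..<n}. \<exists>y\<in>{..<n}. blk x \<in> S \<and> blk y \<notin> R \<and> {x, y} \<in> E" by blast
qed (use l2 \<kappa>_bounds n_less blk_less blk_size_ge blk_size_le in auto)

lemma flow_ge':
  assumes "A \<subseteq> {..<n}" "x < n" "y < n" "z < n" "(x \<in> A) \<noteq> (y \<in> A)" "a \<le> P x z" "b \<le> P y z" "0 \<le> a" "0 \<le> b"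
  shows "a * b \<le> flow A z"
proof (cases "x \<in> A")
  case True
  then show ?thesis using assms flow_ge[of A x y z a b] by auto
next
  case False
  then show ?thesis using assms flow_ge[of A y x z b a] by (auto simp: mult.commute)
qed

text \<open>Blocks are intervals, so the path between the two nodes stays in the block and must
  change sides on the way.\<close>

lemma change_in_block:
  assumes A: "x \<in> A" "x < n" "y < n" "y \<notin> A" "blk x = blk y"
  obtains z where "Suc z < n" "blk z = blk x" "blk (Suc z) = blk x" "(z \<in> A) \<noteq> (Suc z \<in> A)"
proof -
  define u where "u = min x y"
  define v where "v = max x y"
  have uv: "u \<le> v" "v < n" "blk u = blk x" "blk v = blk x" "(u \<in> A) \<noteq> (v \<in> A)"
    using A by (auto simp: u_def v_def min_def max_def)
  obtain z where z: "u \<le> z" "z < v" "(z \<in> A) \<noteq> (Suc z \<in> A)"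
    using exists_adjacent_change[of u v "\<lambda>z. z \<in> A"] uv by auto
  show thesis
    using that[of z] z uv blk_convex[of u z v] blk_convex[of u "Suc z" v] by auto
qed

text \<open>A node that holds is entered from its own side; any further transition into it from the
  other side creates flow there.\<close>

lemma expands_of_lazy:
  assumes lazy: "\<And>x. x < n \<Longrightarrow> 1 / 2 \<le> P x x"
  shows "expands (\<kappa> / (10 * real l))"
proof (rule expands_of_split_bridge)
  fix A x y assume A: "A \<subseteq> {..<n}" "x \<in> A" "y \<in> {..<n} - A" "blk x = blk y"
  then obtain z where z: "Suc z < n" "blk z = blk x" "blk (Suc z) = blk x" "(z \<in> A) \<noteq> (Suc z \<in> A)"
    using change_in_block[of x A y] by auto
  show "\<exists>z<n. blk z = blk x \<and> \<kappa> \<le> flow A z"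
  \<comment> \<open>As \<open>\<bar>r\<bar> = q\<^sub>c\<close> is allowed, one direction may have
    probability 0. The direction with probability at least \<open>q\<^sub>c\<close> decides which
    end of the changing pair carries the flow.\<close>
  proof (cases "0 \<le> r")
    case True
    have "1 / 2 * q\<^sub>c \<le> flow A (Suc z)"
      using A z lazy[of "Suc z"] P_succ[of z] True qc by (intro flow_ge'[of A "Suc z" z]) auto
    then show ?thesis using z \<kappa>_bounds by (intro exI[of _ "Suc z"]) auto
  next
    case False
    have "1 / 2 * q\<^sub>c \<le> flow A z"
      using A z lazy[of z] P_pred[of z] False qc by (intro flow_ge'[of A z "Suc z"]) auto
    then show ?thesis using z \<kappa>_bounds by (intro exI[of _ z]) auto
  qed
next
  fix A x y assume A: "A \<subseteq> {..<n}" "x \<in> A" "y \<in> {..<n} - A" "{x, y} \<in> E"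
  have "1 / 2 * (q\<^sub>l / d) \<le> flow A x"
    using A lazy[of x] P_long[of y x] ql d1 by (intro flow_ge'[of A x y]) (auto simp: insert_commute)
  then show "\<kappa> \<le> flow A x" using \<kappa>_bounds by simp
qed

text \<open>Without holding probability, a set that alternates inside a block has no flow there. An
  isolated node, which holds with probability at least \<open>q\<^sub>l\<close>, excludes this.\<close>

lemma expands_of_isolated:
  assumes r0: "r = 0"
    and isolated: "\<And>b. b < k \<Longrightarrow> \<exists>w. Suc w < n \<and> blk w = b \<and> blk (Suc w) = b \<and> long_range_degree E w = 0"
  shows "expands (\<kappa> / (10 * real l))"
proof (rule expands_of_split_bridge)
  fix A x y assume A: "A \<subseteq> {..<n}" "x \<in> A" "y \<in> {..<n} - A" "blk x = blk y"
  have x: "x < n" using A by auto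
  show "\<exists>z<n. blk z = blk x \<and> \<kappa> \<le> flow A z"
  proof (rule ccontr)
    assume "\<not> ?thesis"
    then have no: "\<not> \<kappa> \<le> flow A z" if "z < n" "blk z = blk x" for z using that by blast
    obtain w where w: "Suc w < n" "blk w = blk x" "blk (Suc w) = blk x" "long_range_degree E w = 0"
      using isolated[OF blk_less[OF x]] by auto
    \<comment> \<open>The isolated node holds with probability \<open>1 - 2 * q\<^sub>c\<close>, at
      least \<open>q\<^sub>l\<close>, so a neighbour on the other side would create flow at
      \<open>w\<close>.\<close>
    have cw: "(w \<in> A) = (Suc w \<in> A)"
    proof (rule ccontr)
      assume "(w \<in> A) \<noteq> (Suc w \<in> A)"
      moreover have "q\<^sub>l \<le> P w w" using w q_le by (simp add: P_diag)
      ultimately have "q\<^sub>l * q\<^sub>c \<le> flow A w"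
        using A w P_pred[of w] r0 qc ql by (intro flow_ge'[of A w "Suc w"]) auto
      then show False using no[of w] w \<kappa>_bounds by auto
    qed
    define S where "S = {z\<in>{..<n}. blk z = blk x}"
    have S: "finite S" "S \<noteq> {}" using x by (auto simp: S_def)
    define a where "a = Min S"
    define b where "b = Max S"
    have ab: "a \<in> S" "b \<in> S" using S by (auto simp: a_def b_def)
    have in_S: "a \<le> z" "z \<le> b" if "z \<in> S" for z using that S by (auto simp: a_def b_def)
    have conv: "z < n \<and> blk z = blk x" if "a \<le> z" "z \<le> b" for z
      using ab that blk_convex[of a z b] by (auto simp: S_def)
    \<comment> \<open>The node in the middle is entered from both neighbours, so without flow there
      they lie on the same side.\<close>
    have two: "(z \<in> A) = (z + 2 \<in> A)" if z: "a \<le> z" "z + 2 \<le> b" for z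
    proof (rule ccontr)
      assume "(z \<in> A) \<noteq> (z + 2 \<in> A)"
      then have "q\<^sub>c * q\<^sub>c \<le> flow A (Suc z)"
        using A z conv[of z] conv[of "Suc z"] conv[of "z + 2"] P_succ[of z] P_pred[of "Suc z"] r0 qc
        by (intro flow_ge'[of A z "z + 2"]) auto
      then show False using no[of "Suc z"] z conv[of "Suc z"] \<kappa>_bounds by auto
    qed
    have const: "(z \<in> A) = (w \<in> A)" if "z \<in> S" for z
      by (rule constant_of_step_two[of a b "\<lambda>z. z \<in> A"])
         (use two cw w in_S[of w] in_S[of "Suc w"] in_S[of z] that in \<open>auto simp: S_def\<close>)
    show False using const[of x] const[of y] A x by (auto simp: S_def)
  qed
next
  fix A x y assume A: "A \<subseteq> {..<n}" "{z\<in>{..<n}. blk z = blk x} \<subseteq> A" "x \<in> A" "y \<in> {..<n} - A" "{x, y} \<in> E"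
  have x: "x < n" using A by auto
  \<comment> \<open>In place of holding, a neighbour of \<open>x\<close> in the same full block
    steps to \<open>x\<close>, while \<open>y\<close> reaches \<open>x\<close> along the bridge.
    Such a neighbour exists because \<open>2 \<le> l\<close>.\<close>
  have "\<exists>u<n. u \<noteq> x \<and> blk u = blk x"
  proof (rule ccontr)
    assume "\<not> ?thesis"
    then have "{z\<in>{..<n}. blk z = blk x} = {x}" using x by auto
    then show False using blk_size_ge[OF blk_less[OF x]] l2 by simp
  qed
  then obtain u where u: "u < n" "u \<noteq> x" "blk u = blk x" by blast
  have "\<exists>v<n. v \<in> A \<and> q\<^sub>c \<le> P v x"
  proof (cases "u < x")
    case True
    have "blk (x - 1) = blk u" by (rule blk_convex[of _ _ x]) (use True u x in auto)
    then show ?thesis using A True x u P_succ[of "x - 1"] r0 by (intro exI[of _ "x - 1"]) auto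
  next
    case False
    have "blk (Suc x) = blk x" by (rule blk_convex[of _ _ u]) (use False u x in auto)
    then show ?thesis using A False x u P_pred[of x] r0 by (intro exI[of _ "Suc x"]) auto
  qed
  then obtain v where v: "v < n" "v \<in> A" "q\<^sub>c \<le> P v x" by blast
  have "q\<^sub>c * (q\<^sub>l / d) \<le> flow A x"
    using A v x P_long[of y x] ql qc d1 by (intro flow_ge'[of A v y]) (auto simp: insert_commute)
  then show "\<kappa> \<le> flow A x" using \<kappa>_bounds by simp
qed

end

section \<open>Lower bounds from an interval without long range edges\<close>

context cycle_chain
begin

lemma isolated_not_edge:
  assumes "long_range_degree E x = 0"
  shows "{x, y} \<notin> E"
  using assms finite_E by (auto simp: long_range_degree_def)

lemma sum_P_isolated:
  assumes x: "0 < x" "Suc x < n" and deg: "long_range_degree E x = 0"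
  shows "(\<Sum>y<n. P x y * f y) = (1 - 2 * q\<^sub>c) * f x + (q\<^sub>c + r) * f (Suc x) + (q\<^sub>c - r) * f (x - 1)"
proof -
  have "P x y = (if y = x then 1 - 2 * q\<^sub>c else 0) + (if y = Suc x then q\<^sub>c + r else 0) + (if y = x - 1 then q\<^sub>c - r else 0)"
    if "y < n" for y
  proof (cases "y = x")
    case True
    moreover have "x \<noteq> x - 1" using x by simp
    ultimately show ?thesis using x deg by (simp add: P_diag)
  next
    case False
    then show ?thesis using x that Suc_mod_eq_iff[of x y] isolated_not_edge[OF deg]
      by (simp add: P_off_diag edge_prob_def)
  qed
  then have "(\<Sum>y<n. P x y * f y) = (\<Sum>y<n. (if y = x then (1 - 2 * q\<^sub>c) * f y else 0)
      + (if y = Suc x then (q\<^sub>c + r) * f y else 0) + (if y = x - 1 then (q\<^sub>c - r) * f y else 0))"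
    by (intro sum.cong refl) (auto simp: algebra_simps)
  also have "\<dots> = (1 - 2 * q\<^sub>c) * f x + (q\<^sub>c + r) * f (Suc x) + (q\<^sub>c - r) * f (x - 1)"
    using x by (simp add: sum.distrib less_imp_diff_less)
  finally show ?thesis .
qed

text \<open>Truncation at \<open>w\<close> settles all nodes outside the gap at once: there the
  potential is maximal and cannot grow, wherever the long range edges lead.\<close>

lemma mixing_time_gt_of_gap:
  fixes \<phi> :: "real \<Rightarrow> real" and w x0 :: nat
  assumes ex: "expands h" and w: "0 < w" "w \<le> x0" "x0 + w < n"
    and gap: "\<And>x. x0 - w \<le> x \<Longrightarrow> x \<le> x0 + w \<Longrightarrow> long_range_degree E x = 0"
    and mono: "\<And>s t. 0 \<le> s \<Longrightarrow> s \<le> t \<Longrightarrow> \<phi> s \<le> \<phi> t" and \<phi>: "\<phi> 0 = 0" "0 < \<phi> (real w)"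
    and drift: "\<And>u. (1 - 2 * q\<^sub>c) * \<phi> \<bar>u\<bar> + (q\<^sub>c + r) * \<phi> \<bar>u + 1\<bar> + (q\<^sub>c - r) * \<phi> \<bar>u - 1\<bar> \<le> \<phi> \<bar>u\<bar> + 1"
    and small: "8 * real w \<le> (1 - \<epsilon>) * real n" and eps: "\<epsilon> < 1"
    and t: "t \<le> (1 - \<epsilon>) / 4 * \<phi> (real w)"
  shows "ereal t < ereal_of_enat (mixing_time {..<n} P \<epsilon>)"
proof -
  define f where "f y = \<phi> (min \<bar>real y - real x0\<bar> (real w))" for y :: nat
  have f_le: "f y \<le> \<phi> (real w)" "f y \<le> \<phi> \<bar>real y - real x0\<bar>" "0 \<le> f y" for y
    unfolding f_def using mono[of 0 "min \<bar>real y - real x0\<bar> (real w)"] \<phi>(1) by (auto intro!: mono)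
  show ?thesis
  proof (rule mixing_time_gt[OF ex, where f = f and ?x0.0 = x0 and M = "\<phi> (real w)"])
    show "x0 \<in> {..<n}" "f x0 = 0" using w \<phi> by (auto simp: f_def)
    show "0 \<le> f x" for x by (rule f_le)
    show "(\<Sum>y<n. P x y * f y) \<le> f x + 1" if "x \<in> {..<n}" for x
    proof (cases "\<bar>real x - real x0\<bar> < real w")
      case True
      \<comment> \<open>The strict inequality keeps both cycle neighbours within the range, without
        wrapping around.\<close>
      then have x: "0 < x" "Suc x < n" "x0 - w \<le> x" "x \<le> x0 + w" using w by linarith+
      define u where "u = real x - real x0"
      have u: "real (Suc x) - real x0 = u + 1" "real (x - 1) - real x0 = u - 1"
        using x by (auto simp: u_def of_nat_diff)
      have "(\<Sum>y<n. P x y * f y) = (1 - 2 * q\<^sub>c) * f x + (q\<^sub>c + r) * f (Suc x) + (q\<^sub>c - r) * f (x - 1)"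
        using x gap by (intro sum_P_isolated) auto
      also have "\<dots> \<le> (1 - 2 * q\<^sub>c) * \<phi> \<bar>u\<bar> + (q\<^sub>c + r) * \<phi> \<bar>u + 1\<bar> + (q\<^sub>c - r) * \<phi> \<bar>u - 1\<bar>"
        using f_le(2)[of x] f_le(2)[of "Suc x"] f_le(2)[of "x - 1"] r q_le ql unfolding u u_def[symmetric]
        by (intro add_mono mult_left_mono) auto
      also have "\<dots> \<le> \<phi> \<bar>u\<bar> + 1" by (rule drift)
      also have "\<phi> \<bar>u\<bar> = f x" using True by (simp add: f_def u_def)
      finally show ?thesis .
    next
      case False
      then have fx: "f x = \<phi> (real w)" by (simp add: f_def)
      have "(\<Sum>y<n. P x y * f y) \<le> (\<Sum>y<n. P x y * \<phi> (real w))"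
        using P_nonneg that f_le by (intro sum_mono mult_left_mono) auto
      also have "\<dots> = f x" using row_sum[OF that] by (simp add: fx sum_distrib_right[symmetric])
      finally show ?thesis by simp
    qed
    have "{x \<in> {..<n}. f x < \<phi> (real w)} \<subseteq> {x0 - w<..<x0 + w}"
    proof
      fix x assume "x \<in> {x \<in> {..<n}. f x < \<phi> (real w)}"
      then have "\<bar>real x - real x0\<bar> < real w" by (cases "real w \<le> \<bar>real x - real x0\<bar>") (auto simp: f_def)
      then show "x \<in> {x0 - w<..<x0 + w}" using w by (auto simp: abs_less_iff)
    qed
    then have "card {x \<in> {..<n}. f x < \<phi> (real w)} \<le> card {x0 - w<..<x0 + w}"
      by (intro card_mono) auto
    also have "\<dots> \<le> 2 * w" using w by simp
    finally have "real (card {x \<in> {..<n}. f x < \<phi> (real w)}) \<le> real (2 * w)" by (simp only: of_nat_le_iff)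
    then show "real (card {x \<in> {..<n}. f x < \<phi> (real w)}) \<le> (1 - \<epsilon>) / 4 * real (card {..<n})"
      using small by simp
  qed (use \<phi> t eps in auto)
qed

text \<open>For \<open>r = 0\<close> the linear terms in \<open>u\<close> cancel and the squared
  distance grows by \<open>2 * q\<^sub>c\<close> in expectation, hence the diffusive time scale
  \<open>w^2\<close>.\<close>

lemma mixing_time_gt_reversible:
  assumes "expands h" "r = 0" "0 < w" "w \<le> x0" "x0 + w < n"
    and "\<And>x. x0 - w \<le> x \<Longrightarrow> x \<le> x0 + w \<Longrightarrow> long_range_degree E x = 0"
    and "8 * real w \<le> (1 - \<epsilon>) * real n" "\<epsilon> < 1" "t \<le> (1 - \<epsilon>) / 4 * real w ^ 2"
  shows "ereal t < ereal_of_enat (mixing_time {..<n} P \<epsilon>)"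
proof (rule mixing_time_gt_of_gap[where \<phi> = "\<lambda>s. s ^ 2", OF assms(1,3,4,5)])
  show "(1 - 2 * q\<^sub>c) * \<bar>u\<bar>^2 + (q\<^sub>c + r) * \<bar>u + 1\<bar>^2 + (q\<^sub>c - r) * \<bar>u - 1\<bar>^2 \<le> \<bar>u\<bar>^2 + 1" for u
  proof -
    have "(1 - 2 * q\<^sub>c) * \<bar>u\<bar>^2 + (q\<^sub>c + r) * \<bar>u + 1\<bar>^2 + (q\<^sub>c - r) * \<bar>u - 1\<bar>^2 = u^2 + 2 * q\<^sub>c"
      using assms(2) by (simp add: power2_eq_square algebra_simps)
    then show ?thesis using q_le ql by simp
  qed
qed (use assms in \<open>auto intro: power_mono\<close>)

text \<open>With a drift the square can grow by an amount proportional to \<open>u\<close>. The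
  distance itself grows by at most \<open>2 * q\<^sub>c\<close> in expectation for every
  \<open>r\<close>, which gives only a time linear in \<open>w\<close>.\<close>

lemma mixing_time_gt_general:
  assumes "expands h" "0 < w" "w \<le> x0" "x0 + w < n"
    and "\<And>x. x0 - w \<le> x \<Longrightarrow> x \<le> x0 + w \<Longrightarrow> long_range_degree E x = 0"
    and "8 * real w \<le> (1 - \<epsilon>) * real n" "\<epsilon> < 1" "t \<le> (1 - \<epsilon>) / 4 * real w"
  shows "ereal t < ereal_of_enat (mixing_time {..<n} P \<epsilon>)"
proof (rule mixing_time_gt_of_gap[where \<phi> = "\<lambda>s. s", OF assms(1-4)])
  show "(1 - 2 * q\<^sub>c) * \<bar>u\<bar> + (q\<^sub>c + r) * \<bar>u + 1\<bar> + (q\<^sub>c - r) * \<bar>u - 1\<bar> \<le> \<bar>u\<bar> + 1" for u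
  proof -
    have "(q\<^sub>c + r) * \<bar>u + 1\<bar> \<le> (q\<^sub>c + r) * (\<bar>u\<bar> + 1)" "(q\<^sub>c - r) * \<bar>u - 1\<bar> \<le> (q\<^sub>c - r) * (\<bar>u\<bar> + 1)"
      using r by (auto intro!: mult_left_mono)
    then have "(1 - 2 * q\<^sub>c) * \<bar>u\<bar> + (q\<^sub>c + r) * \<bar>u + 1\<bar> + (q\<^sub>c - r) * \<bar>u - 1\<bar> \<le> \<bar>u\<bar> + 2 * q\<^sub>c"
      by (simp add: algebra_simps)
    then show ?thesis using q_le ql by simp
  qed
qed (use assms in auto)

end

section \<open>The random long range edges\<close>

lemma exp_minus_double_le: "0 \<le> x \<Longrightarrow> x \<le> 1 / 2 \<Longrightarrow> exp (- (2 * x)) \<le> 1 - (x :: real)"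
proof -
  assume x: "0 \<le> x" "x \<le> 1 / 2"
  have "- (2 * x) \<le> - x - 2 * x^2"
    using mult_left_mono[OF x(2) x(1)] by (simp add: power2_eq_square)
  also have "\<dots> \<le> ln (1 - x)" by (rule ln_one_minus_pos_lower_bound[OF x])
  finally have "exp (- (2 * x)) \<le> exp (ln (1 - x))" by (simp only: exp_le_cancel_iff)
  then show ?thesis using x by simp
qed

lemma finite_node_pairs: "finite (node_pairs n)"
  by (rule finite_subset[of _ "Pow {..<n}"]) (auto simp: node_pairs_def)

lemma card_node_pairs: "card (node_pairs n) = n choose 2"
  unfolding node_pairs_def using n_subsets[of "{..<n}" 2] by simp

lemma real_choose_two: "real (n choose 2) = real n * (real n - 1) / 2"
  by (simp add: binomial_gbinomial gbinomial_prod_rev numeral_2_eq_2 lessThan_Suc)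

definition touching :: "nat \<Rightarrow> nat set \<Rightarrow> nat set set" where
  "touching n W = {e \<in> node_pairs n. e \<inter> W \<noteq> {}}"

lemma touching_subset: "touching n W \<subseteq> node_pairs n"
  by (auto simp: touching_def)

lemma card_not_touching:
  assumes "W \<subseteq> {..<n}"
  shows "card (node_pairs n) - card (touching n W) = (n - card W) choose 2"
proof -
  have "node_pairs n - touching n W = {e. e \<subseteq> {..<n} - W \<and> card e = 2}"
    by (auto simp: node_pairs_def touching_def)
  then have "card (node_pairs n - touching n W) = card ({..<n} - W) choose 2"
    by (simp add: n_subsets)
  also have "card ({..<n} - W) = n - card W"
    using assms by (simp add: card_Diff_subset finite_subset)
  finally show ?thesis
    using card_Diff_subset[OF finite_subset[OF touching_subset finite_node_pairs] touching_subset] by simp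
qed

lemma card_touching_le:
  assumes "W \<subseteq> {..<n}"
  shows "card (touching n W) \<le> card W * n"
proof -
  have finW: "finite W" using assms by (rule finite_subset) simp
  have "touching n W \<subseteq> (\<lambda>(x, y). {x, y}) ` (W \<times> {..<n})"
  proof
    fix e assume e: "e \<in> touching n W"
    then obtain x y where "e = {x, y}" by (auto simp: touching_def node_pairs_def card_2_iff)
    then show "e \<in> (\<lambda>(x, y). {x, y}) ` (W \<times> {..<n})"
      using e by (force simp: touching_def node_pairs_def insert_commute)
  qed
  then have "card (touching n W) \<le> card ((\<lambda>(x, y). {x, y}) ` (W \<times> {..<n}))"
    using finW by (intro card_mono) auto
  also have "\<dots> \<le> card (W \<times> {..<n})" using finW by (intro card_image_le) auto
  finally show ?thesis by (simp add: card_cartesian_product)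
qed

section \<open>Probability estimates for a uniform set of pairs\<close>

locale random_pairs =
  fixes n m :: nat
  assumes m_choose: "m \<le> n choose 2"
begin

sublocale uniform_subset "node_pairs n" m
  by standard (auto simp: finite_node_pairs card_node_pairs m_choose)

lemma \<Omega>_finite: "E \<in> \<Omega> \<Longrightarrow> finite E"
  using finite_node_pairs by (auto simp: \<Omega>_def intro: finite_subset)

lemma isolated_iff:
  assumes "E \<in> \<Omega>"
  shows "(\<forall>x\<in>W. long_range_degree E x = 0) \<longleftrightarrow> E \<inter> touching n W = {}"
  using assms \<Omega>_finite[OF assms] by (auto simp: long_range_degree_def touching_def \<Omega>_def)

lemma pr_mono:
  assumes "\<And>E. E \<in> \<Omega> \<Longrightarrow> E \<in> A \<Longrightarrow> E \<in> B"
  shows "pr A \<le> pr B"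
  using assms by (intro prob_mono_support) (auto simp: set_pmf)

text \<open>The edges that meet \<open>W\<close> must cover its \<open>2 * j\<close> nodes, and each
  edge covers at most two, so at least \<open>j\<close> of them are present.\<close>

lemma pr_no_isolated_le:
  assumes W: "W \<subseteq> {..<n}" "card W = 2 * j"
  shows "pr {E. \<forall>x\<in>W. long_range_degree E x \<noteq> 0} \<le> (real (2 * j * n) * real m / real (n choose 2)) ^ j"
proof -
  have finW: "finite W" using W(1) by (rule finite_subset) simp
  have "pr {E. \<forall>x\<in>W. long_range_degree E x \<noteq> 0} \<le> pr {E. j \<le> card (E \<inter> touching n W)}"
  proof (rule pr_mono)
    fix E assume E: "E \<in> \<Omega>" "E \<in> {E. \<forall>x\<in>W. long_range_degree E x \<noteq> 0}"
    have fin: "finite (E \<inter> touching n W)" using \<Omega>_finite[OF E(1)] by simp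
    have two: "card e = 2" if "e \<in> E \<inter> touching n W" for e
      using that by (auto simp: touching_def node_pairs_def)
    have "W \<subseteq> \<Union>(E \<inter> touching n W)"
    proof
      fix x assume x: "x \<in> W"
      then have "card {e\<in>E. x \<in> e} \<noteq> 0" using E(2) by (auto simp only: long_range_degree_def)
      then have "{e\<in>E. x \<in> e} \<noteq> {}" by (metis card.empty)
      then show "x \<in> \<Union>(E \<inter> touching n W)" using E(1) x by (auto simp: touching_def \<Omega>_def)
    qed
    then have "card W \<le> card (\<Union>(E \<inter> touching n W))"
      using fin two by (intro card_mono finite_Union) (auto intro: card_ge_0_finite)
    also have "\<dots> \<le> (\<Sum>e\<in>E \<inter> touching n W. card e)"
      by (rule card_Union_le_sum_card)
    also have "\<dots> = 2 * card (E \<inter> touching n W)" using two by simp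
    finally show "E \<in> {E. j \<le> card (E \<inter> touching n W)}" using W(2) by simp
  qed
  also have "\<dots> \<le> (real (card (touching n W)) * real m / real (card (node_pairs n))) ^ j"
    by (rule pr_inter_card_ge[OF touching_subset])
  also have "\<dots> \<le> (real (2 * j * n) * real m / real (n choose 2)) ^ j"
  proof (intro power_mono divide_right_mono mult_right_mono)
    show "real (card (touching n W)) * real m / real (card (node_pairs n)) \<le> real (2 * j * n) * real m / real (n choose 2)"
      using card_touching_le[OF W(1)] W(2) unfolding card_node_pairs
      by (intro divide_right_mono mult_right_mono) (auto simp only: of_nat_le_iff of_nat_0_le_iff)
  qed simp
  finally show ?thesis .
qed

lemma pr_isolated_in_windows:
  "pr {E. \<not> (\<forall>a. a + 2 * j \<le> n \<longrightarrow> (\<exists>x\<in>{a..<a + 2 * j}. long_range_degree E x = 0))}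
     \<le> real (n + 1) * (real (2 * j * n) * real m / real (n choose 2)) ^ j"
proof -
  have fin: "finite {a. a + 2 * j \<le> n}" by (rule finite_subset[of _ "{..n}"]) auto
  have "pr {E. \<not> (\<forall>a. a + 2 * j \<le> n \<longrightarrow> (\<exists>x\<in>{a..<a + 2 * j}. long_range_degree E x = 0))}
      \<le> pr (\<Union>a\<in>{a. a + 2 * j \<le> n}. {E. \<forall>x\<in>{a..<a + 2 * j}. long_range_degree E x \<noteq> 0})"
    by (rule pr_mono) auto
  also have "\<dots> \<le> (\<Sum>a\<in>{a. a + 2 * j \<le> n}. pr {E. \<forall>x\<in>{a..<a + 2 * j}. long_range_degree E x \<noteq> 0})"
    using fin by (intro measure_UNION_le) auto
  also have "\<dots> \<le> (\<Sum>a\<in>{a. a + 2 * j \<le> n}. (real (2 * j * n) * real m / real (n choose 2)) ^ j)"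
    by (intro sum_mono pr_no_isolated_le) auto
  also have "\<dots> \<le> (\<Sum>a\<in>{..n}. (real (2 * j * n) * real m / real (n choose 2)) ^ j)"
    by (intro sum_mono2) auto
  finally show ?thesis by simp
qed

text \<open>All pairs between the blocks of \<open>S\<close> and those outside \<open>R\<close> must
  be avoided. Their number grows in proportion to \<open>card R\<close>, so the bound is a power
  that a union bound over \<open>R\<close> can sum.\<close>

lemma pr_no_edge_between:
  fixes blk :: "nat \<Rightarrow> nat"
  assumes size: "\<And>b. b < k \<Longrightarrow> l \<le> card {x\<in>{..<n}. blk x = b}"
    and SR: "S \<subseteq> R" "R \<subseteq> {..<k}" "card R \<le> 3 * card S" "4 * card R \<le> 3 * k"
  shows "pr {E. \<not> (\<exists>x<n. \<exists>y<n. blk x \<in> S \<and> blk y \<notin> R \<and> {x, y} \<in> E)}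
     \<le> exp (- (real l ^ 2 * real k * real m / (12 * real (n choose 2)))) ^ card R"
proof -
  have many: "l * card T \<le> card {x\<in>{..<n}. blk x \<in> T}" if "T \<subseteq> {..<k}" for T
  proof -
    have fin: "finite T" using that by (rule finite_subset) simp
    have "l * card T = (\<Sum>b\<in>T. l)" by simp
    also have "\<dots> \<le> (\<Sum>b\<in>T. card {x\<in>{..<n}. blk x = b})" using that size by (intro sum_mono) auto
    also have "\<dots> = card (\<Union>b\<in>T. {x\<in>{..<n}. blk x = b})"
      using fin by (intro card_UN_disjoint[symmetric]) auto
    also have "(\<Union>b\<in>T. {x\<in>{..<n}. blk x = b}) = {x\<in>{..<n}. blk x \<in> T}" by auto
    finally show ?thesis .
  qed
  define U where "U = {x\<in>{..<n}. blk x \<in> S}"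
  define V where "V = {y\<in>{..<n}. blk y \<notin> R}"
  define F where "F = (\<lambda>(x, y). {x, y}) ` (U \<times> V)"
  have UV: "U \<inter> V = {}" using SR(1) by (auto simp: U_def V_def)
  have F_sub: "F \<subseteq> node_pairs n"
    using UV by (auto simp: F_def node_pairs_def U_def V_def card_insert_if)
  have card_F: "card F = card U * card V"
  proof -
    have "inj_on (\<lambda>(x, y). {x, y}) (U \<times> V)"
      using UV by (auto simp: inj_on_def doubleton_eq_iff)
    then show ?thesis by (simp add: F_def card_image card_cartesian_product)
  qed
  have U: "l * card S \<le> card U" unfolding U_def using SR by (intro many) auto
  have "l * card ({..<k} - R) \<le> card {y\<in>{..<n}. blk y \<in> {..<k} - R}" by (rule many) auto
  also have "\<dots> \<le> card V" unfolding V_def by (intro card_mono) auto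
  also have "card ({..<k} - R) = k - card R"
    using SR(2) by (simp add: card_Diff_subset finite_subset)
  finally have V: "l * (k - card R) \<le> card V" .
  have "l * card S * (l * (k - card R)) \<le> card F" unfolding card_F using U V by (rule mult_le_mono)
  \<comment> \<open>The constant 12 is \<open>3 * 4\<close>: \<open>S\<close> has at least a third
    of \<open>R\<close>, and at least a quarter of all blocks lie outside \<open>R\<close>.\<close>
  moreover have "card R * k \<le> 3 * card S * (4 * (k - card R))"
    by (rule mult_le_mono) (use SR in auto)
  then have "l ^ 2 * (card R * k) \<le> l ^ 2 * (3 * card S * (4 * (k - card R)))" by (rule mult_left_mono) simp
  ultimately have "l ^ 2 * (card R * k) \<le> 12 * card F" by (simp add: power2_eq_square algebra_simps)
  then have "real (l ^ 2 * (card R * k)) \<le> real (12 * card F)" by (simp only: of_nat_le_iff)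
  then have cF: "real l ^ 2 * real k * real (card R) / 12 \<le> real (card F)" by (simp add: algebra_simps)
  have "pr {E. \<not> (\<exists>x<n. \<exists>y<n. blk x \<in> S \<and> blk y \<notin> R \<and> {x, y} \<in> E)} \<le> pr {E. E \<inter> F = {}}"
    by (rule pr_mono) (auto simp: F_def U_def V_def)
  also have "\<dots> \<le> exp (- (real (card F) * real m / real (n choose 2)))"
    using pr_avoid_le[OF F_sub] by (simp add: card_node_pairs)
  also have "\<dots> \<le> exp (- (real l ^ 2 * real k * real (card R) / 12 * real m / real (n choose 2)))"
    unfolding exp_le_cancel_iff neg_le_iff_le by (intro divide_right_mono mult_right_mono cF) auto
  also have "\<dots> = exp (real (card R) * (- (real l ^ 2 * real k * real m / (12 * real (n choose 2)))))"
    by (simp add: field_simps)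
  also have "\<dots> = exp (- (real l ^ 2 * real k * real m / (12 * real (n choose 2)))) ^ card R"
    by (rule exp_of_nat_mult)
  finally show ?thesis .
qed

text \<open>There are at most \<open>2 ^ card R\<close> choices of \<open>S\<close> for a given
  \<open>R\<close>. Summing over all \<open>R\<close> is then a binomial expansion, and the
  subtracted 1 is the term of the empty \<open>R\<close>.\<close>

lemma pr_blocks_connected:
  fixes blk :: "nat \<Rightarrow> nat"
  assumes size: "\<And>b. b < k \<Longrightarrow> l \<le> card {x\<in>{..<n}. blk x = b}"
    and c: "c \<le> real l ^ 2 * real k * real m / (12 * real (n choose 2))"
  shows "pr {E. \<not> (\<forall>S R. S \<subseteq> R \<longrightarrow> R \<subseteq> {..<k} \<longrightarrow> S \<noteq> {} \<longrightarrow> card R \<le> 3 * card S \<longrightarrow> 4 * card R \<le> 3 * k \<longrightarrow>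
        (\<exists>x<n. \<exists>y<n. blk x \<in> S \<and> blk y \<notin> R \<and> {x, y} \<in> E))} \<le> exp (2 * real k * exp (- c)) - 1"
    (is "pr ?bad \<le> _")
proof -
  define \<S> where "\<S> R = {S. S \<subseteq> R \<and> card R \<le> 3 * card S \<and> 4 * card R \<le> 3 * k}" for R :: "nat set"
  define none where "none S R = {E. \<not> (\<exists>x<n. \<exists>y<n. blk x \<in> S \<and> blk y \<notin> R \<and> {x, y} \<in> E)}" for S R
  have \<S>: "finite (\<S> R)" "card (\<S> R) \<le> 2 ^ card R" if "R \<in> Pow {..<k}" for R
  proof -
    have fin: "finite R" using that by (auto intro: finite_subset)
    have sub: "\<S> R \<subseteq> Pow R" by (auto simp: \<S>_def)
    then show "finite (\<S> R)" using fin by (auto intro: finite_subset)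
    show "card (\<S> R) \<le> 2 ^ card R" using sub fin card_mono[of "Pow R"] by (simp add: card_Pow)
  qed
  have "pr ?bad \<le> pr (\<Union>R\<in>Pow {..<k} - {{}}. \<Union>S\<in>\<S> R. none S R)"
  proof (rule pr_mono)
    fix E assume "E \<in> ?bad"
    then obtain S R where SR: "S \<subseteq> R" "R \<subseteq> {..<k}" "S \<noteq> {}" "card R \<le> 3 * card S" "4 * card R \<le> 3 * k"
      "\<not> (\<exists>x<n. \<exists>y<n. blk x \<in> S \<and> blk y \<notin> R \<and> {x, y} \<in> E)" by blast
    then have "R \<in> Pow {..<k} - {{}}" "S \<in> \<S> R" "E \<in> none S R" by (auto simp: \<S>_def none_def)
    then show "E \<in> (\<Union>R\<in>Pow {..<k} - {{}}. \<Union>S\<in>\<S> R. none S R)" by blast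
  qed
  also have "\<dots> \<le> (\<Sum>R\<in>Pow {..<k} - {{}}. pr (\<Union>S\<in>\<S> R. none S R))"
    by (intro measure_UNION_le) auto
  also have "\<dots> \<le> (\<Sum>R\<in>Pow {..<k} - {{}}. (2 * exp (- c)) ^ card R)"
  proof (intro sum_mono)
    fix R assume R: "R \<in> Pow {..<k} - {{}}"
    have "pr (\<Union>S\<in>\<S> R. none S R) \<le> (\<Sum>S\<in>\<S> R. pr (none S R))"
      using \<S>(1) R by (intro measure_UNION_le) auto
    also have "\<dots> \<le> (\<Sum>S\<in>\<S> R. exp (- c) ^ card R)"
    proof (rule sum_mono)
      fix S assume S: "S \<in> \<S> R"
      have "pr (none S R) \<le> exp (- (real l ^ 2 * real k * real m / (12 * real (n choose 2)))) ^ card R"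
        unfolding none_def by (rule pr_no_edge_between[OF size]) (use S R in \<open>auto simp: \<S>_def\<close>)
      also have "\<dots> \<le> exp (- c) ^ card R" using c by (intro power_mono) auto
      finally show "pr (none S R) \<le> exp (- c) ^ card R" .
    qed
    also have "\<dots> = real (card (\<S> R)) * exp (- c) ^ card R" by simp
    also have "\<dots> \<le> 2 ^ card R * exp (- c) ^ card R"
    proof (intro mult_right_mono)
      have "real (card (\<S> R)) \<le> real (2 ^ card R)" using \<S>(2)[of R] R unfolding of_nat_le_iff by auto
      then show "real (card (\<S> R)) \<le> 2 ^ card R" by simp
    qed simp
    finally show "pr (\<Union>S\<in>\<S> R. none S R) \<le> (2 * exp (- c)) ^ card R" by (simp add: power_mult_distrib)
  qed
  also have "\<dots> = (\<Sum>R\<in>Pow {..<k}. (2 * exp (- c)) ^ card R) - 1"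
    by (subst sum_diff) auto
  also have "(\<Sum>R\<in>Pow {..<k}. (2 * exp (- c)) ^ card R) = (1 + 2 * exp (- c)) ^ k"
    using prod_add[of "{..<k}" "\<lambda>_. 2 * exp (- c)" "\<lambda>_. 1 :: real"] by (simp add: add.commute)
  also have "\<dots> \<le> exp (2 * exp (- c)) ^ k"
    using exp_ge_add_one_self[of "2 * exp (- c)"] by (intro power_mono) (auto simp: add_nonneg_nonneg)
  also have "\<dots> = exp (2 * real k * exp (- c))"
    by (simp add: exp_of_nat_mult[symmetric] mult_ac)
  finally show ?thesis by simp
qed

text \<open>Second moment method for \<open>K\<close> disjoint windows of length \<open>g\<close>:
  \<open>p\<close> is the probability that one window has no long range edge, and \<open>p2\<close>
  that two have none. Both are products over the draws and are compared factor by factor.\<close>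

lemma pr_no_gap:
  fixes g K :: nat
  assumes g: "0 < g" "16 * g \<le> n" and K: "0 < K" "K * g \<le> n" and n8: "8 \<le> n" and m8: "8 * real m \<le> real n ^ 2"
  shows "pr {E. \<not> (\<exists>i<K. \<forall>x\<in>{i * g..<(i + 1) * g}. long_range_degree E x = 0)}
    \<le> exp (16 * real m * real g / real n) / real K + exp (8 * real m * real g ^ 2 / real n ^ 2) - 1"
proof -
  define W where "W i = {i * g..<(i + 1) * g}" for i
  define A where "A i = {E. E \<inter> touching n (W i) = {}}" for i
  have W: "W i \<subseteq> {..<n}" "card (W i) = g" if "i < K" for i
  proof -
    have "(i + 1) * g \<le> K * g" using that by (intro mult_le_mono1) simp
    then show "W i \<subseteq> {..<n}" "card (W i) = g" using K(2) by (auto simp: W_def)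
  qed
  have W_disj: "W i \<inter> W j = {}" if "i \<noteq> j" for i j
  proof -
    have "(a + 1) * g \<le> b * g" if "a < b" for a b using that by (intro mult_le_mono1) simp
    from this[of i j] this[of j i] that show ?thesis by (auto simp: W_def neq_iff)
  qed
  define N N1 N2 where "N = real (n choose 2)" and "N1 = real ((n - g) choose 2)" and "N2 = real ((n - 2 * g) choose 2)"
  define p where "p = (\<Prod>i<m. (N1 - real i) / (N - real i))"
  define p2 where "p2 = (\<Prod>i<m. (N2 - real i) / (N - real i))"
  \<comment> \<open>A uniform lower bound for all numerators and denominators of these
    factors.\<close>
  define D where "D = real n ^ 2 / 8"
  have gn: "real g \<le> real n / 16" "0 < real g" using g by linarith+
  have Ns: "N = real n * (real n - 1) / 2" "N1 = (real n - g) * (real n - g - 1) / 2"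
      "N2 = (real n - 2 * g) * (real n - 2 * g - 1) / 2"
    using g by (simp_all add: N_def N1_def N2_def real_choose_two of_nat_diff)
  have D0: "0 < D" using n8 by (simp add: D_def)
  have N2_ge: "D \<le> N2 - m"
  proof -
    have "7 / 8 * real n * (3 / 4 * real n) \<le> (real n - 2 * g) * (real n - 2 * g - 1)"
      using gn n8 by (intro mult_mono) auto
    then show ?thesis using m8 unfolding Ns D_def by (simp add: power2_eq_square)
  qed
  have N_N1: "N - N1 \<le> real g * real n" "0 \<le> N1 - N2" "N1 - N2 \<le> N - N1"
      "N + N2 - 2 * N1 = real g ^ 2"
  proof -
    have "N - N1 = real g * (2 * real n - g - 1) / 2" unfolding Ns by (simp add: field_simps)
    also have "\<dots> \<le> real g * (2 * real n) / 2" using gn by (intro divide_right_mono mult_left_mono) auto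
    finally show "N - N1 \<le> real g * real n" by simp
    have "N1 - N2 = real g * (2 * real n - 3 * g - 1) / 2" unfolding Ns by (simp add: field_simps)
    also have "\<dots> \<ge> 0" using gn n8 by (intro divide_nonneg_nonneg mult_nonneg_nonneg) auto
    finally show "0 \<le> N1 - N2" .
    \<comment> \<open>These are the pairs with one end in each of two disjoint windows. Being
      counted once instead of twice, they are what makes \<open>p2\<close> differ from
      \<open>p^2\<close> by more than the effect of drawing without replacement.\<close>
    show e: "N + N2 - 2 * N1 = real g ^ 2" unfolding Ns by (simp add: field_simps power2_eq_square)
    have "0 \<le> real g ^ 2" by simp
    with e show "N1 - N2 \<le> N - N1" by linarith
  qed
  have fac: "D \<le> N - real i" "D \<le> N1 - real i" "D \<le> N2 - real i" if "i < m" for i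
    using N2_ge N_N1 that by auto
  have p_pos: "0 < p" and p2_pos: "0 \<le> p2"
    unfolding p_def p2_def using fac D0 by (fastforce intro!: prod_pos divide_pos_pos prod_nonneg divide_nonneg_nonneg)+
  have single: "pr (A i) = p" if "i < K" for i
    unfolding A_def pr_avoid[OF touching_subset] card_not_touching[OF W(1)[OF that]] W(2)[OF that]
    unfolding card_node_pairs binomial_ratio p_def N_def N1_def by simp
  have pair: "pr (A i \<inter> A j) \<le> p2" if ij: "i < K" "j < K" "i \<noteq> j" for i j
  proof -
    have "A i \<inter> A j = {E. E \<inter> touching n (W i \<union> W j) = {}}" by (auto simp: A_def touching_def)
    moreover have sub: "W i \<union> W j \<subseteq> {..<n}" using W ij by auto
    moreover have card: "card (W i \<union> W j) = 2 * g"
      using W W_disj ij by (subst card_Un_disjoint) (auto simp: W_def)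
    have "pr {E. E \<inter> touching n (W i \<union> W j) = {}} = p2"
      unfolding pr_avoid[OF touching_subset] card_not_touching[OF sub] card
      unfolding card_node_pairs binomial_ratio p2_def N_def N2_def by simp
    ultimately show ?thesis by simp
  qed
  have p_ge: "exp (- (16 * real m * real g / real n)) \<le> p"
  proof -
    have "exp (- (16 * real m * real g / real n)) = (\<Prod>i<m. exp (- (2 * (8 * real g / real n))))"
      by (simp add: exp_of_nat_mult[symmetric] mult_ac)
    also have "\<dots> \<le> p" unfolding p_def
    proof (intro prod_mono conjI)
      fix i assume "i \<in> {..<m}"
      then have i: "D \<le> N - real i" "0 < N - real i" using fac[of i] D0 by auto
      have "exp (- (2 * (8 * real g / real n))) \<le> 1 - 8 * real g / real n"
        using gn n8 by (intro exp_minus_double_le) (auto simp: field_simps)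
      also have "\<dots> \<le> 1 - (N - N1) / (N - real i)"
      proof -
        have "(N - N1) / (N - real i) \<le> real g * real n / D"
          using i N_N1 D0 gn by (intro frac_le) auto
        also have "\<dots> = 8 * real g / real n" using n8 by (simp add: D_def power2_eq_square)
        finally show ?thesis by simp
      qed
      also have "\<dots> = (N1 - real i) / (N - real i)" using i by (simp add: field_simps)
      finally show "exp (- (2 * (8 * real g / real n))) \<le> (N1 - real i) / (N - real i)" .
    qed simp
    finally show ?thesis .
  qed
  have p2_le: "p2 / p^2 \<le> exp (8 * real m * real g ^ 2 / real n ^ 2)"
  proof -
    have "p2 / p^2 = (\<Prod>i<m. (N2 - real i) / (N - real i) / ((N1 - real i) / (N - real i))^2)"
      unfolding p_def p2_def prod_power_distrib by (simp only: prod_dividef)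
    also have "\<dots> \<le> (\<Prod>i<m. exp (real g ^ 2 / D))"
    proof (intro prod_mono conjI)
      fix i assume "i \<in> {..<m}"
      then have i: "D \<le> N - real i" "D \<le> N1 - real i" "D \<le> N2 - real i" using fac by auto
      define a b c where "a = N - real i" and "b = N1 - real i" and "c = N2 - real i"
      have abc: "0 < a" "0 < b" "0 < c" "D \<le> b" using i D0 by (auto simp: a_def b_def c_def)
      show "0 \<le> (N2 - real i) / (N - real i) / ((N1 - real i) / (N - real i))^2"
        unfolding a_def[symmetric] b_def[symmetric] c_def[symmetric] using abc by simp
      have s: "a + c - 2 * b = real g ^ 2" "0 \<le> (a - b) * (b - c)"
        using N_N1 by (auto simp: a_def b_def c_def intro!: mult_nonneg_nonneg)
      \<comment> \<open>A rearrangement of \<open>0 \<le> (a - b) * (b - c)\<close>.\<close>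
      have "c * a \<le> b^2 + b * (a + c - 2 * b)"
        using s(2) by (simp add: algebra_simps power2_eq_square)
      then have "c * a / b^2 \<le> (b^2 + b * real g ^ 2) / b^2" unfolding s(1) by (rule divide_right_mono) simp
      also have "\<dots> = 1 + real g ^ 2 / b" using abc by (simp add: field_simps power2_eq_square)
      also have "\<dots> \<le> 1 + real g ^ 2 / D" using abc D0 by (intro add_left_mono divide_left_mono) auto
      also have "\<dots> \<le> exp (real g ^ 2 / D)" by (rule exp_ge_add_one_self)
      also have "c * a / b^2 = c / a / (b / a)^2" using abc by (simp add: power_divide field_simps power2_eq_square)
      finally show "(N2 - real i) / (N - real i) / ((N1 - real i) / (N - real i))^2 \<le> exp (real g ^ 2 / D)"
        by (simp add: a_def b_def c_def)
    qed
    also have "\<dots> = exp (8 * real m * real g ^ 2 / real n ^ 2)"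
      by (simp add: exp_of_nat_mult[symmetric] D_def mult_ac)
    finally show ?thesis .
  qed
  have "pr {E. \<not> (\<exists>i<K. \<forall>x\<in>W i. long_range_degree E x = 0)} \<le> pr {E. \<forall>i<K. E \<notin> A i}"
    by (rule pr_mono) (simp add: isolated_iff[symmetric] A_def)
  also have "\<dots> \<le> 1 / (real K * p) + (p2 / p^2 - 1)"
    by (rule second_moment) (use K p_pos p2_pos single pair finite_\<Omega> set_pmf in auto)
  also have "1 / (real K * p) \<le> 1 / (real K * exp (- (16 * real m * real g / real n)))"
    using p_ge K by (intro divide_left_mono mult_left_mono mult_pos_pos) (auto simp: p_pos)
  also have "\<dots> = exp (16 * real m * real g / real n) / real K"
    by (simp add: exp_minus field_simps)
  finally show ?thesis using p2_le by (simp add: W_def)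
qed

end

section \<open>Cutting the cycle into intervals\<close>

text \<open>The minimum merges the incomplete interval at the end into the last full block, so that
  sizes lie between \<open>l\<close> and \<open>2 * l\<close>.\<close>

definition block :: "nat \<Rightarrow> nat \<Rightarrow> nat \<Rightarrow> nat" where
  "block n l x = min (x div l) (n div l - 1)"

locale division =
  fixes n l :: nat
  assumes l: "0 < l" "l \<le> n"
begin

abbreviation k :: nat where "k \<equiv> n div l"

lemma k_pos: "0 < k"
  using l by (simp add: div_greater_zero_iff)

lemma block_less: "block n l x < k"
  using k_pos by (simp add: block_def min_less_iff_disj)

lemma block_mono: "x \<le> y \<Longrightarrow> block n l x \<le> block n l y"
  unfolding block_def by (intro min.mono div_le_mono) auto

lemma n_less: "n < (k + 1) * l"
  using l dividend_less_div_times[of l n] by simp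

lemma k_times_le: "k * l \<le> n"
  by simp

lemma Suc_block_le: "b < k \<Longrightarrow> (b + 1) * l \<le> n"
  using mult_le_mono1[of "b + 1" k l] k_times_le by linarith

lemma block_eq:
  assumes "b < k" "b * l \<le> x" "x < (b + 1) * l"
  shows "block n l x = b"
proof -
  have "x div l = b" using assms by (intro div_nat_eqI) (auto simp: mult.commute)
  then show ?thesis using assms(1) by (simp add: block_def)
qed

lemma block_size_ge:
  assumes "b < k"
  shows "l \<le> card {x\<in>{..<n}. block n l x = b}"
proof -
  have "{b * l..<(b + 1) * l} \<subseteq> {x\<in>{..<n}. block n l x = b}"
    using assms Suc_block_le[OF assms] block_eq by auto
  then have "card {b * l..<(b + 1) * l} \<le> card {x\<in>{..<n}. block n l x = b}"
    by (intro card_mono) auto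
  then show ?thesis by simp
qed

lemma block_size_le:
  assumes "b < k"
  shows "card {x\<in>{..<n}. block n l x = b} \<le> 2 * l"
proof -
  have "{x\<in>{..<n}. block n l x = b} \<subseteq> {b * l..<(b + 2) * l}"
  proof
    fix x assume x: "x \<in> {x\<in>{..<n}. block n l x = b}"
    then have "x < (k + 1) * l" using n_less by simp
    then have "x div l < k + 1" by (simp add: less_mult_imp_div_less)
    then have q: "b \<le> x div l" "x div l \<le> b + 1" using x by (auto simp: block_def min_def split: if_splits)
    have "b * l \<le> x div l * l" using q(1) by (rule mult_le_mono1)
    also have "\<dots> \<le> x" by simp
    finally have 1: "b * l \<le> x" .
    have "x < (x div l + 1) * l" using l dividend_less_div_times[of l x] by simp
    also have "\<dots> \<le> (b + 2) * l" using q(2) by (intro mult_le_mono1) simp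
    finally show "x \<in> {b * l..<(b + 2) * l}" using 1 by simp
  qed
  then have "card {x\<in>{..<n}. block n l x = b} \<le> card {b * l..<(b + 2) * l}"
    by (intro card_mono) auto
  then show ?thesis by simp
qed

lemma isolated_in_block:
  assumes win: "\<And>a. a + 2 * j \<le> n \<Longrightarrow> \<exists>x\<in>{a..<a + 2 * j}. long_range_degree E x = 0"
    and j: "2 * j < l" and b: "b < k"
  shows "\<exists>w. Suc w < n \<and> block n l w = b \<and> block n l (Suc w) = b \<and> long_range_degree E w = 0"
proof -
  \<comment> \<open>The strict inequality leaves room for the successor of the isolated node in the
    same block.\<close>
  have "b * l + 2 * j < (b + 1) * l" using j by simp
  then obtain x where x: "b * l \<le> x" "x < b * l + 2 * j" "long_range_degree E x = 0"
    using win[of "b * l"] Suc_block_le[OF b] by auto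
  have "Suc x < (b + 1) * l" using x j by simp
  then show ?thesis
    using x Suc_block_le[OF b] block_eq[OF b, of x] block_eq[OF b, of "Suc x"]
    by (intro exI[of _ x]) auto
qed

end

text \<open>In \<open>block_expansion\<close>, \<open>S\<close> consists of the full blocks without
  flow and \<open>R\<close> of all full or split blocks.\<close>

definition connected_blocks :: "nat \<Rightarrow> nat \<Rightarrow> nat set set \<Rightarrow> bool" where
  "connected_blocks n l E \<longleftrightarrow> (\<forall>S R. S \<subseteq> R \<longrightarrow> R \<subseteq> {..<n div l} \<longrightarrow> S \<noteq> {} \<longrightarrow> card R \<le> 3 * card S \<longrightarrow>
     4 * card R \<le> 3 * (n div l) \<longrightarrow>
     (\<exists>x<n. \<exists>y<n. block n l x \<in> S \<and> block n l y \<notin> R \<and> {x, y} \<in> E))"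

section \<open>Typical graphs\<close>

locale exponent =
  fixes \<alpha> :: real
  assumes \<alpha>: "1 < \<alpha>" "\<alpha> < 2"
begin

definition m :: "nat \<Rightarrow> nat" where
  "m n = nat \<lceil>real n powr (2 - \<alpha>)\<rceil>"

text \<open>The scale \<open>L\<close> of the longest intervals without long range edges.\<close>

definition L :: "nat \<Rightarrow> real" where
  "L n = real n powr (\<alpha> - 1) * ln (real n)"

text \<open>The factor 48 yields the exponent \<open>4 * ln n\<close> in
  \<open>aas_connected_blocks\<close>.\<close>

definition l :: "nat \<Rightarrow> nat" where
  "l n = nat \<lceil>48 * L n\<rceil>"

text \<open>Chosen so that \<open>96 * gap_const = (2 - \<alpha>) / 2\<close>: a window of length
  \<open>2 * w n + 1\<close> is then free of long range edges with probability at least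
  \<open>n powr (- (2 - \<alpha>) / 2)\<close>, while the number of windows is of order
  \<open>n powr (2 - \<alpha>) / ln n\<close>.\<close>

definition gap_const :: real where
  "gap_const = (2 - \<alpha>) / 192"

definition w :: "nat \<Rightarrow> nat" where
  "w n = nat \<lfloor>gap_const * L n\<rfloor>"

lemma L_at_top: "filterlim L at_top sequentially"
  unfolding L_def using \<alpha> by real_asymp

lemma L_over_n: "(\<lambda>n. L n / real n) \<longlonglongrightarrow> 0"
  unfolding L_def using \<alpha> by real_asymp

lemma eventually_L_ge: "\<forall>\<^sub>F n in sequentially. C \<le> L n"
  using L_at_top by (simp add: filterlim_at_top)

lemma eventually_L_le:
  assumes "0 < C"
  shows "\<forall>\<^sub>F n in sequentially. L n \<le> C * real n"
proof -
  have "\<forall>\<^sub>F n in sequentially. L n / real n < C"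
    using L_over_n assms by (rule order_tendstoD)
  then show ?thesis
    using eventually_gt_at_top[of 0]
    by eventually_elim (simp add: divide_less_eq)
qed

lemma L_sq: "0 < n \<Longrightarrow> L n ^ 2 = real n powr (2 * \<alpha> - 2) * ln (real n) ^ 2"
proof -
  have "real n powr (2 * \<alpha> - 2) = real n powr (\<alpha> - 1) * real n powr (\<alpha> - 1)"
    by (simp add: powr_add[symmetric])
  then show ?thesis by (simp add: L_def power2_eq_square)
qed

text \<open>Collects all numerical requirements on \<open>n\<close>; none refers to the random
  graph.\<close>

definition large :: "nat \<Rightarrow> bool" where
  "large n \<longleftrightarrow> 8 \<le> n \<and> real n powr (2 - \<alpha>) \<le> real (m n) \<and> real (m n) \<le> 2 * real n powr (2 - \<alpha>) \<and>
     m n \<le> n choose 2 \<and> 8 * real (m n) \<le> real n ^ 2 \<and>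
     48 * L n \<le> real (l n) \<and> real (l n) \<le> 49 * L n \<and> 0 < l n \<and> l n \<le> n \<and>
     gap_const * L n / 2 \<le> real (w n) \<and> real (w n) \<le> gap_const * L n \<and> 0 < w n \<and> 1 \<le> L n \<and>
     2 * real (w n) + 1 \<le> 3 * gap_const * L n \<and> 48 * gap_const * L n \<le> real n"

lemma gap_const: "0 < gap_const"
  using \<alpha> by (simp add: gap_const_def)

lemma eventually_large: "\<forall>\<^sub>F n in sequentially. large n"
proof -
  have 1: "\<forall>\<^sub>F n in sequentially. 1 \<le> real n powr (2 - \<alpha>)"
    using \<alpha> by real_asymp
  have 2: "\<forall>\<^sub>F n in sequentially. 16 * real n powr (2 - \<alpha>) \<le> real n ^ 2"
    using \<alpha> by real_asymp
  have e49: "\<forall>\<^sub>F n in sequentially. L n \<le> 1 / 49 * real n" by (rule eventually_L_le) simp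
  have g: "0 < 1 / (48 * gap_const)" using gap_const by simp
  show ?thesis
    using 1 2 eventually_ge_at_top[of 8] eventually_L_ge[of 1] eventually_L_ge[of "2 / gap_const"]
      e49 eventually_L_le[OF g]
  proof eventually_elim
    case (elim n)
    have m1: "real n powr (2 - \<alpha>) \<le> real (m n)" unfolding m_def by linarith
    have m2: "real (m n) \<le> 2 * real n powr (2 - \<alpha>)" unfolding m_def using elim(1) by linarith
    have m3: "8 * real (m n) \<le> real n ^ 2" using m2 elim(2) by linarith
    have "real n * 8 \<le> real n * real n" using elim(3) by (intro mult_left_mono) auto
    then have "real (m n) \<le> real (n choose 2)"
      using m3 by (simp add: real_choose_two power2_eq_square algebra_simps)
    then have m4: "m n \<le> n choose 2" by simp
    have gL: "2 \<le> gap_const * L n" using elim(5) gap_const by (simp add: divide_le_eq mult.commute)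
    have l1: "48 * L n \<le> real (l n)" unfolding l_def by linarith
    have l2: "real (l n) \<le> 49 * L n" unfolding l_def using elim(4) by linarith
    have l3: "0 < l n" using l1 elim(4) by linarith
    have l4: "l n \<le> n" using l2 elim(6) by linarith
    have w1: "real (w n) \<le> gap_const * L n" unfolding w_def using gL by linarith
    have w2: "gap_const * L n - 1 \<le> real (w n)" unfolding w_def using gL by linarith
    have w3: "48 * gap_const * L n \<le> real n" using elim(7) gap_const by (simp add: field_simps)
    show ?case unfolding large_def using elim(3,4) m1 m2 m3 m4 l1 l2 l3 l4 w1 w2 w3 gL by auto
  qed
qed

lemma M2_eq:
  assumes "large n"
  shows "M2 \<alpha> n = pmf_of_set (uniform_subset.\<Omega> (node_pairs n) (m n))"
proof -
  interpret random_pairs n "m n" by standard (use assms in \<open>simp add: large_def\<close>)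
  show ?thesis by (simp only: M2_def \<Omega>_def m_def[symmetric])
qed

lemma set_pmf_M2:
  assumes "large n"
  shows "set_pmf (M2 \<alpha> n) = {E. E \<subseteq> node_pairs n \<and> card E = m n}"
proof -
  interpret random_pairs n "m n" by standard (use assms in \<open>simp add: large_def\<close>)
  show ?thesis unfolding M2_eq[OF assms] set_pmf by (rule \<Omega>_def)
qed

lemma pairs_bounds:
  assumes "large n"
  shows "real n ^ 2 / 4 \<le> real (n choose 2)" "real (n choose 2) \<le> real n ^ 2 / 2" "0 < real (n choose 2)"
proof -
  have "8 \<le> real n" using assms by (simp add: large_def)
  then have "real n * 2 \<le> real n * real n" by (intro mult_left_mono) auto
  then show 1: "real n ^ 2 / 4 \<le> real (n choose 2)"
    by (simp add: real_choose_two power2_eq_square algebra_simps)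
  show "real (n choose 2) \<le> real n ^ 2 / 2" by (simp add: real_choose_two power2_eq_square algebra_simps)
  have "0 < real n ^ 2 / 4" using \<open>8 \<le> real n\<close> by simp
  then show "0 < real (n choose 2)" using 1 by linarith
qed

text \<open>The third identity fixes the scale: \<open>L n\<close> nodes meet of order
  \<open>ln n\<close> long range edges on average. The fourth makes the correlation of two windows
  negligible.\<close>

lemma powr_cancel:
  assumes "0 < n"
  shows "real n powr (\<alpha> - 1) * real n powr (2 - \<alpha>) = real n"
    and "real n powr (2 - \<alpha>) / real n = real n powr (1 - \<alpha>)"
    and "L n * real n powr (2 - \<alpha>) = real n * ln (real n)"
    and "L n * (real n * ln (real n)) / real n ^ 2 = real n powr (\<alpha> - 2) * ln (real n) ^ 2"
proof -
  show 1: "real n powr (\<alpha> - 1) * real n powr (2 - \<alpha>) = real n"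
    using assms by (simp add: powr_add[symmetric])
  show "real n powr (2 - \<alpha>) / real n = real n powr (1 - \<alpha>)"
    using assms powr_diff[of "real n" "2 - \<alpha>" 1] by simp
  show "L n * real n powr (2 - \<alpha>) = real n * ln (real n)"
    unfolding L_def using 1 by (metis mult.assoc mult.commute)
  have "real n powr (\<alpha> - 2) = real n powr (\<alpha> - 1) / real n"
    using assms powr_diff[of "real n" "\<alpha> - 1" 1] by simp
  then show "L n * (real n * ln (real n)) / real n ^ 2 = real n powr (\<alpha> - 2) * ln (real n) ^ 2"
    using assms by (simp add: L_def power2_eq_square)
qed

lemma aas_connected_blocks:
  "asymptotically_almost_surely (M2 \<alpha>) (\<lambda>n E. connected_blocks n (l n) E)"
proof (rule aasI)
  \<comment> \<open>The inner exponential is \<open>n^(-4)\<close>, which outweighs the at most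
    \<open>n\<close> blocks.\<close>
  show "(\<lambda>n. exp (2 * real n * exp (- (4 * ln (real n)))) - 1) \<longlonglongrightarrow> 0" by real_asymp
  show "\<forall>\<^sub>F n in sequentially. measure_pmf.prob (M2 \<alpha> n) {E. \<not> connected_blocks n (l n) E}
      \<le> exp (2 * real n * exp (- (4 * ln (real n)))) - 1"
    using eventually_large
  proof eventually_elim
    case (elim n)
    note lg = elim[unfolded large_def]
    interpret random_pairs n "m n" by standard (use lg in simp)
    interpret division n "l n" by standard (use lg in auto)
    have n0: "0 < n" using lg by simp
    have ln0: "0 \<le> ln (real n)" using n0 by simp
    have kl: "real n / 2 \<le> real k * real (l n)"
    proof -
      have "n < (k + 1) * l n" by (rule n_less)
      also have "\<dots> \<le> (2 * k) * l n" using k_pos by (intro mult_le_mono1) simp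
      finally have "real n < real (2 * k * l n)" by (simp only: of_nat_less_iff)
      then show ?thesis by simp
    qed
    have "4 * ln (real n) = 48 * L n * (real n / 2) * real n powr (2 - \<alpha>) / (12 * (real n ^ 2 / 2))"
      using n0 powr_cancel(3)[OF n0] by (simp add: power2_eq_square field_simps)
    also have "\<dots> \<le> real (l n) * (real k * real (l n)) * real (m n) / (12 * real (n choose 2))"
      using lg kl pairs_bounds[OF elim] by (intro frac_le mult_mono) auto
    also have "\<dots> = real (l n) ^ 2 * real k * real (m n) / (12 * real (n choose 2))"
      by (simp add: power2_eq_square mult_ac)
    finally have c: "4 * ln (real n) \<le> real (l n) ^ 2 * real k * real (m n) / (12 * real (n choose 2))" .
    have "pr {E. \<not> connected_blocks n (l n) E} \<le> exp (2 * real k * exp (- (4 * ln (real n)))) - 1"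
      unfolding connected_blocks_def by (rule pr_blocks_connected[OF block_size_ge c])
    also have "\<dots> \<le> exp (2 * real n * exp (- (4 * ln (real n)))) - 1"
      by (intro diff_right_mono) (simp add: mult_right_mono)
    finally show ?case by (simp add: M2_eq[OF elim])
  qed
qed

text \<open>The mean degree is of order \<open>n powr (1 - \<alpha>)\<close>, so \<open>j\<close>
  edges at one window of bounded length cost \<open>n powr ((1 - \<alpha>) * j)\<close> up to a
  constant.\<close>

lemma aas_isolated_in_windows:
  "\<exists>j. asymptotically_almost_surely (M2 \<alpha>)
     (\<lambda>n E. \<forall>a. a + 2 * j \<le> n \<longrightarrow> (\<exists>x\<in>{a..<a + 2 * j}. long_range_degree E x = 0))"
proof -
  \<comment> \<open>Makes that cost at most \<open>n powr (- 2)\<close>, enough against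
    \<open>n + 1\<close> windows.\<close>
  define j where "j = nat \<lceil>2 / (\<alpha> - 1)\<rceil>"
  have "2 / (\<alpha> - 1) \<le> real j" unfolding j_def by linarith
  then have j: "2 \<le> (\<alpha> - 1) * real j" using \<alpha> by (simp add: field_simps)
  have "asymptotically_almost_surely (M2 \<alpha>)
     (\<lambda>n E. \<forall>a. a + 2 * j \<le> n \<longrightarrow> (\<exists>x\<in>{a..<a + 2 * j}. long_range_degree E x = 0))"
  proof (rule aasI)
    show "(\<lambda>n. (16 * real j) ^ j * (real (n + 1) * real n powr (- 2))) \<longlonglongrightarrow> 0"
      by (rule tendsto_mult_right_zero) real_asymp
    show "\<forall>\<^sub>F n in sequentially. measure_pmf.prob (M2 \<alpha> n)
        {E. \<not> (\<forall>a. a + 2 * j \<le> n \<longrightarrow> (\<exists>x\<in>{a..<a + 2 * j}. long_range_degree E x = 0))}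
        \<le> (16 * real j) ^ j * (real (n + 1) * real n powr (- 2))"
      using eventually_large
    proof eventually_elim
      case (elim n)
      note lg = elim[unfolded large_def]
      interpret random_pairs n "m n" by standard (use lg in simp)
      have n0: "0 < n" "1 \<le> real n" using lg by auto
      have "real (2 * j * n) * real (m n) / real (n choose 2)
          \<le> real (2 * j * n) * (2 * real n powr (2 - \<alpha>)) / (real n ^ 2 / 4)"
        using lg pairs_bounds[OF elim] n0 by (intro frac_le mult_left_mono) auto
      also have "\<dots> = 16 * real j * (real n powr (2 - \<alpha>) / real n)"
        using n0 by (simp add: power2_eq_square)
      also have "\<dots> = 16 * real j * real n powr (1 - \<alpha>)" by (simp only: powr_cancel(2)[OF n0(1)])
      finally have "(real (2 * j * n) * real (m n) / real (n choose 2)) ^ j \<le> (16 * real j * real n powr (1 - \<alpha>)) ^ j"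
        by (intro power_mono) auto
      also have "\<dots> = (16 * real j) ^ j * real n powr ((1 - \<alpha>) * real j)"
        using n0 by (simp add: power_mult_distrib powr_realpow[symmetric] powr_powr)
      also have "\<dots> \<le> (16 * real j) ^ j * real n powr (- 2)"
        using n0 j by (intro mult_left_mono powr_mono) (auto simp: algebra_simps)
      finally have "real (n + 1) * (real (2 * j * n) * real (m n) / real (n choose 2)) ^ j
          \<le> real (n + 1) * ((16 * real j) ^ j * real n powr (- 2))" by (rule mult_left_mono) simp
      with pr_isolated_in_windows[of j] show ?case by (simp add: M2_eq[OF elim] algebra_simps)
    qed
  qed
  then show ?thesis by blast
qed

lemma aas_gap:
  "asymptotically_almost_surely (M2 \<alpha>) (\<lambda>n E. \<exists>x0. w n \<le> x0 \<and> x0 + w n < n \<and>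
     (\<forall>x. x0 - w n \<le> x \<and> x \<le> x0 + w n \<longrightarrow> long_range_degree E x = 0))"
proof (rule aasI)
  let ?c = "144 * gap_const ^ 2"
  have c: "96 * gap_const = (2 - \<alpha>) / 2" by (simp add: gap_const_def)
  show "(\<lambda>n. 6 * gap_const * (real n powr ((\<alpha> - 2) / 2) * ln (real n)) + (exp (?c * (real n powr (\<alpha> - 2) * ln (real n) ^ 2)) - 1)) \<longlonglongrightarrow> 0"
  proof (intro tendsto_add_zero tendsto_mult_right_zero)
    show "(\<lambda>n. real n powr ((\<alpha> - 2) / 2) * ln (real n)) \<longlonglongrightarrow> 0" using \<alpha> by real_asymp
    have "(\<lambda>n. real n powr (\<alpha> - 2) * ln (real n) ^ 2) \<longlonglongrightarrow> 0" using \<alpha> by real_asymp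
    then have "(\<lambda>n. exp (?c * (real n powr (\<alpha> - 2) * ln (real n) ^ 2)) - 1) \<longlonglongrightarrow> exp (?c * 0) - 1"
      by (intro tendsto_intros)
    then show "(\<lambda>n. exp (?c * (real n powr (\<alpha> - 2) * ln (real n) ^ 2)) - 1) \<longlonglongrightarrow> 0" by simp
  qed
  show "\<forall>\<^sub>F n in sequentially. measure_pmf.prob (M2 \<alpha> n)
      {E. \<not> (\<exists>x0. w n \<le> x0 \<and> x0 + w n < n \<and> (\<forall>x. x0 - w n \<le> x \<and> x \<le> x0 + w n \<longrightarrow> long_range_degree E x = 0))}
      \<le> 6 * gap_const * (real n powr ((\<alpha> - 2) / 2) * ln (real n)) + (exp (?c * (real n powr (\<alpha> - 2) * ln (real n) ^ 2)) - 1)"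
    using eventually_large
  proof eventually_elim
    case (elim n)
    note lg = elim[unfolded large_def]
    interpret random_pairs n "m n" by standard (use lg in simp)
    \<comment> \<open>An odd length, so that the window has a midpoint with \<open>w n\<close> nodes
      on each side.\<close>
    define g where "g = 2 * w n + 1"
    define K where "K = n div g"
    have n0: "0 < n" "1 \<le> real n" using lg by auto
    have g3: "real g \<le> 3 * gap_const * L n" "0 < g" using lg by (auto simp: g_def)
    then have g16: "16 * g \<le> n" using lg by linarith
    then interpret division n g by unfold_locales (use g3 in auto)
    have K: "0 < K" "K * g \<le> n" using k_pos by (auto simp: K_def)
    have "n < (K + 1) * g" unfolding K_def by (rule n_less)
    also have "\<dots> \<le> (2 * K) * g" using K by (intro mult_le_mono1) simp
    finally have "real n < real (2 * K * g)" by (simp only: of_nat_less_iff)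
    then have nK: "real n / (2 * real g) \<le> real K" using g3 by (simp add: field_simps)
    have n_pos: "0 < real n / (2 * real g)" using n0 g3 by simp
    have mg: "real (m n) * real g / real n \<le> 6 * gap_const * ln (real n)"
    proof -
      have "real (m n) * real g / real n \<le> (2 * real n powr (2 - \<alpha>)) * (3 * gap_const * L n) / real n"
        using lg g3 by (intro divide_right_mono mult_mono) auto
      also have "\<dots> = 6 * gap_const * ((L n * real n powr (2 - \<alpha>)) / real n)" by simp
      also have "\<dots> = 6 * gap_const * ln (real n)" using n0 unfolding powr_cancel(3)[OF n0(1)] by simp
      finally show ?thesis .
    qed
    have "exp (16 * real (m n) * real g / real n) \<le> exp (96 * gap_const * ln (real n))"
      using mg by simp
    also have "\<dots> = real n powr ((2 - \<alpha>) / 2)" unfolding c using n0 by (simp add: powr_def)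
    finally have e1: "exp (16 * real (m n) * real g / real n) \<le> real n powr ((2 - \<alpha>) / 2)" .
    have "exp (16 * real (m n) * real g / real n) / real K \<le> real n powr ((2 - \<alpha>) / 2) / (real n / (2 * real g))"
      using e1 nK n_pos by (intro frac_le) auto
    also have "\<dots> = 2 * real n powr ((2 - \<alpha>) / 2) / real n * real g" by simp
    also have "\<dots> \<le> 2 * real n powr ((2 - \<alpha>) / 2) / real n * (3 * gap_const * L n)"
      using g3 by (intro mult_left_mono) auto
    also have "\<dots> = 6 * gap_const * (real n powr ((\<alpha> - 2) / 2) * ln (real n))"
    proof -
      have "real n powr a / real n * real n powr b = real n powr (a + b - 1)" for a b
        using n0 powr_diff[of "real n" "a + b" 1] powr_add[of "real n" a b] by simp
      then have "real n powr ((2 - \<alpha>) / 2) / real n * real n powr (\<alpha> - 1) = real n powr ((2 - \<alpha>) / 2 + (\<alpha> - 1) - 1)" .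
      also have "(2 - \<alpha>) / 2 + (\<alpha> - 1) - 1 = (\<alpha> - 2) / 2" by (simp add: field_simps)
      finally have e: "real n powr ((2 - \<alpha>) / 2) / real n * real n powr (\<alpha> - 1) = real n powr ((\<alpha> - 2) / 2)" .
      show ?thesis unfolding e[symmetric] L_def by simp
    qed
    finally have first: "exp (16 * real (m n) * real g / real n) / real K \<le> 6 * gap_const * (real n powr ((\<alpha> - 2) / 2) * ln (real n))" .
    have "8 * real (m n) * real g ^ 2 / real n ^ 2 = 8 * (real (m n) * real g / real n) * (real g / real n)"
      unfolding power2_eq_square by simp
    also have "\<dots> \<le> 8 * (6 * gap_const * ln (real n)) * (3 * gap_const * L n / real n)"
      using mg g3 n0 gap_const by (intro mult_mono divide_right_mono) auto
    also have "\<dots> = ?c * (L n * (real n * ln (real n)) / real n ^ 2)"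
    proof -
      have "L n * (real n * ln (real n)) / real n ^ 2 = L n / real n * ln (real n)"
        using n0 by (simp add: power2_eq_square)
      then show ?thesis by (simp add: power2_eq_square)
    qed
    also have "\<dots> = ?c * (real n powr (\<alpha> - 2) * ln (real n) ^ 2)" by (simp only: powr_cancel(4)[OF n0(1)])
    finally have second: "exp (8 * real (m n) * real g ^ 2 / real n ^ 2) \<le> exp (?c * (real n powr (\<alpha> - 2) * ln (real n) ^ 2))"
      by simp
    have "pr {E. \<not> (\<exists>x0. w n \<le> x0 \<and> x0 + w n < n \<and> (\<forall>x. x0 - w n \<le> x \<and> x \<le> x0 + w n \<longrightarrow> long_range_degree E x = 0))}
        \<le> pr {E. \<not> (\<exists>i<K. \<forall>x\<in>{i * g..<(i + 1) * g}. long_range_degree E x = 0)}"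
    proof (rule pr_mono, clarify)
      fix E i assume i: "i < K" "\<forall>x\<in>{i * g..<(i + 1) * g}. long_range_degree E x = 0"
        and no: "\<not> (\<exists>x0. w n \<le> x0 \<and> x0 + w n < n \<and> (\<forall>x. x0 - w n \<le> x \<and> x \<le> x0 + w n \<longrightarrow> long_range_degree E x = 0))"
      have "(i + 1) * g \<le> n" using Suc_block_le[of i] i(1) by (simp add: K_def)
      then have "w n \<le> i * g + w n \<and> i * g + w n + w n < n \<and>
          (\<forall>x. i * g + w n - w n \<le> x \<and> x \<le> i * g + w n + w n \<longrightarrow> long_range_degree E x = 0)"
        using i(2) by (auto simp: g_def)
      then show False using no by blast
    qed
    also have "\<dots> \<le> exp (16 * real (m n) * real g / real n) / real K + exp (8 * real (m n) * real g ^ 2 / real n ^ 2) - 1"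
      by (rule pr_no_gap) (use g3 g16 K lg in auto)
    finally show ?case unfolding M2_eq[OF elim] using first second by linarith
  qed
qed

end

section \<open>Mixing time\<close>

text \<open>The last assumption makes the main term at least 1 in units of the claimed bound, so
  that rounding up to an integer is harmless.\<close>

lemma mixing_time_upper:
  fixes n l :: nat and L \<epsilon> :: real
  assumes "doubly_stochastic {..<n} P" and "doubly_stochastic.expands {..<n} P (\<kappa> / (10 * real l))"
    and \<kappa>: "0 < \<kappa>" and \<epsilon>: "0 < \<epsilon>" and n: "0 < n" "- 2 * ln \<epsilon> \<le> ln (real n)"
    and l: "0 < l" "real l \<le> 49 * L" and L: "\<kappa>^2 \<le> L^2 * ln (real n)"
  shows "ereal_of_enat (mixing_time {..<n} P \<epsilon>) < ereal (10^6 / \<kappa>^2 * (L^2 * ln (real n)))"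
proof -
  interpret doubly_stochastic "{..<n}" P by fact
  define h where "h = \<kappa> / (10 * real l)"
  \<comment> \<open>Solves \<open>n * exp (- s) = \<epsilon>^2\<close>, the requirement of
    \<open>mixing_time_le\<close>.\<close>
  define s where "s = ln (real n) - 2 * ln \<epsilon>"
  define K where "K = nat \<lceil>2 / h^2 * s\<rceil>"
  have h: "0 < h" using \<kappa> l by (simp add: h_def)
  have "0 \<le> ln (real n)" using n by simp
  then have s: "s \<le> 2 * ln (real n)" using n by (simp add: s_def)
  have "2 / h^2 * s \<le> real K" unfolding K_def by linarith
  then have "s \<le> real K * h^2 / 2" using h by (simp add: field_simps)
  then have "exp (- (real K * h^2 / 2)) \<le> exp (- s)" by simp
  also have "\<dots> = \<epsilon>^2 / real n"
    using n \<epsilon> by (simp add: s_def exp_diff exp_double)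
  finally have "real n * exp (- (real K * h^2 / 2)) \<le> \<epsilon>^2" using n by (simp add: field_simps)
  then have "mixing_time {..<n} P \<epsilon> \<le> enat K"
    using assms(2) \<epsilon> by (intro mixing_time_le[of h]) (auto simp: h_def)
  then have "ereal_of_enat (mixing_time {..<n} P \<epsilon>) \<le> ereal_of_enat (enat K)"
    by (simp only: ereal_of_enat_le_iff)
  also have "\<dots> < ereal (10^6 / \<kappa>^2 * (L^2 * ln (real n)))"
  proof -
    have "2 / h^2 * s = 200 * real l ^ 2 / \<kappa>^2 * s" by (simp add: h_def power_divide power_mult_distrib)
    also have "\<dots> \<le> 200 * (49 * L) ^ 2 / \<kappa>^2 * (2 * ln (real n))"
    proof (rule order.trans)
      show "200 * real l ^ 2 / \<kappa>^2 * s \<le> 200 * real l ^ 2 / \<kappa>^2 * (2 * ln (real n))"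
        using s by (intro mult_left_mono) auto
      show "200 * real l ^ 2 / \<kappa>^2 * (2 * ln (real n)) \<le> 200 * (49 * L) ^ 2 / \<kappa>^2 * (2 * ln (real n))"
        using l \<open>0 \<le> ln (real n)\<close> by (intro mult_right_mono divide_right_mono mult_left_mono power_mono) auto
    qed
    also have "\<dots> = 960400 * (L^2 * ln (real n) / \<kappa>^2)" by (simp add: power_mult_distrib)
    finally have 1: "2 / h^2 * s \<le> 960400 * (L^2 * ln (real n) / \<kappa>^2)" .
    have 2: "1 \<le> L^2 * ln (real n) / \<kappa>^2" using L \<kappa> by simp
    \<comment> \<open>Here 960400 is \<open>200 * 49^2 * 2\<close>; rounding adds less than 1, which
      the margin up to \<open>10^6\<close> covers.\<close>
    have "real K < 1000000 * (L^2 * ln (real n) / \<kappa>^2)"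
    proof -
      define x y where "x = 2 / h^2 * s" and "y = L^2 * ln (real n) / \<kappa>^2"
      have "x \<le> 960400 * y" "1 \<le> y" using 1 2 by (simp_all only: x_def y_def)
      then have "real (nat \<lceil>x\<rceil>) < 1000000 * y" by linarith
      then show ?thesis by (simp only: K_def x_def y_def)
    qed
    then show ?thesis by simp
  qed
  finally show ?thesis .
qed

context exponent
begin

text \<open>The bound \<open>d\<close> is real and known only asymptotically almost surely, but some
  graph of the model obeys it and has an edge.\<close>

lemma degree_bound_ge_1:
  assumes "asymptotically_almost_surely (M2 \<alpha>) (\<lambda>n E. \<forall>i<n. real (long_range_degree E i) \<le> d)"
  shows "1 \<le> d"
proof -
  have "\<forall>\<^sub>F n in sequentially. 1 \<le> d"
    using aas_eventually_witness[OF assms] eventually_large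
  proof eventually_elim
    case (elim n)
    then obtain E where E: "E \<subseteq> node_pairs n" "card E = m n" "\<forall>i<n. real (long_range_degree E i) \<le> d"
      by (auto simp: set_pmf_M2)
    have "0 < n" using elim(2) by (simp add: large_def)
    then have "0 < real n powr (2 - \<alpha>)" by simp
    moreover have "real n powr (2 - \<alpha>) \<le> real (m n)" using elim(2) by (simp add: large_def)
    ultimately have "0 < m n" by linarith
    then have fin: "finite E" "E \<noteq> {}" using E(2) by (auto intro: card_ge_0_finite)
    then obtain e where e: "e \<in> E" by blast
    then have "e \<subseteq> {..<n}" "card e = 2" using E(1) by (auto simp: node_pairs_def)
    then obtain i where i: "i \<in> e" "i < n" by (fastforce simp: card_2_iff)
    have "0 < long_range_degree E i"
      using e i fin by (auto simp: long_range_degree_def card_gt_0_iff)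
    moreover have "real (long_range_degree E i) \<le> d" using E(3) i by simp
    ultimately show "1 \<le> d" by linarith
  qed
  then show ?thesis by simp
qed

lemma blocked_cycle_chainI:
  assumes "large n" and "E \<in> set_pmf (M2 \<alpha> n)" and "1 \<le> d"
    and "0 < q\<^sub>c" "0 < q\<^sub>l" "\<bar>r\<bar> \<le> q\<^sub>c" "2 * q\<^sub>c + q\<^sub>l \<le> 1"
    and "\<forall>i<n. real (long_range_degree E i) \<le> d" and "connected_blocks n (l n) E"
  shows "blocked_cycle_chain n E q\<^sub>c q\<^sub>l r d (n div l n) (l n) (block n (l n))"
proof -
  note lg = assms(1)[unfolded large_def]
  interpret division n "l n" by standard (use lg in auto)
  show ?thesis
  proof
    show "E \<subseteq> node_pairs n" using assms(1,2) by (simp add: set_pmf_M2)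
    show "2 \<le> l n" using lg by linarith
    show "n < (k + 1) * l n" by (rule n_less)
    show "\<exists>x<n. \<exists>y<n. block n (l n) x \<in> S \<and> block n (l n) y \<notin> R \<and> {x, y} \<in> E"
      if "S \<subseteq> R" "R \<subseteq> {..<k}" "S \<noteq> {}" "card R \<le> 3 * card S" "4 * card R \<le> 3 * k" for S R
      using assms(9) that unfolding connected_blocks_def by blast
  qed (use lg assms block_less block_mono block_size_ge block_size_le in auto)
qed

lemma eventually_mixing_conditions:
  assumes "0 < \<epsilon>" "\<epsilon> < 1" "0 < \<kappa>"
  shows "\<forall>\<^sub>F n in sequentially. large n \<and> - 2 * ln \<epsilon> \<le> ln (real n) \<and> \<kappa>^2 \<le> L n ^ 2 * ln (real n) \<and>
    8 * real (w n) \<le> (1 - \<epsilon>) * real n \<and> 2 * real j < 48 * L n"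
proof -
  have "filterlim (\<lambda>n. ln (real n)) at_top sequentially" by real_asymp
  then have 1: "\<forall>\<^sub>F n in sequentially. max 1 (- 2 * ln \<epsilon>) \<le> ln (real n)"
    unfolding filterlim_at_top by blast
  have pos: "0 < (1 - \<epsilon>) / (8 * gap_const)" using assms gap_const by simp
  show ?thesis
    using eventually_large 1 eventually_L_ge[of \<kappa>] eventually_L_le[OF pos] eventually_L_ge[of "real j"] eventually_L_ge[of 1]
  proof eventually_elim
    case (elim n)
    have "\<kappa>^2 * 1 \<le> L n ^ 2 * ln (real n)"
      using elim(2,3) assms by (intro mult_mono power_mono) auto
    moreover have "8 * real (w n) \<le> (1 - \<epsilon>) * real n"
    proof -
      have "8 * real (w n) \<le> 8 * (gap_const * L n)" using elim(1) by (simp add: large_def)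
      also have "\<dots> \<le> (1 - \<epsilon>) * real n" using elim(4) gap_const by (simp add: field_simps)
      finally show ?thesis .
    qed
    ultimately show ?case using elim by simp
  qed
qed

end

theorem theorem23:
  fixes \<alpha> \<epsilon> q\<^sub>c q\<^sub>l r :: real and d :: "real \<Rightarrow> real"
  assumes "1 < \<alpha>" and "\<alpha> < 2" and "0 < \<epsilon>" and "\<epsilon> < 1"
    and "q\<^sub>c > 0" and "q\<^sub>l > 0" and "\<bar>r\<bar> \<le> q\<^sub>c" and "2 * q\<^sub>c + q\<^sub>l \<le> 1"
    and "asymptotically_almost_surely (M2 \<alpha>)
           (\<lambda>n E. \<forall>i<n. real (long_range_degree E i) \<le> d \<alpha>)"
  defines "P \<equiv> \<lambda>n E. homogeneous_chain n E q\<^sub>c q\<^sub>l r (d \<alpha>)"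
  defines "t_mix \<equiv> \<lambda>n E. ereal_of_enat (mixing_time {..<n} (P n E) \<epsilon>)"
  shows
    "(r = 0 \<longrightarrow>
        (\<exists>c\<^sub>1>0. \<exists>c\<^sub>2>0. asymptotically_almost_surely (M2 \<alpha>) (\<lambda>n E.
           ereal (c\<^sub>1 * real n powr (2 * \<alpha> - 2) * ln (real n) ^ 2) < t_mix n E \<and>
           t_mix n E < ereal (c\<^sub>2 * (d \<alpha>)\<^sup>2 * real n powr (2 * \<alpha> - 2) * ln (real n) ^ 3)))) \<and>
     (r \<noteq> 0 \<and> asymptotically_almost_surely (M2 \<alpha>) (\<lambda>n E. lazy {..<n} (P n E)) \<longrightarrow>
        (\<exists>c\<^sub>1>0. \<exists>c\<^sub>2>0. asymptotically_almost_surely (M2 \<alpha>) (\<lambda>n E.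
           ereal (c\<^sub>1 * real n powr (\<alpha> - 1) * ln (real n)) < t_mix n E \<and>
           t_mix n E < ereal (c\<^sub>2 * (d \<alpha>)\<^sup>2 * real n powr (2 * \<alpha> - 2) * ln (real n) ^ 3))))"
proof -
  interpret exponent \<alpha> by standard fact+
  have d1: "1 \<le> d \<alpha>" by (rule degree_bound_ge_1) fact
  \<comment> \<open>The same value as in the chain's locale, but fixed before \<open>n\<close> and
    \<open>E\<close>, so that constants may depend on it.\<close>
  define \<kappa> where "\<kappa> = q\<^sub>c * min q\<^sub>c (q\<^sub>l / d \<alpha>)"
  have \<kappa>: "0 < \<kappa>" using assms d1 by (simp add: \<kappa>_def)
  define gap where "gap n E \<longleftrightarrow> (\<exists>x0. w n \<le> x0 \<and> x0 + w n < n \<and>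
     (\<forall>x. x0 - w n \<le> x \<and> x \<le> x0 + w n \<longrightarrow> long_range_degree E x = 0))" for n E
  define typical where "typical n E \<longleftrightarrow> (\<forall>i<n. real (long_range_degree E i) \<le> d \<alpha>) \<and>
     connected_blocks n (l n) E \<and> gap n E" for n E
  have aas_typical: "asymptotically_almost_surely (M2 \<alpha>) typical"
    using aas_conj[OF assms(9) aas_conj[OF aas_connected_blocks aas_gap]]
    unfolding typical_def gap_def .
  define c\<^sub>2 where "c\<^sub>2 = 10^6 / \<kappa>^2"
  have c2: "0 < c\<^sub>2" using \<kappa> by (simp add: c\<^sub>2_def)
  have upper: "t_mix n E < ereal (c\<^sub>2 * (d \<alpha>)\<^sup>2 * real n powr (2 * \<alpha> - 2) * ln (real n) ^ 3)"
    if lg: "large n" and n: "- 2 * ln \<epsilon> \<le> ln (real n)" "\<kappa>^2 \<le> L n ^ 2 * ln (real n)"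
      and ds: "doubly_stochastic {..<n} (P n E)"
      and ex: "doubly_stochastic.expands {..<n} (P n E) (\<kappa> / (10 * real (l n)))" for n E
  proof -
    have n0: "0 < n" and l: "0 < l n" "real (l n) \<le> 49 * L n" using lg by (auto simp: large_def)
    have "t_mix n E < ereal (10^6 / \<kappa>^2 * (L n ^ 2 * ln (real n)))"
      unfolding t_mix_def using mixing_time_upper[OF ds ex \<kappa> assms(3) n0 n(1) l n(2)] .
    \<comment> \<open>The factor 1 marks the place of \<open>(d \<alpha>)\<^sup>2\<close>, which is
      at least 1; the constant \<open>c\<^sub>2\<close> itself depends on \<open>d \<alpha>\<close>
      through \<kappa>.\<close>
    also have "10^6 / \<kappa>^2 * (L n ^ 2 * ln (real n)) = c\<^sub>2 * 1 * real n powr (2 * \<alpha> - 2) * ln (real n) ^ 3"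
      unfolding L_sq[OF n0] c\<^sub>2_def by (simp add: power2_eq_square power3_eq_cube)
    also have "ereal \<dots> \<le> ereal (c\<^sub>2 * (d \<alpha>)\<^sup>2 * real n powr (2 * \<alpha> - 2) * ln (real n) ^ 3)"
      unfolding ereal_less_eq using d1 c2 n0 by (intro mult_right_mono mult_left_mono) auto
    finally show ?thesis .
  qed
  have g0: "0 < gap_const" by (rule gap_const)
  show ?thesis
  proof (intro conjI impI)
    assume r0: "r = 0"
    \<comment> \<open>From \<open>(1 - \<epsilon>) / 4 * w^2\<close> with \<open>w\<close> at least
      \<open>gap_const * L / 2\<close>.\<close>
    define c\<^sub>1 where "c\<^sub>1 = (1 - \<epsilon>) * gap_const ^ 2 / 16"
    have c1: "0 < c\<^sub>1" using assms g0 by (simp add: c\<^sub>1_def)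
    \<comment> \<open>Isolated nodes in every block take the place of laziness, which is not assumed
      for \<open>r = 0\<close>.\<close>
    obtain j where j: "asymptotically_almost_surely (M2 \<alpha>)
     (\<lambda>n E. \<forall>a. a + 2 * j \<le> n \<longrightarrow> (\<exists>x\<in>{a..<a + 2 * j}. long_range_degree E x = 0))"
      using aas_isolated_in_windows by blast
    have "asymptotically_almost_surely (M2 \<alpha>) (\<lambda>n E.
           ereal (c\<^sub>1 * real n powr (2 * \<alpha> - 2) * ln (real n) ^ 2) < t_mix n E \<and>
           t_mix n E < ereal (c\<^sub>2 * (d \<alpha>)\<^sup>2 * real n powr (2 * \<alpha> - 2) * ln (real n) ^ 3))"
    proof (rule aas_mono[OF aas_conj[OF aas_typical j]])
      show "\<forall>\<^sub>F n in sequentially. \<forall>E\<in>set_pmf (M2 \<alpha> n).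
        typical n E \<and> (\<forall>a. a + 2 * j \<le> n \<longrightarrow> (\<exists>x\<in>{a..<a + 2 * j}. long_range_degree E x = 0)) \<longrightarrow>
           ereal (c\<^sub>1 * real n powr (2 * \<alpha> - 2) * ln (real n) ^ 2) < t_mix n E \<and>
           t_mix n E < ereal (c\<^sub>2 * (d \<alpha>)\<^sup>2 * real n powr (2 * \<alpha> - 2) * ln (real n) ^ 3)"
        using eventually_mixing_conditions[OF assms(3,4) \<kappa>, of j]
      proof (eventually_elim, intro ballI impI, elim conjE)
        fix n E
        assume lg: "large n" and n: "- 2 * ln \<epsilon> \<le> ln (real n)" "\<kappa>^2 \<le> L n ^ 2 * ln (real n)"
            "8 * real (w n) \<le> (1 - \<epsilon>) * real n" "2 * real j < 48 * L n"
          and E: "E \<in> set_pmf (M2 \<alpha> n)" "typical n E"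
            "\<forall>a. a + 2 * j \<le> n \<longrightarrow> (\<exists>x\<in>{a..<a + 2 * j}. long_range_degree E x = 0)"
        note lg' = lg[unfolded large_def]
        have w0: "0 < w n" using lg' by simp
        interpret C: blocked_cycle_chain n E q\<^sub>c q\<^sub>l r "d \<alpha>" "n div l n" "l n" "block n (l n)"
          using blocked_cycle_chainI[OF lg E(1) d1 assms(5-8)] E(2) by (auto simp: typical_def)
        interpret division n "l n" by standard (use lg' in auto)
        have P: "P n E = C.P" by (simp add: P_def C.P_def)
        have \<kappa>_eq: "\<kappa> = C.\<kappa>" by (simp add: \<kappa>_def C.\<kappa>_def)
        have jl: "2 * j < l n" using n(4) lg' by linarith
        have ex: "C.expands (\<kappa> / (10 * real (l n)))"
          unfolding \<kappa>_eq using r0 isolated_in_block[of j E] jl E(3) by (intro C.expands_of_isolated) auto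
        obtain x0 where x0: "w n \<le> x0" "x0 + w n < n"
            "\<And>x. x0 - w n \<le> x \<Longrightarrow> x \<le> x0 + w n \<Longrightarrow> long_range_degree E x = 0"
          using E(2) by (auto simp: typical_def gap_def)
        have "(gap_const * L n / 2) ^ 2 \<le> real (w n) ^ 2"
          using lg' g0 by (intro power_mono) auto
        then have "(1 - \<epsilon>) / 4 * (gap_const * L n / 2) ^ 2 \<le> (1 - \<epsilon>) / 4 * real (w n) ^ 2"
          using assms by (intro mult_left_mono) auto
        also have "(1 - \<epsilon>) / 4 * (gap_const * L n / 2) ^ 2 = c\<^sub>1 * L n ^ 2"
          by (simp add: c\<^sub>1_def power_divide power_mult_distrib)
        finally have t: "c\<^sub>1 * L n ^ 2 \<le> (1 - \<epsilon>) / 4 * real (w n) ^ 2" .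
        have "ereal (c\<^sub>1 * L n ^ 2) < t_mix n E"
          unfolding t_mix_def P by (rule C.mixing_time_gt_reversible[OF ex r0 w0 x0 n(3) assms(4) t])
        moreover have "0 < n" using lg' by simp
        ultimately have "ereal (c\<^sub>1 * real n powr (2 * \<alpha> - 2) * ln (real n) ^ 2) < t_mix n E"
          by (simp add: L_sq mult.assoc)
        moreover have "t_mix n E < ereal (c\<^sub>2 * (d \<alpha>)\<^sup>2 * real n powr (2 * \<alpha> - 2) * ln (real n) ^ 3)"
          by (rule upper[OF lg n(1,2)]) (unfold P, rule C.doubly_stochastic_axioms, rule ex)
        ultimately show "ereal (c\<^sub>1 * real n powr (2 * \<alpha> - 2) * ln (real n) ^ 2) < t_mix n E \<and>
           t_mix n E < ereal (c\<^sub>2 * (d \<alpha>)\<^sup>2 * real n powr (2 * \<alpha> - 2) * ln (real n) ^ 3)" ..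
      qed
    qed
    with c1 c2 show "\<exists>c\<^sub>1>0. \<exists>c\<^sub>2>0. asymptotically_almost_surely (M2 \<alpha>) (\<lambda>n E.
           ereal (c\<^sub>1 * real n powr (2 * \<alpha> - 2) * ln (real n) ^ 2) < t_mix n E \<and>
           t_mix n E < ereal (c\<^sub>2 * (d \<alpha>)\<^sup>2 * real n powr (2 * \<alpha> - 2) * ln (real n) ^ 3))"
      by blast
  next
    assume "r \<noteq> 0 \<and> asymptotically_almost_surely (M2 \<alpha>) (\<lambda>n E. lazy {..<n} (P n E))"
    then have aas_lazy: "asymptotically_almost_surely (M2 \<alpha>) (\<lambda>n E. lazy {..<n} (P n E))" ..
    \<comment> \<open>From \<open>(1 - \<epsilon>) / 4 * w\<close>, linear in \<open>w\<close>
      because of the drift.\<close>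
    define c\<^sub>1 where "c\<^sub>1 = (1 - \<epsilon>) * gap_const / 8"
    have c1: "0 < c\<^sub>1" using assms g0 by (simp add: c\<^sub>1_def)
    have "asymptotically_almost_surely (M2 \<alpha>) (\<lambda>n E.
           ereal (c\<^sub>1 * real n powr (\<alpha> - 1) * ln (real n)) < t_mix n E \<and>
           t_mix n E < ereal (c\<^sub>2 * (d \<alpha>)\<^sup>2 * real n powr (2 * \<alpha> - 2) * ln (real n) ^ 3))"
    proof (rule aas_mono[OF aas_conj[OF aas_typical aas_lazy]])
      show "\<forall>\<^sub>F n in sequentially. \<forall>E\<in>set_pmf (M2 \<alpha> n).
        typical n E \<and> lazy {..<n} (P n E) \<longrightarrow>
           ereal (c\<^sub>1 * real n powr (\<alpha> - 1) * ln (real n)) < t_mix n E \<and>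
           t_mix n E < ereal (c\<^sub>2 * (d \<alpha>)\<^sup>2 * real n powr (2 * \<alpha> - 2) * ln (real n) ^ 3)"
        using eventually_mixing_conditions[OF assms(3,4) \<kappa>, of 0]
      proof (eventually_elim, intro ballI impI, elim conjE)
        fix n E
        assume lg: "large n" and n: "- 2 * ln \<epsilon> \<le> ln (real n)" "\<kappa>^2 \<le> L n ^ 2 * ln (real n)"
            "8 * real (w n) \<le> (1 - \<epsilon>) * real n"
          and E: "E \<in> set_pmf (M2 \<alpha> n)" "typical n E" "lazy {..<n} (P n E)"
        note lg' = lg[unfolded large_def]
        have w0: "0 < w n" using lg' by simp
        interpret C: blocked_cycle_chain n E q\<^sub>c q\<^sub>l r "d \<alpha>" "n div l n" "l n" "block n (l n)"
          using blocked_cycle_chainI[OF lg E(1) d1 assms(5-8)] E(2) by (auto simp: typical_def)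
        have P: "P n E = C.P" by (simp add: P_def C.P_def)
        have \<kappa>_eq: "\<kappa> = C.\<kappa>" by (simp add: \<kappa>_def C.\<kappa>_def)
        have ex: "C.expands (\<kappa> / (10 * real (l n)))"
          unfolding \<kappa>_eq using E(3) by (intro C.expands_of_lazy) (auto simp: lazy_def P)
        obtain x0 where x0: "w n \<le> x0" "x0 + w n < n"
            "\<And>x. x0 - w n \<le> x \<Longrightarrow> x \<le> x0 + w n \<Longrightarrow> long_range_degree E x = 0"
          using E(2) by (auto simp: typical_def gap_def)
        have "(1 - \<epsilon>) / 4 * (gap_const * L n / 2) \<le> (1 - \<epsilon>) / 4 * real (w n)"
          using assms lg' by (intro mult_left_mono) auto
        also have "(1 - \<epsilon>) / 4 * (gap_const * L n / 2) = c\<^sub>1 * L n"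
          by (simp add: c\<^sub>1_def)
        finally have t: "c\<^sub>1 * L n \<le> (1 - \<epsilon>) / 4 * real (w n)" .
        have "ereal (c\<^sub>1 * L n) < t_mix n E"
          unfolding t_mix_def P by (rule C.mixing_time_gt_general[OF ex w0 x0 n(3) assms(4) t])
        then have "ereal (c\<^sub>1 * real n powr (\<alpha> - 1) * ln (real n)) < t_mix n E"
          by (simp add: L_def mult.assoc)
        moreover have "t_mix n E < ereal (c\<^sub>2 * (d \<alpha>)\<^sup>2 * real n powr (2 * \<alpha> - 2) * ln (real n) ^ 3)"
          by (rule upper[OF lg n(1,2)]) (unfold P, rule C.doubly_stochastic_axioms, rule ex)
        ultimately show "ereal (c\<^sub>1 * real n powr (\<alpha> - 1) * ln (real n)) < t_mix n E \<and>
           t_mix n E < ereal (c\<^sub>2 * (d \<alpha>)\<^sup>2 * real n powr (2 * \<alpha> - 2) * ln (real n) ^ 3)" ..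
      qed
    qed
    with c1 c2 show "\<exists>c\<^sub>1>0. \<exists>c\<^sub>2>0. asymptotically_almost_surely (M2 \<alpha>) (\<lambda>n E.
           ereal (c\<^sub>1 * real n powr (\<alpha> - 1) * ln (real n)) < t_mix n E \<and>
           t_mix n E < ereal (c\<^sub>2 * (d \<alpha>)\<^sup>2 * real n powr (2 * \<alpha> - 2) * ln (real n) ^ 3))"
      by blast
  qed
qed

end
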